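(* Let $\mathbf{GL}^+_n(\mathbb R)$ be the group of real $n\times n$ matrices with positive determinant. Let $\Phi,\Psi:\mathbf{GL}^+_n(\mathbb R)\to\mathbb R^{n\times n}$ be the $\mathbf{SO}(n)$-invariant matrix-valued maps, where $\Phi:x\mapsto xx^t$, $\Phi=[\phi_{kl}]_{k,l=1}^n$, and the components $\psi_{kl}:\mathbf{GL}^+_n(\mathbb R)\to\mathbb R$ of $\Psi$ satisfy $$\psi_{kl}=\sqrt{\phi_{kk}\phi_{ll}-\phi_{kl}^2}.$$ If $k\neq l$, then the map $$(\phi_{kl}+i\psi_{kl})/\phi_{ll}:\mathbf{GL}^+_n(\mathbb R)\to\mathbb C$$ is a globally defined $\mathbb R^+\times\mathbf{SO}(n)$-invariant harmonic morphism on $\mathbf{GL}^+_n(\mathbb R)$, inducing a globally defined harmonic morphism on the irreducible Riemannian symmetric space $\mathbf{SL}_n(\mathbb R)/\mathbf{SO}(n)$.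
   Context: A map $\phi:(M,g)\to(N,h)$ between semi-Riemannian manifolds is a harmonic morphism if for every harmonic function $f:U\to\mathbb R$ on an open subset $U\subset N$ with $\phi^{-1}(U)\neq\emptyset$, the composition $f\circ\phi:\phi^{-1}(U)\to\mathbb R$ is harmonic. For $\phi:(M,g)\to\mathbb C$ this is equivalent to $\tau(\phi)=0$ and $\kappa(\phi,\phi)=0$, where $\tau$ is the Laplacian of $(M,g)$ (extended complex linearly to complex-valued functions) and $\kappa(\phi,\psi)=g(\mathrm{grad}(\phi),\mathrm{grad}(\psi))$ with $g$ extended complex bilinearly to $T^{\mathbb C}M$. $\mathbf{GL}^+_n(\mathbb R)$ carries the bi-invariant semi-Riemannian metric induced by the bilinear form $(X,Y)\mapsto\mathrm{trace}(XY)$ on its Lie algebra $\mathfrak{gl}_n(\mathbb R)$. One has the orthogonal decomposition $\mathfrak{gl}_n(\mathbb R)=\mathfrak{so}(n)\oplus\mathfrak p$ with $\mathfrak p$ the symmetric matrices; the restriction of the form to $\mathfrak p$ induces the $\mathbf{GL}^+_n(\mathbb R)$-invariant Riemannian metric on $\mathbf{GL}^+_n(\mathbb R)/\mathbf{SO}(n)$, and the isomorphism $\mathbb R^+\times\mathbf{SL}_n(\mathbb R)\to\mathbf{GL}^+_n(\mathbb R)$, $(r,x)\mapsto rx$, induces an isometry $\mathbb R^+\times\mathbf{SL}_n(\mathbb R)/\mathbf{SO}(n)\cong\mathbf{GL}^+_n(\mathbb R)/\mathbf{SO}(n)$ (the de Rham decomposition), which determines the metric on $\mathbf{SL}_n(\mathbb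 R)/\mathbf{SO}(n)$. Invariance under $\mathbf{SO}(n)$ means invariance under right multiplication $x\mapsto xk$, $k\in\mathbf{SO}(n)$; invariance under $\mathbb R^+$ means invariance under $x\mapsto rx$, $r>0$. The induced map on $\mathbf{SL}_n(\mathbb R)/\mathbf{SO}(n)$ sends $x\,\mathbf{SO}(n)$ to the value of the map at $x$. *)

theory Defs
  imports "HOL-Analysis.Analysis"
begin

section \<open>Semi-Riemannian geometry in local coordinates\<close>

text \<open>Differentiability class \<open>C\<^sup>k\<close> on an open subset of a Euclidean space.\<close>

primrec Ck_on ::
  "nat \<Rightarrow> ('e::euclidean_space \<Rightarrow> 'b::real_normed_vector) \<Rightarrow> 'e set \<Rightarrow> bool" where
  "Ck_on 0 f S \<longleftrightarrow> continuous_on S f"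
| "Ck_on (Suc k) f S \<longleftrightarrow> (\<forall>x\<in>S. f differentiable at x) \<and>
     (\<forall>v. Ck_on k (\<lambda>x. frechet_derivative f (at x) v) S)"

definition smooth_on ::
  "'e::euclidean_space set \<Rightarrow> ('e \<Rightarrow> 'b::real_normed_vector) \<Rightarrow> bool" where
  "smooth_on S f \<longleftrightarrow> (\<forall>k. Ck_on k f S)"

text \<open>A metric on an open subset of \<open>'e\<close> is a field \<open>g\<close> of nondegenerate symmetric bilinear
  forms, \<open>g x v w\<close> being the product of the tangent vectors \<open>v\<close> and \<open>w\<close> at \<open>x\<close>.\<close>

type_synonym 'e metric = "'e \<Rightarrow> 'e \<Rightarrow> 'e \<Rightarrow> real"

definition grad :: "'e::euclidean_space metric \<Rightarrow> ('e \<Rightarrow> real) \<Rightarrow> 'e \<Rightarrow> 'e" where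
  "grad g f x = (THE w. \<forall>v. g x w v = frechet_derivative f (at x) v)"

text \<open>The Levi-Civita derivative of the constant field \<open>w\<close> in direction \<open>v\<close>, given by the Koszul
  formula (Lie brackets of constant fields vanish).\<close>

definition christoffel :: "'e::euclidean_space metric \<Rightarrow> 'e \<Rightarrow> 'e \<Rightarrow> 'e \<Rightarrow> 'e" where
  "christoffel g x v w = (THE u. \<forall>z. 2 * g x u z =
       frechet_derivative (\<lambda>y. g y w z) (at x) v
     + frechet_derivative (\<lambda>y. g y v z) (at x) w
     - frechet_derivative (\<lambda>y. g y v w) (at x) z)"

definition levi_civita :: "'e::euclidean_space metric \<Rightarrow> ('e \<Rightarrow> 'e) \<Rightarrow> 'e \<Rightarrow> 'e \<Rightarrow> 'e" where
  "levi_civita g X x v = frechet_derivative X (at x) v + christoffel g x v (X x)"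

text \<open>The divergence is the trace of the endomorphism \<open>v \<mapsto> \<nabla>\<^sub>v X\<close>. The trace of an endomorphism does
  not depend on a metric, so it may be computed in the standard basis of \<open>'e\<close>.\<close>

definition divergence :: "'e::euclidean_space metric \<Rightarrow> ('e \<Rightarrow> 'e) \<Rightarrow> 'e \<Rightarrow> real" where
  "divergence g X x = (\<Sum>b\<in>Basis. levi_civita g X x b \<bullet> b)"

definition laplacian :: "'e::euclidean_space metric \<Rightarrow> ('e \<Rightarrow> real) \<Rightarrow> 'e \<Rightarrow> real" where
  "laplacian g f x = divergence g (grad g f) x"

section \<open>Manifolds and harmonic morphisms\<close>

text \<open>A semi-Riemannian manifold with points in \<open>'a\<close>, of dimension \<open>DIM('e)\<close>, is represented by a
  set of charts \<open>(V, p, g)\<close>: an open \<open>V \<subseteq> 'e\<close>, a parametrisation \<open>p\<close> that is injective on \<open>V\<close>,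
  and the metric \<open>g\<close> of the manifold read in the coordinates given by \<open>p\<close>.\<close>

type_synonym ('e, 'a) atlas = "('e set \<times> ('e \<Rightarrow> 'a) \<times> 'e metric) set"

definition points :: "('e::euclidean_space, 'a) atlas \<Rightarrow> 'a set" where
  "points M = (\<Union>(V, p, g)\<in>M. p ` V)"

definition open_in :: "('e::euclidean_space, 'a) atlas \<Rightarrow> 'a set \<Rightarrow> bool" where
  "open_in M U \<longleftrightarrow> U \<subseteq> points M \<and> (\<forall>(V, p, g)\<in>M. open (V \<inter> p -` U))"

definition smooth_map ::
  "('e::euclidean_space, 'a) atlas \<Rightarrow> ('f::euclidean_space, 'b) atlas \<Rightarrow> ('a \<Rightarrow> 'b) \<Rightarrow> bool" where
  "smooth_map M N F \<longleftrightarrow> F ` points M \<subseteq> points N \<and>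
     (\<forall>(V, p, g)\<in>M. \<forall>(W, q, h)\<in>N.
        open (V \<inter> (F \<circ> p) -` (q ` W)) \<and>
        smooth_on (V \<inter> (F \<circ> p) -` (q ` W)) (the_inv_into W q \<circ> F \<circ> p))"

definition harmonic_on :: "('e::euclidean_space, 'a) atlas \<Rightarrow> 'a set \<Rightarrow> ('a \<Rightarrow> real) \<Rightarrow> bool" where
  "harmonic_on M U f \<longleftrightarrow> (\<forall>(V, p, g)\<in>M. Ck_on 2 (f \<circ> p) (V \<inter> p -` U) \<and>
     (\<forall>v \<in> V \<inter> p -` U. laplacian g (f \<circ> p) v = 0))"

definition harmonic_morphism ::
  "('e::euclidean_space, 'a) atlas \<Rightarrow> ('f::euclidean_space, 'b) atlas \<Rightarrow> ('a \<Rightarrow> 'b) \<Rightarrow> bool" where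
  "harmonic_morphism M N F \<longleftrightarrow> smooth_map M N F \<and>
     (\<forall>U f. open_in N U \<and> points M \<inter> F -` U \<noteq> {} \<and> harmonic_on N U f
        \<longrightarrow> harmonic_on M (points M \<inter> F -` U) (f \<circ> F))"

section \<open>The manifolds\<close>

definition complex_plane :: "(complex, complex) atlas" where
  "complex_plane = {(UNIV, \<lambda>z. z, \<lambda>_ v w. v \<bullet> w)}"

definition GL_pos :: "(real^'n^'n) set" where
  "GL_pos = {x. det x > 0}"

definition SL :: "(real^'n^'n) set" where
  "SL = {x. det x = 1}"

definition SO :: "(real^'n^'n) set" where
  "SO = {k. rotation_matrix k}"

text \<open>The left-invariant (in fact bi-invariant) extension of the form \<open>trace (X Y)\<close> at the identity:
  a tangent vector \<open>a\<close> at \<open>x\<close> is the left translate of \<open>x\<^sup>-\<^sup>1 a\<close>.\<close>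

definition GL_metric :: "(real^'n^'n) metric" where
  "GL_metric x a b = trace ((matrix_inv x ** a) ** (matrix_inv x ** b))"

definition GL_manifold :: "(real^'n^'n, real^'n^'n) atlas" where
  "GL_manifold = {(GL_pos, \<lambda>x. x, GL_metric)}"

definition coset :: "real^'n^'n \<Rightarrow> (real^'n^'n) set" where
  "coset x = (\<lambda>k. x ** k) ` SO"

definition sym_part :: "real^'n^'n \<Rightarrow> real^'n^'n" where
  "sym_part A = (1/2) *\<^sub>R (A + transpose A)"

text \<open>The traceless part of \<open>\<pp>\<close>, identified with the tangent space of \<open>SL/SO\<close> at the base point.\<close>

definition sym_traceless :: "(real^'n^'n) set" where
  "sym_traceless = {A. transpose A = A \<and> trace A = 0}"

text \<open>Let \<open>\<sigma>\<close> be a smooth \<open>SL\<close>-valued map. The velocity of \<open>v \<mapsto> \<sigma> v SO\<close> in direction \<open>a\<close> is the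
  translate by \<open>\<sigma> v\<close> of the class of \<open>\<sigma>\<^sup>-\<^sup>1 d\<sigma>(a)\<close> modulo \<open>\<so>(n)\<close>, that is, of its \<open>\<pp>\<close>-component.
  The metric of \<open>SL/SO\<close> is the invariant metric of \<open>GL\<^sup>+/SO\<close> restricted to the factor \<open>SL/SO\<close>.\<close>

definition p_component ::
  "('m::euclidean_space \<Rightarrow> real^'n^'n) \<Rightarrow> 'm \<Rightarrow> 'm \<Rightarrow> real^'n^'n" where
  "p_component \<sigma> v a = sym_part (matrix_inv (\<sigma> v) ** frechet_derivative \<sigma> (at v) a)"

definition quotient_metric :: "('m::euclidean_space \<Rightarrow> real^'n^'n) \<Rightarrow> 'm metric" where
  "quotient_metric \<sigma> v a b = trace (p_component \<sigma> v a ** p_component \<sigma> v b)"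

text \<open>All parametrisations \<open>v \<mapsto> \<sigma> v SO\<close> with \<open>\<sigma>\<close> a smooth lift to \<open>SL\<close> that are injective and have
  bijective differential everywhere. For \<open>DIM('m) = dim sym_traceless\<close>, the dimension of \<open>SL/SO\<close>,
  they cover \<open>SL/SO\<close> (lemma \<open>points_SL_mod_SO\<close> below); for other \<open>'m\<close> there is no nonempty one.\<close>

definition SL_mod_SO :: "('m::euclidean_space, (real^'n^'n) set) atlas" where
  "SL_mod_SO = {(V, \<lambda>v. coset (\<sigma> v), quotient_metric \<sigma>) | V \<sigma>.
     open V \<and> smooth_on V \<sigma> \<and> \<sigma> ` V \<subseteq> SL \<and> inj_on (\<lambda>v. coset (\<sigma> v)) V \<and>
     (\<forall>v\<in>V. bij_betw (p_component \<sigma> v) UNIV sym_traceless)}"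

text \<open>The map on cosets induced by an \<open>SO\<close>-invariant map: its value at \<open>x SO\<close> is the common
  value of \<open>F\<close> on \<open>x SO\<close>.\<close>

definition induced :: "(real^'n^'n \<Rightarrow> 'b) \<Rightarrow> (real^'n^'n) set \<Rightarrow> 'b" where
  "induced F C = the_elem (F ` C)"

section \<open>The maps\<close>

definition Phi :: "real^'n^'n \<Rightarrow> real^'n^'n" where
  "Phi x = x ** transpose x"

definition Psi :: "real^'n^'n \<Rightarrow> real^'n^'n" where
  "Psi x = (\<chi> k l. sqrt (Phi x $ k $ k * Phi x $ l $ l - (Phi x $ k $ l)\<^sup>2))"

definition phi_psi_ratio :: "'n \<Rightarrow> 'n \<Rightarrow> real^'n^'n \<Rightarrow> complex" where
  "phi_psi_ratio k l x =
     (of_real (Phi x $ k $ l) + \<i> * of_real (Psi x $ k $ l)) / of_real (Phi x $ l $ l)"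

section \<open>The charts of \<open>SL/SO\<close> cover it\<close>

lemma Ck_on_cong:
  assumes "open S" "\<And>x. x \<in> S \<Longrightarrow> f x = g x" "Ck_on k f S"
  shows "Ck_on k g S"
  using assms(2,3)
proof (induction k arbitrary: f g)
  case 0
  then show ?case by (metis Ck_on.simps(1) continuous_on_cong)
next
  case (Suc k)
  have eq: "frechet_derivative g (at x) = frechet_derivative f (at x)" if "x \<in> S" for x
  proof -
    have "(g has_derivative D) (at x) \<longleftrightarrow> (f has_derivative D) (at x)" for D
      using has_derivative_transform_within_open[OF _ assms(1) that] Suc.prems(1) by metis
    then show ?thesis unfolding frechet_derivative_def by presburger
  qed
  have "g differentiable at x" if "x \<in> S" for x
    using Suc.prems that differentiable_def has_derivative_transform_within_open[OF _ assms(1) that]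
    by (metis Ck_on.simps(2))
  moreover have "Ck_on k (\<lambda>x. frechet_derivative g (at x) v) S" for v
    by (rule Suc.IH[of "\<lambda>x. frechet_derivative f (at x) v"]) (use Suc.prems eq in auto)
  ultimately show ?case by simp
qed

lemma Ck_on_SucI:
  assumes "open S" "\<And>x. x \<in> S \<Longrightarrow> (f has_derivative D x) (at x)"
    and "\<And>v. Ck_on k (\<lambda>x. D x v) S"
  shows "Ck_on (Suc k) f S"
proof -
  have "frechet_derivative f (at x) = D x" if "x \<in> S" for x
    using assms(2)[OF that] frechet_derivative_at by metis
  then have "Ck_on k (\<lambda>x. frechet_derivative f (at x) v) S" for v
    by (intro Ck_on_cong[OF assms(1) _ assms(3)[of v]]) simp
  then show ?thesis using assms(2) by (auto simp: differentiable_def)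
qed

lemma Ck_on_Suc_D: "Ck_on (Suc k) f S \<Longrightarrow> Ck_on k f S"
proof (induction k arbitrary: f)
  case 0
  then show ?case
    by (auto intro!: continuous_at_imp_continuous_on differentiable_imp_continuous_within)
next
  case (Suc k)
  then show ?case by (metis Ck_on.simps(2))
qed

lemma Ck_on_has_derivative:
  "Ck_on (Suc k) f S \<Longrightarrow> x \<in> S \<Longrightarrow> (f has_derivative frechet_derivative f (at x)) (at x)"
  by (simp add: frechet_derivative_works)

lemma Ck_on_const: "open S \<Longrightarrow> Ck_on k (\<lambda>_. c) S"
proof (induction k arbitrary: c)
  case (Suc k)
  show ?case by (rule Ck_on_SucI[of _ _ "\<lambda>_ _. 0"]) (use Suc in auto)
qed simp

lemma Ck_on_linear:
  assumes "open S" "bounded_linear f" shows "Ck_on k f S"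
proof (cases k)
  case 0
  then show ?thesis using assms linear_continuous_on by auto
next
  case (Suc j)
  show ?thesis unfolding Suc
    by (rule Ck_on_SucI[of _ _ "\<lambda>_. f"])
       (use assms Ck_on_const bounded_linear_imp_has_derivative in auto)
qed

lemma Ck_on_add:
  assumes "open S" "Ck_on k f S" "Ck_on k g S" shows "Ck_on k (\<lambda>x. f x + g x) S"
  using assms(2,3)
proof (induction k arbitrary: f g)
  case 0
  then show ?case by (auto intro: continuous_intros)
next
  case (Suc k)
  show ?case
    by (rule Ck_on_SucI[OF assms(1) has_derivative_add[OF
          Ck_on_has_derivative[OF Suc.prems(1)] Ck_on_has_derivative[OF Suc.prems(2)]]])
       (use Suc in auto)
qed

lemma Ck_on_bilinear:
  assumes "open S" "bounded_bilinear B" "Ck_on k f S" "Ck_on k g S"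
  shows "Ck_on k (\<lambda>x. B (f x) (g x)) S"
  using assms(3,4)
proof (induction k arbitrary: f g)
  case 0
  then show ?case using bounded_bilinear.continuous_on[OF assms(2)] by auto
next
  case (Suc k)
  show ?case
  proof (rule Ck_on_SucI[OF assms(1) bounded_bilinear.FDERIV[OF assms(2)
          Ck_on_has_derivative[OF Suc.prems(1)] Ck_on_has_derivative[OF Suc.prems(2)]]])
    show "Ck_on k (\<lambda>x. B (f x) (frechet_derivative g (at x) v)
                     + B (frechet_derivative f (at x) v) (g x)) S" for v
      by (intro Ck_on_add[OF assms(1)] Suc.IH) (use Suc.prems Ck_on_Suc_D in auto)
  qed
qed

lemma Ck_on_powr:
  fixes u :: "'e::euclidean_space \<Rightarrow> real"
  assumes "open S" "\<And>x. x \<in> S \<Longrightarrow> u x > 0" "Ck_on k u S"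
  shows "Ck_on k (\<lambda>x. u x powr c) S"
  using assms(3)
proof (induction k arbitrary: c)
  case 0
  have "\<forall>x\<in>S. u x \<noteq> 0" using assms(2) by fastforce
  then show ?case using 0 by (auto intro!: continuous_on_powr)
next
  case (Suc k)
  show ?case
  proof (rule Ck_on_SucI[OF assms(1)])
    fix x assume x: "x \<in> S"
    have "((\<lambda>y. y powr c) has_real_derivative c * u x powr (c - 1)) (at (u x))"
      using assms(2)[OF x] by (rule has_real_derivative_powr)
    from DERIV_compose_FDERIV[OF this Ck_on_has_derivative[OF Suc.prems x]]
    show "((\<lambda>x. u x powr c) has_derivative
        (\<lambda>v. frechet_derivative u (at x) v * (c * u x powr (c - 1)))) (at x)" .
  next
    fix v
    have "Ck_on k (\<lambda>x. frechet_derivative u (at x) v) S" using Suc.prems by simp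
    moreover have "Ck_on k (\<lambda>x. c * u x powr (c - 1)) S"
      by (intro Ck_on_bilinear[OF assms(1) bounded_bilinear_mult] Ck_on_const assms(1) Suc.IH
            Ck_on_Suc_D[OF Suc.prems])
    ultimately show "Ck_on k (\<lambda>x. frechet_derivative u (at x) v * (c * u x powr (c - 1))) S"
      by (rule Ck_on_bilinear[OF assms(1) bounded_bilinear_mult])
  qed
qed

lemma Ck_on_sum:
  assumes "open S" "finite I" "\<And>i. i \<in> I \<Longrightarrow> Ck_on k (f i) S"
  shows "Ck_on k (\<lambda>x. \<Sum>i\<in>I. f i x) S"
  using assms(2,3) by (induction I) (auto intro: Ck_on_add Ck_on_const assms(1))

lemma Ck_on_prod:
  fixes f :: "'i \<Rightarrow> 'e::euclidean_space \<Rightarrow> real"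
  assumes "open S" "finite I" "\<And>i. i \<in> I \<Longrightarrow> Ck_on k (f i) S"
  shows "Ck_on k (\<lambda>x. \<Prod>i\<in>I. f i x) S"
  using assms(2,3)
  by (induction I) (auto intro: Ck_on_bilinear[OF _ bounded_bilinear_mult] Ck_on_const assms(1))

lemma Ck_on_entry:
  fixes f :: "'e::euclidean_space \<Rightarrow> real^'m^'n"
  assumes "open S" "Ck_on k f S" shows "Ck_on k (\<lambda>x. f x $ i $ j) S"
proof -
  have "bounded_bilinear (\<lambda>(A::real^'m^'n) (c::real). c * A $ i $ j)"
    by (simp add: bilinear_conv_bounded_bilinear [symmetric] bilinear_def linear_iff algebra_simps)
  from Ck_on_bilinear[OF assms(1) this assms(2) Ck_on_const[OF assms(1), of k 1]]
  show ?thesis by simp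
qed

lemma Ck_on_det:
  fixes f :: "'e::euclidean_space \<Rightarrow> real^'n^'n"
  assumes "open S" "Ck_on k f S" shows "Ck_on k (\<lambda>x. det (f x)) S"
  unfolding det_def
  by (intro Ck_on_sum Ck_on_prod Ck_on_bilinear[OF _ bounded_bilinear_mult] Ck_on_const
        Ck_on_entry assms) auto

lemma has_derivative_det_1:
  "(det has_derivative trace) (at (mat 1 :: real^'n^'n))"
proof -
  let ?P = "{p. p permutes (UNIV::'n set)}"
  let ?I = "mat 1 :: real^'n^'n"
  define D where "D p Z = (\<Sum>i\<in>UNIV. Z $ i $ p i * (\<Prod>j\<in>UNIV - {i}. ?I $ j $ p j))"
    for p :: "'n \<Rightarrow> 'n" and Z :: "real^'n^'n"
  have "((\<lambda>A::real^'n^'n. \<Prod>i\<in>UNIV. A $ i $ p i) has_derivative D p) (at ?I)" for p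
  proof -
    have "((\<lambda>A::real^'n^'n. A $ i $ p i) has_derivative (\<lambda>Z. Z $ i $ p i)) (at ?I)" for i
      by (rule linear_imp_has_derivative) (simp add: linear_iff)
    from has_derivative_prod[of UNIV "\<lambda>i A. A $ i $ p i" "\<lambda>i Z. Z $ i $ p i" ?I UNIV, OF this]
    show ?thesis unfolding D_def by simp
  qed
  then have 1: "(det has_derivative (\<lambda>Z. \<Sum>p\<in>?P. of_int (sign p) * D p Z)) (at ?I)"
    unfolding det_def[abs_def] by (intro has_derivative_sum has_derivative_mult_right)
  have "D p Z = 0" if p: "p \<in> ?P" "p \<noteq> id" for p Z
  proof -
    from p obtain i where i: "p i \<noteq> i" by (auto simp: fun_eq_iff)
    have inj: "inj p" using p permutes_inj by auto
    then have i2: "p (p i) \<noteq> p i" using i by (auto dest: injD)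
    have "\<exists>j. j \<noteq> m \<and> p j \<noteq> j" for m using i i2 by metis
    then have "(\<Prod>j\<in>UNIV - {m}. ?I $ j $ p j) = 0" for m
      unfolding mat_def by simp (metis DiffI UNIV_I singletonD)
    then have "Z $ m $ p m * (\<Prod>j\<in>UNIV - {m}. ?I $ j $ p j) = 0" for m
      by (metis mult_zero_right)
    then show ?thesis unfolding D_def by (rule sum.neutral[OF ballI])
  qed
  then have "(\<Sum>p\<in>?P. of_int (sign p) * D p Z) = (\<Sum>p\<in>{id}. of_int (sign p) * D p Z)" for Z
    by (intro sum.mono_neutral_right) (auto simp: permutes_id finite_permutations)
  moreover have "D id Z = trace Z" for Z
    by (simp add: D_def trace_def mat_def)
  ultimately show ?thesis using 1 by (simp add: sign_id)
qed

lemma matrix_inv_mult: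
  fixes A :: "real^'n^'n"
  assumes "invertible A"
  shows "A ** matrix_inv A = mat 1" "matrix_inv A ** A = mat 1"
  using someI_ex[OF assms[unfolded invertible_def]] by (auto simp: matrix_inv_def)

lemma matrix_scaleR_mult:
  fixes A :: "real^'n^'m" and B :: "real^'p^'n"
  shows "(c *\<^sub>R A) ** B = c *\<^sub>R (A ** B)" "A ** (c *\<^sub>R B) = c *\<^sub>R (A ** B)"
  by (simp_all add: matrix_matrix_mult_def vec_eq_iff sum_distrib_left algebra_simps)

lemma matrix_mult_add_left:
  fixes A B :: "real^'n^'m" and C :: "real^'p^'n"
  shows "(A + B) ** C = A ** C + B ** C"
  by (simp add: matrix_matrix_mult_def vec_eq_iff sum.distrib algebra_simps)

lemma bounded_bilinear_matrix_mult:
  "bounded_bilinear ((**) :: real^'n^'m \<Rightarrow> real^'p^'n \<Rightarrow> _)"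
  by (simp add: bilinear_conv_bounded_bilinear [symmetric] bilinear_def linear_iff
      matrix_scaleR_mult matrix_add_ldistrib matrix_mult_add_left)

lemma has_derivative_det:
  fixes A :: "real^'n^'n"
  assumes "invertible A"
  shows "(det has_derivative (\<lambda>Z. det A * trace (matrix_inv A ** Z))) (at A)"
proof -
  have inv: "A ** matrix_inv A = mat 1" "matrix_inv A ** A = mat 1"
    using assms by (auto simp: matrix_inv_mult)
  have eq: "det = (\<lambda>B. det A * det (matrix_inv A ** B))"
    by (metis det_mul inv(1) matrix_mul_assoc matrix_mul_lid)
  have "linear (\<lambda>B. matrix_inv A ** B)"
    by (simp add: linear_iff matrix_add_ldistrib matrix_scaleR_mult)
  then have "((\<lambda>B. matrix_inv A ** B) has_derivative (\<lambda>B. matrix_inv A ** B)) (at A)"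
    by (rule linear_imp_has_derivative)
  from has_derivative_compose[OF this, of det trace] has_derivative_det_1
  have "((\<lambda>B. det (matrix_inv A ** B)) has_derivative (\<lambda>Z. trace (matrix_inv A ** Z))) (at A)"
    by (simp add: inv)
  then show ?thesis by (subst eq) (rule has_derivative_mult_right)
qed

lemma trace_scaleR: "trace (c *\<^sub>R (A::real^'n^'n)) = c * trace A"
  by (simp add: trace_def sum_distrib_left)

definition pos_def :: "real^'n^'n \<Rightarrow> bool" where
  "pos_def M \<longleftrightarrow> (\<forall>w. w \<noteq> 0 \<longrightarrow> w \<bullet> (M *v w) > 0)"

lemma trace_congruence:
  fixes Z M :: "real^'n^'n"
  assumes "transpose Z = Z"
  shows "trace (Z ** M ** Z) = (\<Sum>i\<in>UNIV. Z $ i \<bullet> (M *v Z $ i))"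
proof -
  have Z: "Z $ i $ j = Z $ j $ i" for i j using assms by (metis transpose_def vec_lambda_beta)
  have "(Z ** M ** Z) $ i $ i = Z $ i \<bullet> (M *v Z $ i)" for i
  proof -
    have "(Z ** M ** Z) $ i $ i = (Z ** (M ** Z)) $ i $ i" by (simp add: matrix_mul_assoc)
    also have "\<dots> = (\<Sum>j\<in>UNIV. Z $ i $ j * (\<Sum>k\<in>UNIV. M $ j $ k * Z $ k $ i))"
      by (simp add: matrix_matrix_mult_def)
    also have "\<dots> = Z $ i \<bullet> (M *v Z $ i)"
      by (simp add: inner_vec_def matrix_vector_mult_def Z[of _ i])
    finally show ?thesis .
  qed
  then show ?thesis by (simp add: trace_def)
qed

lemma sylvester_unique:
  fixes Z M M' :: "real^'n^'n"
  assumes "transpose Z = Z" "pos_def M" "pos_def M'" "Z ** M + M' ** Z = 0"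
  shows "Z = 0"
proof -
  have nn: "Z $ i \<bullet> (N *v Z $ i) \<ge> 0" if "pos_def N" for N i
    using that by (cases "Z $ i = 0") (auto simp: pos_def_def less_imp_le)
  have "0 = trace (Z ** (Z ** M + M' ** Z))" by (simp add: assms trace_def)
  also have "\<dots> = trace (Z ** M ** Z) + trace (Z ** M' ** Z)"
    using trace_mul_sym[of Z "Z ** M"]
    by (simp add: matrix_add_ldistrib trace_add matrix_mul_assoc)
  finally have "(\<Sum>i\<in>UNIV. Z $ i \<bullet> (M *v Z $ i)) + (\<Sum>i\<in>UNIV. Z $ i \<bullet> (M' *v Z $ i)) = 0"
    by (simp add: trace_congruence[OF assms(1)])
  moreover have "(\<Sum>i\<in>UNIV. Z $ i \<bullet> (M *v Z $ i)) \<ge> 0" "(\<Sum>i\<in>UNIV. Z $ i \<bullet> (M' *v Z $ i)) \<ge> 0"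
    by (auto intro!: sum_nonneg nn assms)
  ultimately have "(\<Sum>i\<in>UNIV. Z $ i \<bullet> (M *v Z $ i)) = 0" by linarith
  then have "Z $ i \<bullet> (M *v Z $ i) = 0" for i
    by (subst (asm) sum_nonneg_eq_0_iff) (use nn assms in auto)
  then have "Z $ i = 0" for i using assms(2) by (metis order_less_irrefl pos_def_def)
  then show ?thesis by (simp add: vec_eq_iff)
qed

lemma pos_def_1_plus:
  fixes X :: "real^'n^'n"
  assumes "norm X < 1"
  shows "pos_def (mat 1 + X)"
  unfolding pos_def_def
proof (intro allI impI)
  fix w :: "real^'n" assume w: "w \<noteq> 0"
  have "norm (X *v w) \<le> L2_set (\<lambda>i. norm (X $ i) * norm w) UNIV"
    unfolding norm_vec_def[of "X *v w"]
    by (rule L2_set_mono)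
       (auto simp: matrix_vector_mul_component Cauchy_Schwarz_ineq2)
  also have "\<dots> = norm X * norm w"
    by (simp add: norm_vec_def[of X] L2_set_left_distrib[symmetric])
  finally have "\<bar>w \<bullet> (X *v w)\<bar> \<le> norm w * (norm X * norm w)"
    by (meson Cauchy_Schwarz_ineq2 mult_left_mono norm_ge_zero order_trans)
  also have "\<dots> < norm w * norm w" using w assms by simp
  also have "\<dots> = w \<bullet> w" by (simp add: norm_eq_sqrt_inner)
  finally show "w \<bullet> ((mat 1 + X) *v w) > 0"
    by (simp add: matrix_vector_mult_add_rdistrib inner_add_right)
qed

lemma pos_def_det_nz: "pos_def (M::real^'n^'n) \<Longrightarrow> det M \<noteq> 0"
proof
  assume "pos_def M" "det M = 0"
  then have "\<not> invertible M" by (simp add: invertible_det_nz)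
  then obtain w where "w \<noteq> 0" "M *v w = 0"
    using invertible_left_inverse matrix_left_invertible_ker by blast
  with \<open>pos_def M\<close> show False by (metis inner_zero_right order_less_irrefl pos_def_def)
qed

lemma det_1_plus_pos:
  fixes X :: "real^'n^'n"
  assumes "norm X < 1"
  shows "det (mat 1 + X) > 0"
proof (rule ccontr)
  assume neg: "\<not> ?thesis"
  have "continuous_on {0..1} (\<lambda>t::real. det (mat 1 + t *\<^sub>R X))"
    unfolding det_def by (intro continuous_intros)
  moreover have "det (mat 1 + 1 *\<^sub>R X) \<le> 0" "0 \<le> det (mat 1 + 0 *\<^sub>R X)" using neg by auto
  ultimately obtain t where t: "0 \<le> t" "t \<le> 1" "det (mat 1 + t *\<^sub>R X) = 0"
    using IVT2'[of "\<lambda>t. det (mat 1 + t *\<^sub>R X)" 1 0 0] by auto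
  have "norm (t *\<^sub>R X) < 1" using t assms
    by (simp add: mult_le_one less_le_trans) (metis mult_left_le_one_le norm_ge_zero order_le_less_trans)
  then show False using pos_def_1_plus pos_def_det_nz t(3) by blast
qed

lemma subspace_sym_traceless: "subspace (sym_traceless :: (real^'n^'n) set)"
  unfolding subspace_def sym_traceless_def
  by (auto simp: trace_add trace_scaleR transpose_scalar)
     (auto simp: trace_def transpose_def vec_eq_iff)

lemma det_scaleR: "det (c *\<^sub>R (A::real^'n^'n)) = c ^ CARD('n) * det A"
  by (simp add: det_def prod.distrib sum_distrib_left algebra_simps)

lemma transpose_add: "transpose (A + B) = transpose A + transpose (B :: real^'n^'m)"
  by (simp add: transpose_def vec_eq_iff)

lemma coset_eq_imp:
  fixes x y :: "real^'n^'n"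
  assumes "coset x = coset y"
  shows "x ** transpose x = y ** transpose y"
proof -
  have "(mat 1 :: real^'n^'n) \<in> SO" by (simp add: SO_def rotation_matrix_def orthogonal_matrix_id)
  then have "x \<in> coset x" unfolding coset_def by (metis imageI matrix_mul_rid)
  then obtain K where K: "K \<in> SO" "x = y ** K" using assms by (auto simp: coset_def)
  then have "K ** transpose K = mat 1"
    by (simp add: SO_def rotation_matrix_def orthogonal_matrix_def)
  then show ?thesis unfolding K(2)
    by (metis matrix_mul_assoc matrix_mul_rid matrix_transpose_mul)
qed

lemma SL_mod_SO_chart_at:
  fixes x :: "real^'n^'n"
  assumes dim: "DIM('m::euclidean_space) = dim (sym_traceless :: (real^'n^'n) set)"
    and x: "x \<in> SL"
  shows "coset x \<in> points (SL_mod_SO :: ('m, (real^'n^'n) set) atlas)"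
proof -
  obtain T :: "'m \<Rightarrow> real^'n^'n" where T: "linear T" "range T = sym_traceless"
    and normT: "\<And>v. norm (T v) = norm v"
    using isometries_subspaces[of "UNIV::'m set" "sym_traceless :: (real^'n^'n) set"]
      subspace_sym_traceless dim by (metis UNIV_I dim_UNIV subspace_UNIV)
  have T0: "T v = 0 \<longleftrightarrow> v = 0" for v by (metis normT norm_eq_zero)
  have symT: "transpose (T v) = T v" "trace (T v) = 0" for v
    using T(2) by (auto simp: sym_traceless_def)
  let ?n = "CARD('n)"
  define V :: "'m set" where "V = ball 0 1"
  define B where "B v = mat 1 + T v" for v
  define s where "s v = det (B v) powr (-1 / real ?n)" for v
  define \<sigma> where "\<sigma> v = s v *\<^sub>R (x ** B v)" for v
  have openV: "open V" by (simp add: V_def)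
  have detx: "det x = 1" using x by (simp add: SL_def)
  then have "invertible x" by (simp add: invertible_det_nz)
  note xi = matrix_inv_mult[OF this]
  have B_pd: "pos_def (B v)" and det_pos: "det (B v) > 0" if "v \<in> V" for v
    using that pos_def_1_plus[of "T v"] det_1_plus_pos[of "T v"] by (auto simp: V_def B_def normT)
  have s_pos: "s v > 0" if "v \<in> V" for v using det_pos[OF that] by (simp add: s_def)
  have symB: "transpose (B v) = B v" for v by (simp add: B_def transpose_add symT)
  have trB: "trace (B v) = real ?n" for v by (simp add: B_def trace_add symT trace_I)
  have "T 0 = 0" using T0 by blast
  then have \<sigma>0: "\<sigma> 0 = x" by (simp add: \<sigma>_def s_def B_def)

  have "smooth_on V \<sigma>"
    unfolding smooth_on_def
  proof
    fix k
    have "Ck_on k B V"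
      unfolding B_def[abs_def]
      by (intro Ck_on_add Ck_on_const Ck_on_linear openV linear_conv_bounded_linear[THEN iffD1] T)
    then show "Ck_on k \<sigma> V"
      unfolding \<sigma>_def[abs_def] s_def
      by (intro Ck_on_bilinear[OF openV bounded_bilinear_scaleR] Ck_on_powr Ck_on_det openV det_pos
          Ck_on_bilinear[OF openV bounded_bilinear_matrix_mult] Ck_on_const)
  qed
  moreover have "\<sigma> ` V \<subseteq> SL"
  proof -
    have "det (\<sigma> v) = 1" if "v \<in> V" for v
    proof -
      have "s v ^ ?n = s v powr real ?n" using s_pos[OF that] by (simp add: powr_realpow)
      also have "\<dots> = det (B v) powr (-1)" by (simp add: s_def powr_powr)
      also have "\<dots> = 1 / det (B v)" using det_pos[OF that] by (simp add: powr_minus_divide)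
      finally show ?thesis using det_pos[OF that] by (simp add: \<sigma>_def det_scaleR det_mul detx)
    qed
    then show ?thesis by (auto simp: SL_def)
  qed
  moreover have "inj_on (\<lambda>v. coset (\<sigma> v)) V"
  proof (rule inj_onI)
    fix u v assume uv: "u \<in> V" "v \<in> V" "coset (\<sigma> u) = coset (\<sigma> v)"
    define M where "M w = s w *\<^sub>R B w" for w
    have \<sigma>M: "\<sigma> w = x ** M w" for w by (simp add: \<sigma>_def M_def matrix_scaleR_mult)
    have symM: "transpose (M w) = M w" for w by (simp add: M_def transpose_scalar symB)
    have M_pd: "pos_def (M w)" if "w \<in> V" for w
      using B_pd[OF that] s_pos[OF that]
      by (simp add: pos_def_def M_def scaleR_matrix_vector_assoc[symmetric])
    have P: "\<sigma> w ** transpose (\<sigma> w) = x ** (M w ** M w) ** transpose x" for w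
      by (simp add: \<sigma>M matrix_transpose_mul symM matrix_mul_assoc)
    have tx: "transpose x ** transpose (matrix_inv x) = mat 1"
      by (metis xi(2) matrix_transpose_mul transpose_mat)
    have Q: "matrix_inv x ** (\<sigma> w ** transpose (\<sigma> w)) ** transpose (matrix_inv x) = M w ** M w" for w
    proof -
      have "matrix_inv x ** (\<sigma> w ** transpose (\<sigma> w)) ** transpose (matrix_inv x)
          = (matrix_inv x ** x) ** (M w ** M w) ** (transpose x ** transpose (matrix_inv x))"
        unfolding P by (simp only: matrix_mul_assoc)
      then show ?thesis by (simp add: tx xi)
    qed
    have MM: "M u ** M u = M v ** M v" using Q[of u] Q[of v] coset_eq_imp[OF uv(3)] by simp
    have "(M u - M v) ** M u + M v ** (M u - M v) = 0"
      using MM by (simp add: bounded_bilinear.diff_left[OF bounded_bilinear_matrix_mult]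
          bounded_bilinear.diff_right[OF bounded_bilinear_matrix_mult])
    moreover have "transpose (M u - M v) = M u - M v"
      using symM[of u] symM[of v] by (auto simp: transpose_def vec_eq_iff)
    ultimately have "M u - M v = 0" using sylvester_unique M_pd uv by blast
    then have eq: "M u = M v" by simp
    then have "trace (M u) = trace (M v)" by simp
    then have "s u = s v" by (simp add: M_def trace_scaleR trB)
    then have "B u = B v" using eq s_pos[OF uv(2)] by (simp add: M_def)
    then have "T (u - v) = 0" by (simp add: B_def linear_diff[OF T(1)])
    then show "u = v" by (simp add: T0)
  qed
  moreover have "bij_betw (p_component \<sigma> v) UNIV sym_traceless" if v: "v \<in> V" for v
  proof -
    define Bi where "Bi = matrix_inv (B v)"
    have "invertible (B v)" using det_pos[OF v] by (simp add: invertible_det_nz)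
    note Bi = matrix_inv_mult[OF this, folded Bi_def] and ddet = has_derivative_det[OF this, folded Bi_def]
    define \<alpha> where "\<alpha> a = - trace (Bi ** T a) / real ?n" for a
    have dB: "(B has_derivative T) (at v)"
      unfolding B_def[abs_def]
      using has_derivative_add[OF has_derivative_const linear_imp_has_derivative[OF T(1)]] by simp
    have ds: "(s has_derivative (\<lambda>a. s v * \<alpha> a)) (at v)"
    proof -
      have "((\<lambda>y. y powr (-1 / real ?n)) has_real_derivative
              (-1 / real ?n) * det (B v) powr (-1 / real ?n - 1)) (at (det (B v)))"
        using det_pos[OF v] by (rule has_real_derivative_powr)
      from DERIV_compose_FDERIV[OF this has_derivative_compose[OF dB ddet]]
      have "(s has_derivative (\<lambda>a. det (B v) * trace (Bi ** T a) *
          ((-1 / real ?n) * det (B v) powr (-1 / real ?n - 1)))) (at v)"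
        unfolding s_def[abs_def] .
      moreover have "s v = det (B v) * det (B v) powr (-1 / real ?n - 1)"
        using det_pos[OF v] unfolding s_def by (simp add: powr_diff)
      then have "s v * \<alpha> a = det (B v) * trace (Bi ** T a) *
          ((-1 / real ?n) * det (B v) powr (-1 / real ?n - 1))" for a
        unfolding \<alpha>_def by simp
      ultimately show ?thesis by simp
    qed
    have d\<sigma>: "(\<sigma> has_derivative (\<lambda>a. s v *\<^sub>R (x ** T a) + (s v * \<alpha> a) *\<^sub>R (x ** B v))) (at v)"
    proof -
      have "((\<lambda>v. x ** B v) has_derivative (\<lambda>a. x ** T a)) (at v)"
        using bounded_bilinear.FDERIV[OF bounded_bilinear_matrix_mult has_derivative_const dB, of x]
          bounded_bilinear.zero_left[OF bounded_bilinear_matrix_mult] by simp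
      from has_derivative_scaleR[OF ds this] show ?thesis unfolding \<sigma>_def[abs_def] .
    qed
    have fr: "frechet_derivative \<sigma> (at v) =
        (\<lambda>a. s v *\<^sub>R (x ** T a) + (s v * \<alpha> a) *\<^sub>R (x ** B v))"
      using frechet_derivative_at[OF d\<sigma>] by simp
    have inv: "matrix_inv (\<sigma> v) = (1 / s v) *\<^sub>R (Bi ** matrix_inv x)"
    proof -
      let ?J = "(1 / s v) *\<^sub>R (Bi ** matrix_inv x)"
      have "?J ** \<sigma> v = Bi ** (matrix_inv x ** x) ** B v"
        using s_pos[OF v] by (simp add: \<sigma>_def matrix_scaleR_mult matrix_mul_assoc)
      then have J: "?J ** \<sigma> v = mat 1" by (simp add: xi Bi)
      then have "\<sigma> v ** ?J = mat 1" using matrix_left_right_inverse by blast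
      then have "invertible (\<sigma> v)" using J invertible_def by blast
      then show ?thesis
        by (metis J matrix_inv_mult(1) matrix_mul_assoc matrix_mul_lid matrix_mul_rid)
    qed
    have "matrix_inv (\<sigma> v) ** frechet_derivative \<sigma> (at v) a = Bi ** T a + \<alpha> a *\<^sub>R mat 1" for a
    proof -
      have "(Bi ** matrix_inv x) ** (x ** C) = Bi ** C" for C :: "real^'n^'n"
        by (metis xi(2) matrix_mul_assoc matrix_mul_rid)
      then show ?thesis using s_pos[OF v]
        by (simp add: inv fr matrix_add_ldistrib matrix_scaleR_mult Bi scaleR_add_right)
    qed
    then have pc: "p_component \<sigma> v a = sym_part (Bi ** T a) + \<alpha> a *\<^sub>R mat 1" for a
      by (simp add: p_component_def sym_part_def transpose_add transpose_scalar algebra_simps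
          flip: scaleR_add_left)
    have lin: "linear (p_component \<sigma> v)"
      unfolding p_component_def sym_part_def
      using has_derivative_linear[OF d\<sigma>, folded fr]
      by (simp add: linear_iff matrix_add_ldistrib matrix_scaleR_mult transpose_add transpose_scalar
          scaleR_add_right)
    have sub: "range (p_component \<sigma> v) \<subseteq> sym_traceless"
    proof -
      have "transpose (p_component \<sigma> v a) = p_component \<sigma> v a" for a
        by (simp add: p_component_def sym_part_def transpose_add transpose_scalar add.commute)
      moreover have "trace (transpose A) = trace A" for A :: "real^'n^'n"
        by (simp add: trace_def transpose_def)
      then have "trace (p_component \<sigma> v a) = 0" for a
        by (simp add: pc sym_part_def trace_add trace_sub trace_scaleR trace_I \<alpha>_def)
      ultimately show ?thesis by (auto simp: sym_traceless_def)
    qed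
    have inj: "inj (p_component \<sigma> v)"
    proof (subst linear_injective_0[OF lin], intro allI impI)
      fix a assume "p_component \<sigma> v a = 0"
      then have "2 *\<^sub>R (sym_part (Bi ** T a) + \<alpha> a *\<^sub>R mat 1) = 0" by (simp add: pc)
      then have 0: "Bi ** T a + T a ** transpose Bi + (2 * \<alpha> a) *\<^sub>R mat 1 = 0"
        by (simp add: sym_part_def scaleR_add_right matrix_transpose_mul symT)
      have tBi: "transpose Bi ** B v = mat 1"
        by (metis Bi(1) matrix_transpose_mul symB transpose_mat)
      have "0 = B v ** (Bi ** T a + T a ** transpose Bi + (2 * \<alpha> a) *\<^sub>R mat 1) ** B v"
        by (simp only: 0) (simp add: matrix_matrix_mult_def vec_eq_iff)
      also have "\<dots> = (B v ** Bi) ** T a ** B v + B v ** T a ** (transpose Bi ** B v)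
            + (2 * \<alpha> a) *\<^sub>R (B v ** B v)"
        by (simp add: matrix_add_ldistrib matrix_mult_add_left matrix_scaleR_mult matrix_mul_assoc)
      finally have *: "T a ** B v + B v ** T a + (2 * \<alpha> a) *\<^sub>R (B v ** B v) = 0"
        by (simp add: Bi tBi)
      define Z where "Z = T a + \<alpha> a *\<^sub>R B v"
      have "Z ** B v + B v ** Z = T a ** B v + B v ** T a + (\<alpha> a + \<alpha> a) *\<^sub>R (B v ** B v)"
        unfolding scaleR_add_left
        by (simp add: Z_def matrix_add_ldistrib matrix_mult_add_left matrix_scaleR_mult)
      then have "Z ** B v + B v ** Z = 0" using * by simp
      moreover have "transpose Z = Z" by (simp add: Z_def transpose_add transpose_scalar symT symB)
      ultimately have "Z = 0" using sylvester_unique B_pd[OF v] by blast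
      moreover have "trace Z = \<alpha> a * real ?n"
        by (simp add: Z_def trace_add trace_scaleR symT trB)
      ultimately have "\<alpha> a = 0" by (simp add: trace_def)
      then have "T a = 0" using \<open>Z = 0\<close> by (simp add: Z_def)
      then show "a = 0" by (simp add: T0)
    qed
    have "dim (range (p_component \<sigma> v)) = DIM('m)"
      using dim_image_eq[OF lin, of UNIV] inj by simp
    then have "range (p_component \<sigma> v) = sym_traceless"
      by (intro subspace_dim_equal subspace_sym_traceless linear_subspace_image[OF lin] sub)
         (auto simp: dim)
    then show ?thesis using inj by (simp add: bij_betw_def)
  qed
  ultimately have "(V, \<lambda>v. coset (\<sigma> v), quotient_metric \<sigma>) \<in> SL_mod_SO"
    unfolding SL_mod_SO_def using openV by blast
  moreover have "coset x \<in> (\<lambda>v. coset (\<sigma> v)) ` V" by (rule image_eqI[of _ _ 0]) (auto simp: \<sigma>0 V_def)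
  ultimately show ?thesis unfolding points_def by blast
qed

lemma points_SL_mod_SO:
  assumes "DIM('m::euclidean_space) = dim (sym_traceless :: (real^'n^'n) set)"
  shows "points (SL_mod_SO :: ('m, (real^'n^'n) set) atlas) = coset ` SL"
proof
  show "points (SL_mod_SO :: ('m, (real^'n^'n) set) atlas) \<subseteq> coset ` SL"
    unfolding points_def SL_mod_SO_def by auto
  show "coset ` SL \<subseteq> points (SL_mod_SO :: ('m, (real^'n^'n) set) atlas)"
    using SL_mod_SO_chart_at[OF assms] by auto
qed

end

theory Submission
  imports Defs
begin

text \<open>Put \<open>P = x x\<^sup>t\<close>. The ratio \<open>z = (\<phi>\<^bsub>kl\<^esub> + i \<psi>\<^bsub>kl\<^esub>) / \<phi>\<^bsub>ll\<^esub>\<close> is a root of \<open>P\<^bsub>ll\<^esub> z\<^sup>2 - 2 P\<^bsub>kl\<^esub> z + P\<^bsub>kk\<^esub> = 0\<close>,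
  that is, the complex vector \<open>w = x\<^sub>k - z x\<^sub>l\<close> formed from the rows of \<open>x\<close> is isotropic. The
  Laplacian is the trace of the Hessian in a frame whose members change \<open>P\<close> by \<open>2 x E x\<^sup>t\<close> to first
  and \<open>4 x E\<^sup>2 x\<^sup>t\<close> to second order, \<open>E\<close> running through a tight frame of the symmetric matrices
  (for \<open>GL\<^sup>+\<close>) or of the traceless ones (for \<open>SL/SO\<close>). Differentiating the quadratic equation twice
  writes \<open>\<kappa>(z, z)\<close> and \<open>\<tau>(z)\<close> as multiples of \<open>w \<bullet> w = 0\<close>, and the chain rule then gives
  harmonicity of \<open>f \<circ> z\<close> for harmonic \<open>f\<close>.\<close>

section \<open>Second derivatives\<close>

text \<open>\<open>grad\<close> and \<open>christoffel\<close> are definite descriptions, so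
  existence and uniqueness must first be derived from nondegeneracy of the metric; even the
  differentiability of a gradient has to be proved, as that of the solution of a linear system. The
  Hessian form of the Laplacian asks for frames at one point only, and such a frame may be larger
  than a basis: it has to satisfy just the reconstruction identity. The trace form on
  \<open>GL_pos\<close> is indefinite, hence a pair of dual frames instead of an orthonormal one.

  Both metrics are pullbacks of the bi-invariant trace metric: by the identity of
  \<open>GL_pos\<close>, and, with factor 1/4, by P = \<sigma> \<sigma>^t for a lift \<sigma> of a
  chart of SL/SO. Passing to P removes the dependence on the lift, because P is constant on cosets.
  One Koszul computation then serves both spaces, provided that the ambient connection applied to P
  stays tangent to the image; this holds because P stays symmetric with determinant 1.\<close>

definition second_derivative ::
  "('e::euclidean_space \<Rightarrow> 'b::real_normed_vector) \<Rightarrow> 'e \<Rightarrow> 'e \<Rightarrow> 'e \<Rightarrow> 'b" where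
  "second_derivative f x a b = frechet_derivative (\<lambda>y. frechet_derivative f (at y) a) (at x) b"

lemma frechet_derivative_cong_open:
  assumes "open S" "x \<in> S" "\<And>y. y \<in> S \<Longrightarrow> f y = g y"
  shows "frechet_derivative f (at x) = frechet_derivative g (at x)"
proof -
  have "(f has_derivative D) (at x) \<longleftrightarrow> (g has_derivative D) (at x)" for D
    using has_derivative_transform_within_open[OF _ assms(1,2)] assms(3) by metis
  then show ?thesis unfolding frechet_derivative_def by presburger
qed

lemma differentiable_cong_open:
  assumes "open S" "x \<in> S" "\<And>y. y \<in> S \<Longrightarrow> f y = g y" "f differentiable at x"
  shows "g differentiable at x"
  using assms has_derivative_transform_within_open[OF _ assms(1,2)] unfolding differentiable_def
  by metis

lemma Ck_on_2_iff:
  "Ck_on 2 f S \<longleftrightarrow> (\<forall>x\<in>S. f differentiable at x) \<and>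
     (\<forall>a. \<forall>x\<in>S. (\<lambda>y. frechet_derivative f (at y) a) differentiable at x) \<and>
     (\<forall>a b. continuous_on S (\<lambda>x. second_derivative f x a b))"
  by (auto simp: numeral_2_eq_2 second_derivative_def)

lemma has_derivative_frechet: "f differentiable at x \<Longrightarrow>
    (f has_derivative frechet_derivative f (at x)) (at x)"
  by (simp add: frechet_derivative_works)

lemma linear_second_derivative_right:
  assumes "Ck_on 2 f S" "x \<in> S" shows "linear (second_derivative f x a)"
  using assms linear_frechet_derivative unfolding second_derivative_def[abs_def] Ck_on_2_iff by blast

text \<open>The direction \<open>a\<close> sits inside the function that is differentiated, so
  linearity in it comes from linearity of the first derivative at all points near
  \<open>x\<close>.\<close>

lemma linear_second_derivative_left:
  assumes "open S" "Ck_on 2 f S" "x \<in> S" shows "linear (\<lambda>a. second_derivative f x a b)"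
proof -
  let ?D = "\<lambda>a y. frechet_derivative f (at y) a"
  have lin: "linear (frechet_derivative f (at y))" if "y \<in> S" for y
    using assms(2) that linear_frechet_derivative by (auto simp: Ck_on_2_iff)
  have d: "(?D a has_derivative second_derivative f x a) (at x)" for a
    using assms(2,3) has_derivative_frechet[of "?D a" x]
    unfolding Ck_on_2_iff second_derivative_def[abs_def] by blast
  show ?thesis
  proof (rule linearI)
    fix a c :: 'a
    have "(?D (a + c) has_derivative (\<lambda>b. second_derivative f x a b + second_derivative f x c b)) (at x)"
      using has_derivative_transform_within_open[OF has_derivative_add[OF d[of a] d[of c]] assms(1,3),
          of "?D (a + c)"] linear_add[OF lin] by auto
    from frechet_derivative_at[OF this]
    show "second_derivative f x (a + c) b = second_derivative f x a b + second_derivative f x c b"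
      by (metis second_derivative_def)
  next
    fix r :: real and a :: 'a
    have "(?D (r *\<^sub>R a) has_derivative (\<lambda>b. r *\<^sub>R second_derivative f x a b)) (at x)"
      using has_derivative_transform_within_open[OF has_derivative_scaleR_right[OF d[of a], of r] assms(1,3),
          of "?D (r *\<^sub>R a)"] linear_scale[OF lin] by auto
    from frechet_derivative_at[OF this]
    show "second_derivative f x (r *\<^sub>R a) b = r *\<^sub>R second_derivative f x a b"
      by (metis second_derivative_def)
  qed
qed

text \<open>Mean value theorem twice: along \<open>a\<close> for the difference \<open>G\<close>,
  then along \<open>b\<close> for the derivative in direction \<open>a\<close>. The second
  difference is symmetric in \<open>a\<close> and \<open>b\<close>, which gives Schwarz's theorem
  below.\<close>

lemma second_difference_mean_value:
  fixes f :: "'e::euclidean_space \<Rightarrow> real"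
  assumes "Ck_on 2 f S" "h > 0"
    and "\<And>s t. s \<in> {0..h} \<Longrightarrow> t \<in> {0..h} \<Longrightarrow> x + s *\<^sub>R a + t *\<^sub>R b \<in> S"
  obtains s t where "s \<in> {0..h}" "t \<in> {0..h}"
    "f (x + h *\<^sub>R a + h *\<^sub>R b) - f (x + h *\<^sub>R a) - f (x + h *\<^sub>R b) + f x
       = h * (h * second_derivative f (x + s *\<^sub>R a + t *\<^sub>R b) a b)"
proof -
  define G where "G s = f (x + s *\<^sub>R a + h *\<^sub>R b) - f (x + s *\<^sub>R a + 0 *\<^sub>R b)" for s
  have d1: "(f has_derivative frechet_derivative f (at y)) (at y)" if "y \<in> S" for y
    using assms(1) that by (auto simp: Ck_on_2_iff has_derivative_frechet)
  have d2: "((\<lambda>y. frechet_derivative f (at y) a) has_derivative second_derivative f y a) (at y)"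
    if "y \<in> S" for y
    using assms(1) that has_derivative_frechet[of "\<lambda>y. frechet_derivative f (at y) a" y]
    unfolding second_derivative_def[abs_def] by (auto simp: Ck_on_2_iff)
  have dG: "((\<lambda>s. f (x + s *\<^sub>R a + t *\<^sub>R b)) has_derivative
      (\<lambda>\<tau>. \<tau> * frechet_derivative f (at (x + s *\<^sub>R a + t *\<^sub>R b)) a)) (at s)"
    if "s \<in> {0..h}" "t \<in> {0..h}" for s t
  proof -
    have "((\<lambda>s. x + s *\<^sub>R a + t *\<^sub>R b) has_derivative (\<lambda>\<tau>. \<tau> *\<^sub>R a)) (at s)"
      by (auto intro!: derivative_eq_intros)
    from has_derivative_compose[OF this d1[OF assms(3)[OF that]]]
    show ?thesis
      using linear_scale[OF has_derivative_linear[OF d1[OF assms(3)[OF that]]]] by simp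
  qed
  have dG': "(G has_real_derivative frechet_derivative f (at (x + s *\<^sub>R a + h *\<^sub>R b)) a
      - frechet_derivative f (at (x + s *\<^sub>R a + 0 *\<^sub>R b)) a) (at s)" if "0 \<le> s" "s \<le> h" for s
    using has_derivative_diff[OF dG[of s h] dG[of s 0]] that assms(2)
    unfolding G_def[abs_def] has_field_derivative_def
    by (simp add: right_diff_distrib[symmetric] mult_commute_abs)
  have "\<exists>s. 0 < s \<and> s < h \<and> G h - G 0 = (h - 0) * (frechet_derivative f (at (x + s *\<^sub>R a + h *\<^sub>R b)) a
      - frechet_derivative f (at (x + s *\<^sub>R a + 0 *\<^sub>R b)) a)"
    using assms(2)
    by (intro MVT2 dG') auto
  then obtain s where s: "0 < s" "s < h" "G h - G 0 = h * (frechet_derivative f (at (x + s *\<^sub>R a + h *\<^sub>R b)) a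
      - frechet_derivative f (at (x + s *\<^sub>R a + 0 *\<^sub>R b)) a)" by auto
  have "((\<lambda>t. frechet_derivative f (at (x + s *\<^sub>R a + t *\<^sub>R b)) a) has_real_derivative
      second_derivative f (x + s *\<^sub>R a + t *\<^sub>R b) a b) (at t)" if "t \<in> {0..h}" for t
  proof -
    have p: "x + s *\<^sub>R a + t *\<^sub>R b \<in> S" using assms(3) s that by auto
    have "((\<lambda>t. x + s *\<^sub>R a + t *\<^sub>R b) has_derivative (\<lambda>\<tau>. \<tau> *\<^sub>R b)) (at t)"
      by (auto intro!: derivative_eq_intros)
    from has_derivative_compose[OF this d2[OF p]]
    show ?thesis using linear_scale[OF has_derivative_linear[OF d2[OF p]]]
      by (simp add: has_field_derivative_def mult_commute_abs)
  qed
  then have "\<exists>t. 0 < t \<and> t < h \<and> frechet_derivative f (at (x + s *\<^sub>R a + h *\<^sub>R b)) a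
      - frechet_derivative f (at (x + s *\<^sub>R a + 0 *\<^sub>R b)) a
      = (h - 0) * second_derivative f (x + s *\<^sub>R a + t *\<^sub>R b) a b"
    using assms(2) by (intro MVT2) auto
  then obtain t where "0 < t" "t < h" "frechet_derivative f (at (x + s *\<^sub>R a + h *\<^sub>R b)) a
      - frechet_derivative f (at (x + s *\<^sub>R a + 0 *\<^sub>R b)) a
      = h * second_derivative f (x + s *\<^sub>R a + t *\<^sub>R b) a b" by auto
  then show ?thesis using s by (intro that[of s t]) (auto simp: G_def algebra_simps)
qed

lemma second_derivative_symmetric_real:
  fixes f :: "'e::euclidean_space \<Rightarrow> real"
  assumes "open S" "Ck_on 2 f S" "x \<in> S"
  shows "second_derivative f x a b = second_derivative f x b a"
proof (rule ccontr)
  assume ne: "\<not> ?thesis"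
  \<comment> \<open>Half the assumed gap: two errors below \<open>e\<close> add up to less than the
    gap itself.\<close>
  define e where "e = \<bar>second_derivative f x a b - second_derivative f x b a\<bar> / 2"
  have e: "e > 0" using ne by (simp add: e_def)
  have near: "\<exists>d>0. \<forall>y. dist y x < d \<longrightarrow> y \<in> S \<and> \<bar>second_derivative f y u w - second_derivative f x u w\<bar> < e"
    for u w
  proof -
    have "continuous (at x) (\<lambda>y. second_derivative f y u w)"
      using assms by (auto simp: Ck_on_2_iff continuous_on_eq_continuous_at)
    then obtain d1 where "d1 > 0" "\<And>y. dist y x < d1 \<Longrightarrow>
        \<bar>second_derivative f y u w - second_derivative f x u w\<bar> < e"
      using e unfolding continuous_at_eps_delta dist_real_def by (metis dist_commute)
    moreover obtain d2 where "d2 > 0" "\<And>y. dist y x < d2 \<Longrightarrow> y \<in> S"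
      using assms(1,3) unfolding open_dist by blast
    ultimately show ?thesis by (intro exI[of _ "min d1 d2"]) auto
  qed
  obtain d where d: "d > 0" "\<And>y. dist y x < d \<Longrightarrow> y \<in> S"
      "\<And>y. dist y x < d \<Longrightarrow> \<bar>second_derivative f y a b - second_derivative f x a b\<bar> < e"
      "\<And>y. dist y x < d \<Longrightarrow> \<bar>second_derivative f y b a - second_derivative f x b a\<bar> < e"
  proof -
    obtain d1 d2 where "d1 > 0" "d2 > 0"
      "\<forall>y. dist y x < d1 \<longrightarrow> y \<in> S \<and> \<bar>second_derivative f y a b - second_derivative f x a b\<bar> < e"
      "\<forall>y. dist y x < d2 \<longrightarrow> y \<in> S \<and> \<bar>second_derivative f y b a - second_derivative f x b a\<bar> < e"
      using near[of a b] near[of b a] by blast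
    then show ?thesis by (intro that[of "min d1 d2"]) auto
  qed
  \<comment> \<open>Keeps the whole parallelogram within \<open>d / 2\<close> of \<open>x\<close>;
    the summand 1 guards against \<open>a = b = 0\<close>.\<close>
  define h where "h = d / (2 * (norm a + norm b + 1))"
  have h: "h > 0" using d(1) by (simp add: h_def add_nonneg_pos)
  have close: "dist (x + s *\<^sub>R a + t *\<^sub>R b) x < d" if "s \<in> {0..h}" "t \<in> {0..h}" for s t
  proof -
    have "dist (x + s *\<^sub>R a + t *\<^sub>R b) x \<le> norm (s *\<^sub>R a) + norm (t *\<^sub>R b)"
      by (simp add: dist_norm norm_triangle_ineq add.assoc del: norm_scaleR)
    also have "\<dots> \<le> h * norm a + h * norm b"
      using that by (intro add_mono) (auto intro: mult_right_mono)
    also have "\<dots> \<le> h * (norm a + norm b + 1)" using h by (simp add: algebra_simps)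
    also have "\<dots> = d / 2"
    proof -
      have "norm a + norm b + 1 > 0" using norm_ge_zero[of a] norm_ge_zero[of b] by linarith
      then show ?thesis unfolding h_def times_divide_eq_left by (subst nonzero_divide_eq_eq) auto
    qed
    also have "\<dots> < d" using d(1) by simp
    finally show ?thesis .
  qed
  have comm: "x + s *\<^sub>R b + t *\<^sub>R a = x + t *\<^sub>R a + s *\<^sub>R b" for s t by simp
  obtain s t where st: "s \<in> {0..h}" "t \<in> {0..h}"
    "f (x + h *\<^sub>R a + h *\<^sub>R b) - f (x + h *\<^sub>R a) - f (x + h *\<^sub>R b) + f x
       = h * (h * second_derivative f (x + s *\<^sub>R a + t *\<^sub>R b) a b)"
    using second_difference_mean_value[OF assms(2) h, of x a b] close d(2) by metis
  obtain s' t' where st': "s' \<in> {0..h}" "t' \<in> {0..h}"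
    "f (x + h *\<^sub>R b + h *\<^sub>R a) - f (x + h *\<^sub>R b) - f (x + h *\<^sub>R a) + f x
       = h * (h * second_derivative f (x + s' *\<^sub>R b + t' *\<^sub>R a) b a)"
    using second_difference_mean_value[OF assms(2) h, of x b a] close d(2) comm by metis
  have "h * (h * second_derivative f (x + s *\<^sub>R a + t *\<^sub>R b) a b) =
      h * (h * second_derivative f (x + s' *\<^sub>R b + t' *\<^sub>R a) b a)"
    unfolding st(3)[symmetric] st'(3)[symmetric] comm[of h h] by simp
  then have "second_derivative f (x + s *\<^sub>R a + t *\<^sub>R b) a b = second_derivative f (x + t' *\<^sub>R a + s' *\<^sub>R b) b a"
    using h by (simp add: comm)
  moreover have "\<bar>second_derivative f (x + s *\<^sub>R a + t *\<^sub>R b) a b - second_derivative f x a b\<bar> < e"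
    by (intro d close st)
  moreover have "\<bar>second_derivative f (x + t' *\<^sub>R a + s' *\<^sub>R b) b a - second_derivative f x b a\<bar> < e"
    by (intro d close st')
  ultimately have "\<bar>second_derivative f x a b - second_derivative f x b a\<bar> < 2 * e" by linarith
  then show False by (simp add: e_def)
qed

section \<open>Linear images and the chain rule of second order\<close>

lemma Ck_on_bounded_linear:
  assumes "open S" "bounded_linear T" "Ck_on k f S"
  shows "Ck_on k (\<lambda>x. T (f x)) S"
proof -
  have "bounded_bilinear (\<lambda>v (c::real). c *\<^sub>R T v)"
    using bounded_bilinear.comp1[OF bounded_bilinear.flip[OF bounded_bilinear_scaleR] assms(2)] .
  from Ck_on_bilinear[OF assms(1) this assms(3) Ck_on_const[OF assms(1), of k 1]]
  show ?thesis by simp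
qed

lemma frechet_derivative_bounded_linear:
  assumes "bounded_linear T" "f differentiable at x"
  shows "frechet_derivative (\<lambda>x. T (f x)) (at x) a = T (frechet_derivative f (at x) a)"
  using frechet_derivative_at[OF bounded_linear.has_derivative[OF assms(1)
        has_derivative_frechet[OF assms(2)]]] by metis

lemma second_derivative_bounded_linear:
  assumes "open S" "bounded_linear T" "Ck_on 2 f S" "x \<in> S"
  shows "second_derivative (\<lambda>x. T (f x)) x a b = T (second_derivative f x a b)"
proof -
  have "frechet_derivative (\<lambda>y. frechet_derivative (\<lambda>x. T (f x)) (at y) a) (at x)
      = frechet_derivative (\<lambda>y. T (frechet_derivative f (at y) a)) (at x)"
    using assms by (intro frechet_derivative_cong_open[OF assms(1,4)] frechet_derivative_bounded_linear)
      (auto simp: Ck_on_2_iff)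
  then show ?thesis
    using assms frechet_derivative_bounded_linear[OF assms(2), of "\<lambda>y. frechet_derivative f (at y) a" x]
    by (auto simp: second_derivative_def Ck_on_2_iff)
qed

text \<open>Coordinatewise, since the mean value argument is for real values.\<close>

lemma second_derivative_symmetric:
  fixes f :: "'e::euclidean_space \<Rightarrow> 'b::euclidean_space"
  assumes "open S" "Ck_on 2 f S" "x \<in> S"
  shows "second_derivative f x a b = second_derivative f x b a"
proof (rule euclidean_eqI)
  fix c :: 'b assume "c \<in> Basis"
  note bl = bounded_linear_inner_left[of c]
  show "second_derivative f x a b \<bullet> c = second_derivative f x b a \<bullet> c"
    using second_derivative_symmetric_real[OF assms(1) Ck_on_bounded_linear[OF assms(1) bl assms(2)] assms(3)]
      second_derivative_bounded_linear[OF assms(1) bl assms(2,3)] by metis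
qed

lemma Ck_on_subset: "Ck_on k f S \<Longrightarrow> T \<subseteq> S \<Longrightarrow> Ck_on k f T"
  by (induction k arbitrary: f) (auto intro: continuous_on_subset)

lemma linear_eq_sum_Basis:
  fixes a :: "'a::euclidean_space"
  assumes "linear f" shows "f a = (\<Sum>b\<in>Basis. (a \<bullet> b) *\<^sub>R f b)"
  by (subst euclidean_representation[symmetric, of a])
     (simp only: linear_sum[OF assms] linear_scale[OF assms])

lemma Ck_on_compose:
  fixes f :: "'e::euclidean_space \<Rightarrow> 'b::real_normed_vector" and u :: "'d::euclidean_space \<Rightarrow> 'e"
  assumes "open S" "open T" "u ` S \<subseteq> T" "Ck_on k f T" "Ck_on k u S"
  shows "Ck_on k (\<lambda>x. f (u x)) S"
  using assms(4,5)
proof (induction k arbitrary: f)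
  case 0
  then show ?case using assms(3) continuous_on_compose2 by auto
next
  case (Suc k)
  \<comment> \<open>The chain rule over a basis: \<open>Ck_on\<close> speaks of derivatives in fixed
    directions, whereas the direction \<open>frechet_derivative u (at x) a\<close> moves with
    \<open>x\<close>.\<close>
  let ?D = "\<lambda>x a. \<Sum>b\<in>Basis. (frechet_derivative u (at x) a \<bullet> b) *\<^sub>R frechet_derivative f (at (u x)) b"
  show ?case
  proof (rule Ck_on_SucI[OF assms(1)])
    fix x assume x: "x \<in> S"
    then have "u x \<in> T" using assms(3) by auto
    note df = Ck_on_has_derivative[OF Suc.prems(1) this]
    show "((\<lambda>x. f (u x)) has_derivative ?D x) (at x)"
      by (rule has_derivative_eq_rhs[OF has_derivative_compose[OF Ck_on_has_derivative[OF Suc.prems(2) x] df]])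
         (rule ext, rule linear_eq_sum_Basis[OF has_derivative_linear[OF df]])
  next
    fix a
    have "Ck_on k (\<lambda>x. frechet_derivative u (at x) a \<bullet> b) S" for b
      using Suc.prems by (intro Ck_on_bounded_linear[OF assms(1) bounded_linear_inner_left]) auto
    moreover have "Ck_on k (\<lambda>x. frechet_derivative f (at (u x)) b) S" for b
      using Suc.prems Ck_on_Suc_D by (intro Suc.IH) auto
    ultimately show "Ck_on k (\<lambda>x. ?D x a) S"
      by (intro Ck_on_sum[OF assms(1)] Ck_on_bilinear[OF assms(1) bounded_bilinear_scaleR]) auto
  qed
qed

lemma frechet_derivative_compose:
  assumes "f differentiable at (u x)" "u differentiable at x"
  shows "frechet_derivative (\<lambda>x. f (u x)) (at x) a = frechet_derivative f (at (u x)) (frechet_derivative u (at x) a)"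
  using frechet_derivative_at[OF has_derivative_compose[OF has_derivative_frechet[OF assms(2)]
        has_derivative_frechet[OF assms(1)]]] by metis

text \<open>Expanding the moving direction in a basis lets the product rule act on its coefficients;
  linearity then reassembles the two sums.\<close>

lemma second_derivative_compose:
  fixes f :: "'e::euclidean_space \<Rightarrow> 'b::real_normed_vector" and u :: "'d::euclidean_space \<Rightarrow> 'e"
  assumes "open S" "open T" "u ` S \<subseteq> T" "Ck_on 2 f T" "Ck_on 2 u S" "x \<in> S"
  shows "second_derivative (\<lambda>x. f (u x)) x a b =
    second_derivative f (u x) (frechet_derivative u (at x) a) (frechet_derivative u (at x) b)
    + frechet_derivative f (at (u x)) (second_derivative u x a b)"
proof -
  let ?U = "\<lambda>y. frechet_derivative u (at y) a"
  have uT: "u y \<in> T" if "y \<in> S" for y using assms(3) that by auto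
  have lin: "linear (frechet_derivative f (at z))" if "z \<in> T" for z
    using assms(4) that linear_frechet_derivative by (auto simp: Ck_on_2_iff)
  have "second_derivative (\<lambda>x. f (u x)) x a =
      frechet_derivative (\<lambda>y. \<Sum>c\<in>Basis. (?U y \<bullet> c) *\<^sub>R frechet_derivative f (at (u y)) c) (at x)"
    unfolding second_derivative_def[abs_def]
  proof (rule frechet_derivative_cong_open[OF assms(1,6)])
    fix y assume y: "y \<in> S"
    have "frechet_derivative (\<lambda>x. f (u x)) (at y) a = frechet_derivative f (at (u y)) (?U y)"
      using assms(4,5) y uT by (intro frechet_derivative_compose) (auto simp: Ck_on_2_iff)
    also have "\<dots> = (\<Sum>c\<in>Basis. (?U y \<bullet> c) *\<^sub>R frechet_derivative f (at (u y)) c)"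
      by (rule linear_eq_sum_Basis[OF lin[OF uT[OF y]]])
    finally show "frechet_derivative (\<lambda>x. f (u x)) (at y) a =
        (\<Sum>c\<in>Basis. (?U y \<bullet> c) *\<^sub>R frechet_derivative f (at (u y)) c)" .
  qed
  also have "\<dots> = (\<lambda>b. \<Sum>c\<in>Basis. (?U x \<bullet> c) *\<^sub>R second_derivative f (u x) c (frechet_derivative u (at x) b)
      + (second_derivative u x a b \<bullet> c) *\<^sub>R frechet_derivative f (at (u x)) c)"
  proof (rule frechet_derivative_at[symmetric], rule has_derivative_sum, rule has_derivative_scaleR)
    fix c :: 'e
    have U: "(?U has_derivative second_derivative u x a) (at x)"
      using assms(5,6) has_derivative_frechet[of ?U x]
      unfolding second_derivative_def[abs_def] Ck_on_2_iff by blast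
    show "((\<lambda>x. ?U x \<bullet> c) has_derivative (\<lambda>b. second_derivative u x a b \<bullet> c)) (at x)"
      by (rule bounded_linear.has_derivative[OF bounded_linear_inner_left U])
    have "((\<lambda>z. frechet_derivative f (at z) c) has_derivative second_derivative f (u x) c) (at (u x))"
      using assms(4) uT[OF assms(6)] has_derivative_frechet[of "\<lambda>z. frechet_derivative f (at z) c" "u x"]
      unfolding second_derivative_def[abs_def] Ck_on_2_iff by blast
    moreover have "(u has_derivative frechet_derivative u (at x)) (at x)"
      using assms(5,6) by (auto simp: Ck_on_2_iff has_derivative_frechet)
    ultimately show "((\<lambda>x. frechet_derivative f (at (u x)) c) has_derivative
        (\<lambda>b. second_derivative f (u x) c (frechet_derivative u (at x) b))) (at x)"
      using has_derivative_compose by blast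
  qed
  finally have "second_derivative (\<lambda>x. f (u x)) x a b =
      (\<Sum>c\<in>Basis. (?U x \<bullet> c) *\<^sub>R second_derivative f (u x) c (frechet_derivative u (at x) b))
      + (\<Sum>c\<in>Basis. (second_derivative u x a b \<bullet> c) *\<^sub>R frechet_derivative f (at (u x)) c)"
    by (simp only: sum.distrib)
  then show ?thesis
    using linear_eq_sum_Basis[OF lin[OF uT[OF assms(6)]], of "second_derivative u x a b"]
      linear_eq_sum_Basis[OF linear_second_derivative_left[OF assms(2,4) uT[OF assms(6)]], of "?U x"
        "frechet_derivative u (at x) b"] by simp
qed

text \<open>Implicit differentiation for linear systems. \<open>K\<close> inverts \<open>L x\<close>
  on the left, so \<open>R\<close> approximates the increment of \<open>X\<close>; the error is at
  most \<open>M y\<close> times that increment, and \<open>M y\<close> tends to 0. Used for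
  gradients and for matrix inverses.\<close>

lemma differentiable_linear_solution:
  fixes L :: "'d::real_normed_vector \<Rightarrow> 'e::euclidean_space \<Rightarrow> 'f::euclidean_space"
  assumes "open S" "x \<in> S" and lin: "\<And>y. y \<in> S \<Longrightarrow> linear (L y)"
    and dL: "\<And>w. (\<lambda>y. L y w) differentiable at x" and inj: "\<And>w. L x w = 0 \<Longrightarrow> w = 0"
    and sol: "\<And>y. y \<in> S \<Longrightarrow> L y (X y) = r y" and dr: "r differentiable at x"
  shows "X differentiable at x"
proof -
  have "inj (L x)" using inj lin[OF assms(2)] by (simp add: linear_injective_0)
  then obtain K where K: "linear K" "K \<circ> L x = id"
    using linear_injective_left_inverse[OF lin[OF assms(2)]] by blast
  have KL: "K (L x w) = w" for w using K(2) by (simp add: fun_eq_iff)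
  have dK: "(\<lambda>y. K (h y)) differentiable at x" if "h differentiable at x" for h :: "'d \<Rightarrow> 'f"
    using that K(1) bounded_linear.has_derivative[of K h]
    unfolding differentiable_def linear_conv_bounded_linear by blast
  \<comment> \<open>For \<open>y\<close> in \<open>S\<close> this is
    \<open>K (L y (X y - X x))\<close>, which would be the increment itself if \<open>L y\<close>
    were \<open>L x\<close>.\<close>
  define R where "R y = K (r y - L y (X x))" for y
  have "R differentiable at x"
    unfolding R_def by (intro dK differentiable_diff dr dL)
  then obtain R' where R': "(R has_derivative R') (at x)" by (auto simp: differentiable_def)
  have Rx: "R x = 0" using sol[OF assms(2)] linear_0[OF K(1)] by (simp add: R_def)
  define M where "M y = (\<Sum>b\<in>Basis. norm (K (L y b) - b))" for y
  have bound: "norm (K (L y w) - w) \<le> M y * norm w" if y: "y \<in> S" for y w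
  proof -
    have l: "linear (\<lambda>w. K (L y w) - w)"
      using linear_compose_sub[OF linear_compose[OF lin[OF y] K(1)] linear_id] by (simp add: comp_def id_def)
    have "norm (K (L y w) - w) = norm (\<Sum>b\<in>Basis. (w \<bullet> b) *\<^sub>R (K (L y b) - b))"
      by (subst linear_eq_sum_Basis[OF l, of w]) rule
    also have "\<dots> \<le> (\<Sum>b\<in>Basis. norm ((w \<bullet> b) *\<^sub>R (K (L y b) - b)))" by (rule norm_sum)
    also have "\<dots> \<le> (\<Sum>b\<in>Basis. norm w * norm (K (L y b) - b))"
      by (intro sum_mono) (auto intro!: mult_right_mono simp: Basis_le_norm)
    finally show ?thesis by (simp add: M_def sum_distrib_left mult.commute)
  qed
  have "(M \<longlongrightarrow> (\<Sum>b\<in>Basis. norm (K (L x b) - b))) (at x)"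
    unfolding M_def
    by (intro tendsto_sum tendsto_norm tendsto_diff tendsto_const)
       (use differentiable_imp_continuous_within[OF dK[OF dL]] continuous_at in blast)
  then have M0: "(M \<longlongrightarrow> 0) (at x)" by (simp add: KL)
  have step: "X y - X x - R y = - (K (L y (X y - X x)) - (X y - X x))" if y: "y \<in> S" for y
    using sol[OF y] by (simp add: R_def linear_diff[OF K(1)] linear_diff[OF lin[OF y]])
  have ev: "\<forall>\<^sub>F y in at x. norm (X y - X x - R y) \<le> 2 * M y * norm (R y)"
  proof -
    \<comment> \<open>Below 1/2 the increment on the right can be absorbed, which bounds it by
      \<open>2 * norm (R y)\<close>.\<close>
    have "\<forall>\<^sub>F y in at x. M y < 1/2" using M0 by (rule order_tendstoD) simp
    moreover have "\<forall>\<^sub>F y in at x. y \<in> S" using assms(1,2) by (rule eventually_at_in_open')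
    ultimately show ?thesis
    proof eventually_elim
      case (elim y)
      have 1: "norm (X y - X x - R y) \<le> M y * norm (X y - X x)"
        using bound[OF elim(2), of "X y - X x"] step[OF elim(2)] by (simp add: norm_minus_commute)
      also have "\<dots> \<le> 1/2 * norm (X y - X x)" using elim by (intro mult_right_mono) auto
      finally have "norm (X y - X x) \<le> 2 * norm (R y)"
        using norm_triangle_ineq2[of "X y - X x" "R y"] by linarith
      moreover have "M y \<ge> 0" by (simp add: M_def sum_nonneg)
      ultimately have "M y * norm (X y - X x) \<le> M y * (2 * norm (R y))" by (rule mult_left_mono)
      with 1 show ?case by (simp add: mult_ac)
    qed
  qed
  note bl = has_derivative_bounded_linear[OF R']
  have "(X has_derivative R') (at x)"
    unfolding has_derivative_iff_norm
  proof (intro conjI bl)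
    let ?q = "\<lambda>y. norm (R y - R x - R' (y - x)) / norm (y - x)"
    let ?h = "\<lambda>y. ?q y + 2 * M y * (?q y + onorm R')"
    have q: "(?q \<longlongrightarrow> 0) (at x)" using R' by (simp add: has_derivative_iff_norm)
    have "(?h \<longlongrightarrow> 0 + 2 * 0 * (0 + onorm R')) (at x)" by (intro tendsto_intros q M0)
    then have h: "(?h \<longlongrightarrow> 0) (at x)" by simp
    show "((\<lambda>y. norm (X y - X x - R' (y - x)) / norm (y - x)) \<longlongrightarrow> 0) (at x)"
    proof (rule Lim_null_comparison[OF _ h])
      have "\<forall>\<^sub>F y in at x. y \<noteq> x" by (simp add: eventually_at_filter)
      with ev show "\<forall>\<^sub>F y in at x. norm (norm (X y - X x - R' (y - x)) / norm (y - x)) \<le> ?h y"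
      proof eventually_elim
        case (elim y)
        have M: "M y \<ge> 0" by (simp add: M_def sum_nonneg)
        have "norm (R y) \<le> norm (R y - R' (y - x)) + norm (R' (y - x))"
          using norm_triangle_ineq[of "R y - R' (y - x)" "R' (y - x)"] by simp
        also have "\<dots> \<le> norm (R y - R' (y - x)) + onorm R' * norm (y - x)"
          using onorm[OF bl] by simp
        finally have "2 * M y * norm (R y)
            \<le> 2 * M y * (norm (R y - R' (y - x)) + onorm R' * norm (y - x))"
          using M by (intro mult_left_mono) auto
        moreover have "norm (X y - X x - R' (y - x)) \<le> norm (X y - X x - R y) + norm (R y - R' (y - x))"
          using norm_triangle_ineq[of "X y - X x - R y" "R y - R' (y - x)"] by simp
        ultimately have "norm (X y - X x - R' (y - x)) \<le> norm (R y - R' (y - x))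
            + 2 * M y * (norm (R y - R' (y - x)) + onorm R' * norm (y - x))" using elim(1) by linarith
        moreover have "norm (y - x) > 0" using elim(2) by simp
        ultimately show ?case by (simp add: Rx field_simps)
      qed
    qed
  qed
  then show ?thesis by (auto simp: differentiable_def)
qed

section \<open>The Laplacian in a frame\<close>

text \<open>The families \<open>e\<close> and \<open>e'\<close> are dual frames at the single point \<open>v\<close>; \<open>\<Gamma> a b\<close> is the Levi-Civita
  derivative at \<open>v\<close> of the constant field \<open>b\<close> in direction \<open>a\<close>.\<close>

locale framed_metric =
  fixes V :: "'e::euclidean_space set" and g :: "'e metric" and v :: 'e
    and I :: "'i set" and e e' :: "'i \<Rightarrow> 'e" and \<Gamma> :: "'e \<Rightarrow> 'e \<Rightarrow> 'e"
  assumes open_V: "open V" and v_in: "v \<in> V"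
    and metric_linear: "y \<in> V \<Longrightarrow> linear (g y a)"
    and metric_sym: "y \<in> V \<Longrightarrow> g y a b = g y b a"
    and metric_nondegenerate: "y \<in> V \<Longrightarrow> (\<And>b. g y a b = 0) \<Longrightarrow> a = 0"
    and metric_differentiable: "(\<lambda>y. g y a b) differentiable at v"
    and finite_frame: "finite I"
    and frame: "w = (\<Sum>i\<in>I. g v w (e' i) *\<^sub>R e i)"
    and koszul: "2 * g v (\<Gamma> a b) z =
       frechet_derivative (\<lambda>y. g y b z) (at v) a
     + frechet_derivative (\<lambda>y. g y a z) (at v) b
     - frechet_derivative (\<lambda>y. g y a b) (at v) z"
begin

lemma metric_linear_left: "y \<in> V \<Longrightarrow> linear (\<lambda>a. g y a b)"
  using metric_linear[of y b] metric_sym by (simp add: linear_iff)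

lemma metric_expand: "y \<in> V \<Longrightarrow> g y c w = (\<Sum>b\<in>Basis. (c \<bullet> b) * g y b w)"
  using linear_eq_sum_Basis[of "\<lambda>a. g y a w" c] metric_linear_left by simp

lemma grad_eq:
  assumes "y \<in> V" "u differentiable at y"
  shows "g y (grad g u y) z = frechet_derivative u (at y) z"
proof -
  \<comment> \<open>The map from vectors to covectors, written in coordinates as an endomorphism:
    nondegeneracy makes it injective, equal dimensions make it surjective, so the description in
    \<open>grad\<close> has exactly one solution.\<close>
  define L where "L w = (\<Sum>b\<in>Basis. g y w b *\<^sub>R b)" for w
  have L: "linear L"
    unfolding L_def using metric_linear_left[OF assms(1)]
    by (auto simp: linear_iff algebra_simps sum.distrib scaleR_sum_right)
  have Lb: "L w \<bullet> b = g y w b" if "b \<in> Basis" for w b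
    using that by (simp add: L_def inner_sum_left inner_Basis if_distrib cong: if_cong)
  have eqI: "w = w'" if "\<And>b. b \<in> Basis \<Longrightarrow> g y w b = g y w' b" for w w'
  proof -
    have "g y (w - w') z = 0" for z
    proof -
      have "g y (w - w') b = 0" if "b \<in> Basis" for b
        using that \<open>\<And>b. b \<in> Basis \<Longrightarrow> g y w b = g y w' b\<close>
        by (simp add: linear_diff[OF metric_linear_left[OF assms(1)]])
      then show ?thesis by (subst linear_eq_sum_Basis[OF metric_linear[OF assms(1)]]) simp
    qed
    then show ?thesis using metric_nondegenerate[OF assms(1)] by (metis eq_iff_diff_eq_0)
  qed
  have "inj L" by (rule injI, rule eqI) (metis Lb)
  with linear_injective_imp_surjective[OF L] have "surj L" by simp
  then obtain w where w: "L w = (\<Sum>b\<in>Basis. frechet_derivative u (at y) b *\<^sub>R b)" by (metis surjD)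
  have lin: "linear (frechet_derivative u (at y))" using assms(2) by (rule linear_frechet_derivative)
  have "g y w b = frechet_derivative u (at y) b" if "b \<in> Basis" for b
    using Lb[OF that, of w] that unfolding w
    by (simp add: inner_sum_left inner_Basis if_distrib cong: if_cong)
  then have "g y w z = frechet_derivative u (at y) z" for z
    by (subst linear_eq_sum_Basis[OF metric_linear[OF assms(1)]],
        subst linear_eq_sum_Basis[OF lin]) simp
  then have "\<forall>z. g y (grad g u y) z = frechet_derivative u (at y) z"
    unfolding grad_def
    by (intro theI[where P = "\<lambda>w. \<forall>z. g y w z = frechet_derivative u (at y) z" and a = w])
       (simp_all add: eqI)
  then show ?thesis by blast
qed

lemma christoffel_eq: "christoffel g v a b = \<Gamma> a b"
  unfolding christoffel_def
proof (rule the_equality)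
  show "\<forall>z. 2 * g v (\<Gamma> a b) z =
       frechet_derivative (\<lambda>y. g y b z) (at v) a
     + frechet_derivative (\<lambda>y. g y a z) (at v) b
     - frechet_derivative (\<lambda>y. g y a b) (at v) z" using koszul by blast
  fix u assume u: "\<forall>z. 2 * g v u z =
       frechet_derivative (\<lambda>y. g y b z) (at v) a
     + frechet_derivative (\<lambda>y. g y a z) (at v) b
     - frechet_derivative (\<lambda>y. g y a b) (at v) z"
  have "g v (u - \<Gamma> a b) z = 0" for z
    using koszul[of a b z] spec[OF u, of z] linear_diff[OF metric_linear_left[OF v_in]] by simp
  then show "u = \<Gamma> a b" using metric_nondegenerate[OF v_in] by (metis eq_iff_diff_eq_0)
qed

text \<open>\<open>metric_differentiable\<close> is about constant fields. Expansion in a basis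
  carries linearity over to the derivative, and the same expansion later allows a moving field in
  the first slot.\<close>

lemma metric_derivative_left:
  "frechet_derivative (\<lambda>y. g y c w) (at v) a
    = (\<Sum>b\<in>Basis. (c \<bullet> b) * frechet_derivative (\<lambda>y. g y b w) (at v) a)"
proof -
  have "((\<lambda>y. \<Sum>b\<in>Basis. (c \<bullet> b) * g y b w) has_derivative
      (\<lambda>a. \<Sum>b\<in>Basis. (c \<bullet> b) * frechet_derivative (\<lambda>y. g y b w) (at v) a)) (at v)"
    by (intro has_derivative_sum has_derivative_mult_right has_derivative_frechet metric_differentiable)
  moreover have "(\<Sum>b\<in>Basis. (c \<bullet> b) * g y b w) = g y c w" if "y \<in> V" for y
    using metric_expand[OF that, of c w] by simp
  ultimately have "((\<lambda>y. g y c w) has_derivative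
      (\<lambda>a. \<Sum>b\<in>Basis. (c \<bullet> b) * frechet_derivative (\<lambda>y. g y b w) (at v) a)) (at v)"
    by (rule has_derivative_transform_within_open[OF _ open_V v_in])
  from fun_cong[OF frechet_derivative_at[OF this], of a] show ?thesis by simp
qed

lemma metric_derivative_sym:
  "frechet_derivative (\<lambda>y. g y c w) (at v) = frechet_derivative (\<lambda>y. g y w c) (at v)"
  by (rule frechet_derivative_cong_open[OF open_V v_in metric_sym])

text \<open>Forced by the Koszul formula and nondegeneracy. Linearity in the direction is what
  computing a trace in a frame requires.\<close>

lemma linear_connection: "linear (\<lambda>a. \<Gamma> a b)"
proof -
  note lin = linear_frechet_derivative[OF metric_differentiable]
  have add: "frechet_derivative (\<lambda>y. g y (a + c) w) (at v) z =
      frechet_derivative (\<lambda>y. g y a w) (at v) z + frechet_derivative (\<lambda>y. g y c w) (at v) z" for a c w z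
    by (subst (1 2 3) metric_derivative_left) (simp add: inner_left_distrib ring_distribs sum.distrib)
  have scale: "frechet_derivative (\<lambda>y. g y (r *\<^sub>R a) w) (at v) z =
      r * frechet_derivative (\<lambda>y. g y a w) (at v) z" for r a w z
    by (subst (1 2) metric_derivative_left) (simp add: sum_distrib_left mult.assoc)
  note ml = metric_linear_left[OF v_in]
  show ?thesis
  proof (rule linearI)
    fix a c
    have "g v (\<Gamma> (a + c) b - (\<Gamma> a b + \<Gamma> c b)) z = 0" for z
      using koszul[of "a + c" b z] koszul[of a b z] koszul[of c b z]
      by (simp add: linear_diff[OF ml] linear_add[OF ml] linear_add[OF lin] add)
    then show "\<Gamma> (a + c) b = \<Gamma> a b + \<Gamma> c b"
      using metric_nondegenerate[OF v_in] by (metis eq_iff_diff_eq_0)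
  next
    fix r a
    have "g v (\<Gamma> (r *\<^sub>R a) b - r *\<^sub>R \<Gamma> a b) z = 0" for z
    proof -
      have "2 * g v (\<Gamma> (r *\<^sub>R a) b) z = r * (2 * g v (\<Gamma> a b) z)"
        unfolding koszul by (simp add: linear_scale[OF lin] scale right_diff_distrib ring_distribs)
      then show ?thesis by (simp add: linear_diff[OF ml] linear_scale[OF ml])
    qed
    then show "\<Gamma> (r *\<^sub>R a) b = r *\<^sub>R \<Gamma> a b"
      using metric_nondegenerate[OF v_in] by (metis eq_iff_diff_eq_0)
  qed
qed

text \<open>The divergence of the gradient is the trace of its covariant derivative. Pairing with
  the metric turns that endomorphism into the covariant Hessian, and expanding each standard basis
  vector in the frame moves the trace to the frame.\<close>

lemma laplacian_eq:
  assumes "open W" "v \<in> W" "W \<subseteq> V" "Ck_on 2 u W"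
  shows "laplacian g u v = (\<Sum>i\<in>I. second_derivative u v (e' i) (e i)
    - frechet_derivative u (at v) (\<Gamma> (e i) (e' i)))"
proof -
  define X where "X = grad g u"
  have du: "u differentiable at y" if "y \<in> W" for y using assms(4) that by (simp add: Ck_on_2_iff)
  have ddu: "((\<lambda>y. frechet_derivative u (at y) a) has_derivative second_derivative u v a) (at v)" for a
    using assms(2,4) has_derivative_frechet[of "\<lambda>y. frechet_derivative u (at y) a" v]
    unfolding second_derivative_def[abs_def] Ck_on_2_iff by blast
  have gX: "g y (X y) z = frechet_derivative u (at y) z" if "y \<in> W" for y z
    unfolding X_def using that assms(3) du by (intro grad_eq) auto
  \<comment> \<open>\<open>levi_civita\<close> differentiates the gradient, which is known only
    through the linear system \<open>g y (X y) b = frechet_derivative u (at y) b\<close>.\<close>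
  have "X differentiable at v"
  proof (rule differentiable_linear_solution[OF assms(1,2),
        where L = "\<lambda>y w. \<Sum>b\<in>Basis. g y w b *\<^sub>R b"
        and r = "\<lambda>y. \<Sum>b\<in>Basis. frechet_derivative u (at y) b *\<^sub>R b"])
    show "linear (\<lambda>w. \<Sum>b\<in>Basis. g y w b *\<^sub>R b)" if "y \<in> W" for y
      using metric_linear_left[of y] assms(3) that
      by (auto simp: linear_iff algebra_simps sum.distrib scaleR_sum_right)
    show "(\<lambda>y. \<Sum>b\<in>Basis. g y w b *\<^sub>R b) differentiable at v" for w
      by (intro differentiable_sum ballI differentiable_scaleR metric_differentiable) auto
    show "(\<lambda>y. \<Sum>b\<in>Basis. frechet_derivative u (at y) b *\<^sub>R b) differentiable at v"
      using ddu by (intro differentiable_sum ballI differentiable_scaleR) (auto simp: differentiable_def)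
    show "(\<Sum>b\<in>Basis. g y (X y) b *\<^sub>R b) = (\<Sum>b\<in>Basis. frechet_derivative u (at y) b *\<^sub>R b)"
      if "y \<in> W" for y using gX[OF that] by simp
    fix w assume 0: "(\<Sum>b\<in>Basis. g v w b *\<^sub>R b) = 0"
    have "g v w b = 0" if "b \<in> Basis" for b
      using arg_cong[OF 0, of "\<lambda>x. x \<bullet> b"] that
      by (simp add: inner_sum_left inner_Basis if_distrib cong: if_cong)
    then have "g v w z = 0" for z by (subst linear_eq_sum_Basis[OF metric_linear[OF v_in]]) simp
    then show "w = 0" using metric_nondegenerate[OF v_in] by blast
  qed
  note dX = has_derivative_frechet[OF this]
  let ?X = "frechet_derivative X (at v)"
  let ?G = "\<lambda>c w. frechet_derivative (\<lambda>y. g y c w) (at v)"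
  have leibniz: "second_derivative u v w a = g v (?X a) w + ?G (X v) w a" for w a
  proof -
    have "((\<lambda>y. \<Sum>b\<in>Basis. (X y \<bullet> b) * g y b w) has_derivative
        (\<lambda>a. \<Sum>b\<in>Basis. (X v \<bullet> b) * ?G b w a + (?X a \<bullet> b) * g v b w)) (at v)"
      by (intro has_derivative_sum has_derivative_mult has_derivative_frechet metric_differentiable
          bounded_linear.has_derivative[OF bounded_linear_inner_left dX])
    moreover have "(\<Sum>b\<in>Basis. (X y \<bullet> b) * g y b w) = frechet_derivative u (at y) w" if "y \<in> W" for y
    proof -
      have "y \<in> V" using that assms(3) by auto
      from metric_expand[OF this, of "X y" w]
      show ?thesis using gX[OF that] by simp
    qed
    ultimately have "((\<lambda>y. frechet_derivative u (at y) w) has_derivative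
        (\<lambda>a. \<Sum>b\<in>Basis. (X v \<bullet> b) * ?G b w a + (?X a \<bullet> b) * g v b w)) (at v)"
      by (rule has_derivative_transform_within_open[OF _ assms(1,2)])
    from has_derivative_unique[OF ddu this]
    have "second_derivative u v w a = (\<Sum>b\<in>Basis. (X v \<bullet> b) * ?G b w a) + (\<Sum>b\<in>Basis. (?X a \<bullet> b) * g v b w)"
      by (simp add: sum.distrib)
    also have "(\<Sum>b\<in>Basis. (?X a \<bullet> b) * g v b w) = g v (?X a) w"
      by (rule metric_expand[OF v_in, symmetric])
    also have "(\<Sum>b\<in>Basis. (X v \<bullet> b) * ?G b w a) = ?G (X v) w a"
      by (rule metric_derivative_left[symmetric])
    finally show ?thesis by simp
  qed
  define A where "A = levi_civita g X v"
  have A: "A a = ?X a + \<Gamma> a (X v)" for a by (simp add: A_def levi_civita_def christoffel_eq)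
  have linA: "linear A"
    using linear_compose_add[OF has_derivative_linear[OF dX] linear_connection[of "X v"]]
    by (simp add: A[abs_def])
  \<comment> \<open>Adding the Koszul formulas for \<open>\<Gamma> a w\<close> paired with
    \<open>X v\<close> and for \<open>\<Gamma> a (X v)\<close> paired with \<open>w\<close> gives
    metric compatibility, which cancels the derivative of the metric in
    \<open>leibniz\<close>.\<close>
  have hess: "g v (A a) w = second_derivative u v w a - frechet_derivative u (at v) (\<Gamma> a w)" for a w
  proof -
    have "frechet_derivative u (at v) (\<Gamma> a w) = g v (\<Gamma> a w) (X v)"
      using gX[OF assms(2)] metric_sym[OF v_in] by metis
    then show ?thesis
      using leibniz[of w a] koszul[of a w "X v"] koszul[of a "X v" w] metric_derivative_sym[of w "X v"]
      by (simp add: A linear_add[OF metric_linear_left[OF v_in]])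
  qed
  have "laplacian g u v = (\<Sum>b\<in>Basis. A b \<bullet> b)"
    by (simp add: laplacian_def divergence_def A_def X_def)
  also have "\<dots> = (\<Sum>b\<in>Basis. \<Sum>i\<in>I. g v b (e' i) * (A (e i) \<bullet> b))"
  proof (rule sum.cong[OF refl])
    fix b :: 'e
    have "A b = A (\<Sum>i\<in>I. g v b (e' i) *\<^sub>R e i)" using frame[of b] by simp
    then have "A b = (\<Sum>i\<in>I. g v b (e' i) *\<^sub>R A (e i))"
      by (simp only: linear_sum[OF linA] linear_scale[OF linA])
    then show "A b \<bullet> b = (\<Sum>i\<in>I. g v b (e' i) * (A (e i) \<bullet> b))" by (simp add: inner_sum_left)
  qed
  also have "\<dots> = (\<Sum>i\<in>I. \<Sum>b\<in>Basis. (A (e i) \<bullet> b) * g v b (e' i))"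
    by (subst sum.swap) (simp add: mult.commute)
  also have "\<dots> = (\<Sum>i\<in>I. g v (A (e i)) (e' i))"
    by (intro sum.cong refl) (rule metric_expand[OF v_in, symmetric])
  finally show ?thesis by (simp add: hess)
qed

end

section \<open>Composition with harmonic functions on the plane\<close>

lemma harmonic_on_complex_plane:
  assumes "open U" "harmonic_on complex_plane U f" "z \<in> U"
  shows "Ck_on 2 f U" "second_derivative f z 1 1 + second_derivative f z \<i> \<i> = 0"
proof -
  have h: "Ck_on 2 f U" "laplacian (\<lambda>_ v w. v \<bullet> w) f z = 0"
    using assms by (auto simp: harmonic_on_def complex_plane_def comp_def)
  interpret framed_metric U "\<lambda>_ v w. v \<bullet> w" z Basis "\<lambda>b::complex. b" "\<lambda>b. b" "\<lambda>_ _. 0"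
  proof
    show "w = (\<Sum>i\<in>Basis. (w \<bullet> i) *\<^sub>R i)" for w :: complex by (simp add: euclidean_representation)
    show "a = 0" if "\<And>b. a \<bullet> b = 0" for a :: complex using that inner_eq_zero_iff by blast
  qed (use assms in \<open>auto simp: linear_iff inner_right_distrib inner_commute frechet_derivative_const\<close>)
  show "Ck_on 2 f U" by (fact h)
  have "linear (frechet_derivative f (at z))"
    using h assms(3) by (intro linear_frechet_derivative) (simp add: Ck_on_2_iff)
  then show "second_derivative f z 1 1 + second_derivative f z \<i> \<i> = 0"
    using laplacian_eq[OF assms(1,3) order_refl h(1)] h(2) by (simp add: Basis_complex_def linear_0)
qed

context framed_metric
begin

text \<open>The composition law: the trace of the Hessian of \<open>f\<close> along \<zeta>, plus
  the derivative of \<open>f\<close> applied to the tension of \<zeta>. For harmonic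
  \<open>f\<close> the Hessian form at \<open>p\<close> is real-linear in \<open>p^2\<close>, so
  only the sum of the squares enters.\<close>

lemma laplacian_compose_eq_0:
  assumes "Ck_on 2 \<zeta> V" "open U" "harmonic_on complex_plane U f" "\<zeta> v \<in> U"
    and dual: "\<And>i. i \<in> I \<Longrightarrow> frechet_derivative \<zeta> (at v) (e' i) = frechet_derivative \<zeta> (at v) (e i)"
    and conformal: "(\<Sum>i\<in>I. (frechet_derivative \<zeta> (at v) (e i))\<^sup>2) = 0"
    and tension: "(\<Sum>i\<in>I. second_derivative \<zeta> v (e' i) (e i)
      - frechet_derivative \<zeta> (at v) (\<Gamma> (e i) (e' i))) = 0"
  shows "laplacian g (\<lambda>y. f (\<zeta> y)) v = 0"
proof -
  define W where "W = V \<inter> \<zeta> -` U"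
  note f = harmonic_on_complex_plane[OF assms(2-4)]
  have "continuous_on V \<zeta>"
    using assms(1) by (intro continuous_at_imp_continuous_on)
      (auto simp: Ck_on_2_iff intro: differentiable_imp_continuous_within)
  then have W: "open W" "v \<in> W" "W \<subseteq> V" "\<zeta> ` W \<subseteq> U"
    using continuous_open_preimage[OF _ open_V assms(2)] v_in assms(4) by (auto simp: W_def)
  have \<zeta>: "Ck_on 2 \<zeta> W" using assms(1) W(3) by (rule Ck_on_subset)
  let ?z = "\<lambda>i. frechet_derivative \<zeta> (at v) (e i)"
  \<comment> \<open>The mean of the mixed derivatives: \<open>Re p * Im p\<close> times their sum is
    \<open>Im (p^2)\<close> times this mean.\<close>
  let ?c = "(second_derivative f (\<zeta> v) 1 \<i> + second_derivative f (\<zeta> v) \<i> 1) / 2"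
  note sl = linear_second_derivative_left[OF assms(2) f(1) assms(4)]
  note sr = linear_second_derivative_right[OF f(1) assms(4)]
  have sd: "second_derivative f (\<zeta> v) p p = Re (p\<^sup>2) * second_derivative f (\<zeta> v) 1 1 + Im (p\<^sup>2) * ?c" for p
  proof -
    have p: "p = Re p *\<^sub>R 1 + Im p *\<^sub>R \<i>" by (simp add: complex_eq_iff)
    have "second_derivative f (\<zeta> v) p p = (Re p)\<^sup>2 * second_derivative f (\<zeta> v) 1 1
      + Re p * Im p * (second_derivative f (\<zeta> v) 1 \<i> + second_derivative f (\<zeta> v) \<i> 1)
      + (Im p)\<^sup>2 * second_derivative f (\<zeta> v) \<i> \<i>"
      by (subst (1 2) p) (simp only: linear_add[OF sl] linear_add[OF sr] linear_scale[OF sl]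
        linear_scale[OF sr], simp add: algebra_simps power2_eq_square)
    moreover have "second_derivative f (\<zeta> v) \<i> \<i> = - second_derivative f (\<zeta> v) 1 1" using f(2) by simp
    ultimately show ?thesis by (simp add: algebra_simps power2_eq_square)
  qed
  have df: "linear (frechet_derivative f (at (\<zeta> v)))"
    using f(1) assms(4) by (intro linear_frechet_derivative) (simp add: Ck_on_2_iff)
  have diff: "f differentiable at (\<zeta> v)" "\<zeta> differentiable at v"
    using f(1) assms(1,4) v_in by (auto simp: Ck_on_2_iff)
  have "laplacian g (\<lambda>y. f (\<zeta> y)) v = (\<Sum>i\<in>I. second_derivative (\<lambda>y. f (\<zeta> y)) v (e' i) (e i)
    - frechet_derivative (\<lambda>y. f (\<zeta> y)) (at v) (\<Gamma> (e i) (e' i)))"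
    by (rule laplacian_eq[OF W(1-3) Ck_on_compose[OF W(1) assms(2) W(4) f(1) \<zeta>]])
  also have "\<dots> = (\<Sum>i\<in>I. second_derivative f (\<zeta> v) (?z i) (?z i)
      + frechet_derivative f (at (\<zeta> v)) (second_derivative \<zeta> v (e' i) (e i)
        - frechet_derivative \<zeta> (at v) (\<Gamma> (e i) (e' i))))"
    by (intro sum.cong refl)
      (simp add: second_derivative_compose[OF W(1) assms(2) W(4) f(1) \<zeta> W(2)] dual
        frechet_derivative_compose[of f, OF diff] linear_diff[OF df])
  also have "\<dots> = Re (\<Sum>i\<in>I. (?z i)\<^sup>2) * second_derivative f (\<zeta> v) 1 1 + Im (\<Sum>i\<in>I. (?z i)\<^sup>2) * ?c
      + frechet_derivative f (at (\<zeta> v)) (\<Sum>i\<in>I. second_derivative \<zeta> v (e' i) (e i)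
        - frechet_derivative \<zeta> (at v) (\<Gamma> (e i) (e' i)))"
    unfolding linear_sum[OF df] Re_sum Im_sum sum_distrib_right sum.distrib[symmetric]
    by (intro sum.cong refl arg_cong2[where f = "(+)"] sd)
  finally show ?thesis by (simp add: conformal tension linear_0[OF df])
qed

end

section \<open>Isotropic roots\<close>

text \<open>Implicit differentiation, so that the square root never has to be differentiated by
  formula. The derivatives of \<zeta> carry the factor
  \<open>\<alpha> v * \<zeta> v - \<beta> v\<close>, half the derivative of the quadratic in its
  variable, and are thus determined wherever the root is simple.\<close>

lemma quadratic_root_derivatives:
  fixes \<alpha> \<beta> \<gamma> \<zeta> :: "'e::euclidean_space \<Rightarrow> complex"
  assumes "open S" "v \<in> S" and C2: "Ck_on 2 \<alpha> S" "Ck_on 2 \<beta> S" "Ck_on 2 \<gamma> S" "Ck_on 2 \<zeta> S"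
    and root: "\<And>y. y \<in> S \<Longrightarrow> \<alpha> y * (\<zeta> y)\<^sup>2 - 2 * \<beta> y * \<zeta> y + \<gamma> y = 0"
  shows "2 * (\<alpha> v * \<zeta> v - \<beta> v) * frechet_derivative \<zeta> (at v) a
      + (frechet_derivative \<alpha> (at v) a * (\<zeta> v)\<^sup>2 - 2 * frechet_derivative \<beta> (at v) a * \<zeta> v
         + frechet_derivative \<gamma> (at v) a) = 0" (is ?first)
    and "2 * (\<alpha> v * \<zeta> v - \<beta> v) * second_derivative \<zeta> v a b
      + (second_derivative \<alpha> v a b * (\<zeta> v)\<^sup>2 - 2 * second_derivative \<beta> v a b * \<zeta> v
         + second_derivative \<gamma> v a b)
      + 2 * (frechet_derivative \<alpha> (at v) b * \<zeta> v - frechet_derivative \<beta> (at v) b) * frechet_derivative \<zeta> (at v) a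
      + 2 * (frechet_derivative \<alpha> (at v) a * \<zeta> v - frechet_derivative \<beta> (at v) a) * frechet_derivative \<zeta> (at v) b
      + 2 * \<alpha> v * frechet_derivative \<zeta> (at v) a * frechet_derivative \<zeta> (at v) b = 0" (is ?second)
proof -
  have d: "(u has_derivative frechet_derivative u (at y)) (at y)" if "Ck_on 2 u S" "y \<in> S"
    for u :: "'e \<Rightarrow> complex" and y
    using that by (auto simp: Ck_on_2_iff has_derivative_frechet)
  have dd: "((\<lambda>y. frechet_derivative u (at y) a) has_derivative second_derivative u v a) (at v)"
    if "Ck_on 2 u S" for u :: "'e \<Rightarrow> complex"
    using that assms(2) has_derivative_frechet[of "\<lambda>y. frechet_derivative u (at y) a" v]
    unfolding second_derivative_def[abs_def] Ck_on_2_iff by blast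
  have const: "D b = 0"
    if "(F has_derivative D) (at y)" "\<And>y. y \<in> S \<Longrightarrow> F y = 0" "y \<in> S" for F D and b :: 'e and y
  proof -
    have "((\<lambda>_. 0) has_derivative D) (at y)"
      by (rule has_derivative_transform_within_open[OF that(1) assms(1) that(3)]) (rule that(2))
    from has_derivative_unique[OF this has_derivative_const] show ?thesis by simp
  qed
  have first: "2 * (\<alpha> y * \<zeta> y - \<beta> y) * frechet_derivative \<zeta> (at y) a
      + (frechet_derivative \<alpha> (at y) a * (\<zeta> y)\<^sup>2 - 2 * frechet_derivative \<beta> (at y) a * \<zeta> y
         + frechet_derivative \<gamma> (at y) a) = 0" if y: "y \<in> S" for y
  proof -
    note dy = d[OF C2(1) y] d[OF C2(2) y] d[OF C2(3) y] d[OF C2(4) y]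
    have "((\<lambda>y. \<alpha> y * (\<zeta> y * \<zeta> y) - 2 * \<beta> y * \<zeta> y + \<gamma> y) has_derivative
       (\<lambda>a. 2 * (\<alpha> y * \<zeta> y - \<beta> y) * frechet_derivative \<zeta> (at y) a
      + (frechet_derivative \<alpha> (at y) a * (\<zeta> y)\<^sup>2 - 2 * frechet_derivative \<beta> (at y) a * \<zeta> y
         + frechet_derivative \<gamma> (at y) a))) (at y)"
      by (rule derivative_eq_intros dy refl)+ (simp add: fun_eq_iff algebra_simps power2_eq_square)
    from const[OF this _ y] root show ?thesis by (simp add: power2_eq_square)
  qed
  then show ?first using assms(2) by blast
  note dv = d[OF C2(1) assms(2)] d[OF C2(2) assms(2)] d[OF C2(3) assms(2)] d[OF C2(4) assms(2)]
    dd[OF C2(1)] dd[OF C2(2)] dd[OF C2(3)] dd[OF C2(4)]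
  have "((\<lambda>y. 2 * (\<alpha> y * \<zeta> y - \<beta> y) * frechet_derivative \<zeta> (at y) a
      + (frechet_derivative \<alpha> (at y) a * (\<zeta> y * \<zeta> y) - 2 * frechet_derivative \<beta> (at y) a * \<zeta> y
         + frechet_derivative \<gamma> (at y) a)) has_derivative (\<lambda>b. 2 * (\<alpha> v * \<zeta> v - \<beta> v) * second_derivative \<zeta> v a b
      + (second_derivative \<alpha> v a b * (\<zeta> v)\<^sup>2 - 2 * second_derivative \<beta> v a b * \<zeta> v
         + second_derivative \<gamma> v a b)
      + 2 * (frechet_derivative \<alpha> (at v) b * \<zeta> v - frechet_derivative \<beta> (at v) b) * frechet_derivative \<zeta> (at v) a
      + 2 * (frechet_derivative \<alpha> (at v) a * \<zeta> v - frechet_derivative \<beta> (at v) a) * frechet_derivative \<zeta> (at v) b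
      + 2 * \<alpha> v * frechet_derivative \<zeta> (at v) a * frechet_derivative \<zeta> (at v) b)) (at v)"
    by (rule derivative_eq_intros dv refl)+ (simp add: fun_eq_iff algebra_simps power2_eq_square)
  from const[OF this _ assms(2)] first show ?second by (simp add: power2_eq_square)
qed

section \<open>Complex bilinear forms and sums over a tight frame\<close>

definition bilin :: "complex^'n \<Rightarrow> real^'n^'n \<Rightarrow> complex^'n \<Rightarrow> complex" where
  "bilin u M w = (\<Sum>m\<in>UNIV. \<Sum>n\<in>UNIV. u $ m * of_real (M $ m $ n) * w $ n)"

text \<open>Bilinear and not Hermitian, as is \<open>bilin\<close>: a nonzero complex vector may
  satisfy \<open>cdot w w = 0\<close>.\<close>

definition cdot :: "complex^'n \<Rightarrow> complex^'n \<Rightarrow> complex" where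
  "cdot u w = (\<Sum>m\<in>UNIV. u $ m * w $ m)"

lemma bilin_mat_1: "bilin u (mat 1) w = cdot u w"
  by (simp add: bilin_def cdot_def mat_def if_distrib if_distribR cong: if_cong)

lemma bilin_diff:
  "bilin (u - u') M w = bilin u M w - bilin u' M w"
  "bilin u M (w - w') = bilin u M w - bilin u M w'"
  by (simp_all add: bilin_def algebra_simps sum_subtractf)

lemma bilin_scale:
  "bilin (c *s u) M w = c * bilin u M w"
  "bilin u M (c *s w) = c * bilin u M w"
  by (simp_all add: bilin_def algebra_simps sum_distrib_left)

lemma bilin_sym: "transpose M = M \<Longrightarrow> bilin u M w = bilin w M u"
  unfolding bilin_def
  by (subst sum.swap) (simp add: transpose_def vec_eq_iff algebra_simps)

definition complex_row :: "real^'n^'n \<Rightarrow> 'n \<Rightarrow> complex^'n" where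
  "complex_row x k = (\<chi> m. of_real (x $ k $ m))"

lemma congruence_entry:
  "of_real ((x ** M ** transpose x) $ k $ l) = bilin (complex_row x k) M (complex_row x l)"
  unfolding bilin_def complex_row_def matrix_matrix_mult_def transpose_def
  by (simp add: sum_distrib_right) (rule sum.swap)

text \<open>Holds for a tight frame of the symmetric matrices with \<open>c = 0\<close>, and of the traceless ones
  with \<open>c = 1/n\<close>.\<close>

definition casimir :: "real \<Rightarrow> 'i set \<Rightarrow> ('i \<Rightarrow> real^'n^'n) \<Rightarrow> bool" where
  "casimir c I E \<longleftrightarrow> (\<forall>m n p q. (\<Sum>i\<in>I. E i $ m $ n * E i $ p $ q)
     = (of_bool (m = p \<and> n = q) + of_bool (m = q \<and> n = p)) / 2 - c * of_bool (m = n \<and> p = q))"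

lemma sum_if: "(\<Sum>x\<in>A. if b then f x else 0) = (if b then sum f A else 0)"
  by simp

text \<open>With three of the four slots equal to \<open>w\<close>, every pairing of the slots gives
  the same product \<open>cdot u w * cdot w w\<close>: the two permutation terms contribute one half
  each, the trace term \<open>- c\<close>.\<close>

lemma casimir_bilin_product:
  assumes "casimir c I E"
  shows "(\<Sum>i\<in>I. bilin u (E i) w * bilin w (E i) w) = of_real (1 - c) * cdot u w * cdot w w"
proof -
  have "(\<Sum>i\<in>I. bilin u (E i) w * bilin w (E i) w)
      = (\<Sum>i\<in>I. \<Sum>m\<in>UNIV. \<Sum>n\<in>UNIV. \<Sum>p\<in>UNIV. \<Sum>q\<in>UNIV.
          u $ m * w $ n * w $ p * w $ q * of_real (E i $ m $ n * E i $ p $ q))"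
    unfolding bilin_def by (simp only: sum_distrib_right, simp only: sum_distrib_left, simp add: mult_ac)
  also have "\<dots> = (\<Sum>m\<in>UNIV. \<Sum>n\<in>UNIV. \<Sum>p\<in>UNIV. \<Sum>q\<in>UNIV. \<Sum>i\<in>I.
          u $ m * w $ n * w $ p * w $ q * of_real (E i $ m $ n * E i $ p $ q))"
    by (subst sum.swap, intro sum.cong refl)+
  also have "\<dots> = (\<Sum>m\<in>UNIV. \<Sum>n\<in>UNIV. \<Sum>p\<in>UNIV. \<Sum>q\<in>UNIV.
          u $ m * w $ n * w $ p * w $ q * of_real (\<Sum>i\<in>I. E i $ m $ n * E i $ p $ q))"
    by (simp add: sum_distrib_left)
  also have "\<dots> = (\<Sum>m\<in>UNIV. \<Sum>n\<in>UNIV. \<Sum>p\<in>UNIV. \<Sum>q\<in>UNIV.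
         (if q = n then if p = m then u $ m * w $ n * w $ p * w $ q / 2 else 0 else 0)
       + (if q = m then if p = n then u $ m * w $ n * w $ p * w $ q / 2 else 0 else 0)
       - (if q = p then if n = m then of_real c * (u $ m * w $ n * w $ p * w $ q) else 0 else 0))"
    unfolding assms[unfolded casimir_def, rule_format] by (intro sum.cong refl) (auto simp: algebra_simps)
  also have "\<dots> = (\<Sum>m\<in>UNIV. \<Sum>n\<in>UNIV. u $ m * w $ m * w $ n * w $ n)
      - (\<Sum>m\<in>UNIV. \<Sum>p\<in>UNIV. of_real c * (u $ m * w $ m * w $ p * w $ p))"
    by (simp add: sum.distrib sum_subtractf sum_if mult_ac)
  also have "\<dots> = cdot u w * cdot w w - of_real c * (cdot u w * cdot w w)"
  proof -
    have "cdot u w * cdot w w = (\<Sum>m\<in>UNIV. \<Sum>n\<in>UNIV. u $ m * w $ m * w $ n * w $ n)"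
      by (simp add: cdot_def sum_product mult_ac)
    then show ?thesis by (simp add: sum_distrib_left)
  qed
  also have "\<dots> = of_real (1 - c) * cdot u w * cdot w w" by (simp add: algebra_simps)
  finally show ?thesis .
qed

text \<open>In matrix form, the squares \<open>E i ** E i\<close> sum to
  \<open>((n + 1)/2 - c)\<close> times the identity: on contracting the inner indices, one
  permutation term gives 1/2, the other n/2 and the trace term \<open>- c\<close>.\<close>

lemma casimir_bilin_square:
  assumes "casimir c I (E :: 'i \<Rightarrow> real^'n^'n)"
  shows "(\<Sum>i\<in>I. bilin u (E i ** E i) w) = of_real ((1 + real CARD('n)) / 2 - c) * cdot u w"
proof -
  have "(\<Sum>i\<in>I. bilin u (E i ** E i) w)
      = (\<Sum>i\<in>I. \<Sum>m\<in>UNIV. \<Sum>n\<in>UNIV. \<Sum>p\<in>UNIV. u $ m * w $ n * of_real (E i $ m $ p * E i $ p $ n))"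
    unfolding bilin_def matrix_matrix_mult_def
    by (simp add: sum_distrib_left sum_distrib_right mult_ac)
  also have "\<dots> = (\<Sum>m\<in>UNIV. \<Sum>n\<in>UNIV. \<Sum>p\<in>UNIV. \<Sum>i\<in>I. u $ m * w $ n * of_real (E i $ m $ p * E i $ p $ n))"
    by (subst sum.swap, intro sum.cong refl)+
  also have "\<dots> = (\<Sum>m\<in>UNIV. \<Sum>n\<in>UNIV. \<Sum>p\<in>UNIV. u $ m * w $ n * of_real (\<Sum>i\<in>I. E i $ m $ p * E i $ p $ n))"
    by (simp add: sum_distrib_left)
  also have "\<dots> = (\<Sum>m\<in>UNIV. \<Sum>n\<in>UNIV. \<Sum>p\<in>UNIV.
         (if p = m then if n = m then u $ m * w $ n / 2 else 0 else 0)
       + (if n = m then u $ m * w $ n / 2 else 0)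
       - (if p = m then if n = m then of_real c * (u $ m * w $ n) else 0 else 0))"
    unfolding assms[unfolded casimir_def, rule_format] by (intro sum.cong refl) (auto simp: algebra_simps)
  also have "\<dots> = (\<Sum>m\<in>UNIV. u $ m * w $ m / 2) + of_nat CARD('n) * (\<Sum>m\<in>UNIV. u $ m * w $ m / 2)
      - of_real c * (\<Sum>m\<in>UNIV. u $ m * w $ m)"
    by (simp add: sum.distrib sum_subtractf sum_if sum_distrib_left
        if_distrib[of "\<lambda>t. complex_of_nat CARD('n) * t"] cong: if_cong)
  also have "\<dots> = of_real ((1 + real CARD('n)) / 2 - c) * cdot u w"
    unfolding cdot_def sum_divide_distrib[symmetric] by (simp add: algebra_simps add_divide_distrib)
  finally show ?thesis .
qed

context framed_metric
begin

lemma isotropic_root_harmonic: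
  fixes P :: "'e \<Rightarrow> real^'n^'n" and x :: "real^'n^'n" and E :: "'i \<Rightarrow> real^'n^'n"
  assumes P: "Ck_on 2 P V" and \<zeta>: "Ck_on 2 \<zeta> V"
    and root: "\<And>y. y \<in> V \<Longrightarrow> of_real (P y $ l $ l) * (\<zeta> y)\<^sup>2 - 2 * of_real (P y $ k $ l) * \<zeta> y
       + of_real (P y $ k $ k) = 0"
    and simple: "of_real (P v $ l $ l) * \<zeta> v \<noteq> of_real (P v $ k $ l)"
    and x: "P v = x ** transpose x"
    and E: "casimir c I E" "\<And>i. i \<in> I \<Longrightarrow> transpose (E i) = E i"
    and dP: "\<And>i. i \<in> I \<Longrightarrow> frechet_derivative P (at v) (e i) = 2 *\<^sub>R (x ** E i ** transpose x)"
      "\<And>i. i \<in> I \<Longrightarrow> frechet_derivative P (at v) (e' i) = 2 *\<^sub>R (x ** E i ** transpose x)"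
    and ddP: "\<And>i. i \<in> I \<Longrightarrow> second_derivative P v (e' i) (e i)
       - frechet_derivative P (at v) (\<Gamma> (e i) (e' i)) = 4 *\<^sub>R (x ** (E i ** E i) ** transpose x)"
    and f: "open U" "harmonic_on complex_plane U f" "\<zeta> v \<in> U"
  shows "laplacian g (\<lambda>y. f (\<zeta> y)) v = 0"
proof -
  let ?T = "\<lambda>i j (M::real^'n^'n). complex_of_real (M $ i $ j)"
  have T: "bounded_linear (?T i j)" for i j
    by (intro bounded_linear_compose[OF bounded_linear_of_real]
        bounded_linear_compose[OF bounded_linear_vec_nth] bounded_linear_vec_nth)
  note C2 = Ck_on_bounded_linear[OF open_V T P]
  have Pv: "P differentiable at v" using P v_in by (simp add: Ck_on_2_iff)
  note fT = frechet_derivative_bounded_linear[OF T Pv]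
  note sT = second_derivative_bounded_linear[OF open_V T P v_in]
  define z where "z = \<zeta> v"
  define \<rho> where "\<rho> = ?T l l (P v) * z - ?T k l (P v)"
  have \<rho>: "\<rho> \<noteq> 0" using simple by (simp add: \<rho>_def z_def)
  \<comment> \<open>\<open>Q\<close> is the quadratic at the fixed root \<open>z\<close> with
    coefficients taken from \<open>M\<close>; \<open>R\<close> is half its derivative in
    \<open>z\<close>.\<close>
  define Q where "Q M = ?T l l M * z\<^sup>2 - 2 * ?T k l M * z + ?T k k M" for M
  define R where "R M = ?T l l M * z - ?T k l M" for M
  define Z where "Z = frechet_derivative \<zeta> (at v)"
  note qr = quadratic_root_derivatives[OF open_V v_in C2 C2 C2 \<zeta> root, unfolded fT sT, folded z_def]
  have first: "2 * \<rho> * Z a + Q (frechet_derivative P (at v) a) = 0" for a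
    using qr(1)[of a] by (simp add: \<rho>_def Z_def Q_def)
  have second: "2 * \<rho> * second_derivative \<zeta> v a b + Q (second_derivative P v a b)
      + 2 * R (frechet_derivative P (at v) b) * Z a + 2 * R (frechet_derivative P (at v) a) * Z b
      + 2 * ?T l l (P v) * Z a * Z b = 0" for a b
    using qr(2)[of a b] by (simp add: \<rho>_def Z_def Q_def R_def)
  have Q_diff: "Q (M - N) = Q M - Q N" for M N by (simp add: Q_def algebra_simps)
  have Q_scale: "Q (r *\<^sub>R M) = of_real r * Q M" and R_scale: "R (r *\<^sub>R M) = of_real r * R M" for r M
    by (simp_all add: Q_def R_def algebra_simps)
  let ?r = "complex_row x"
  \<comment> \<open>Completing the congruence: \<open>Q\<close> and \<open>R\<close> at
    \<open>x ** M ** transpose x\<close> become \<open>bilin w M w\<close> and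
    \<open>- bilin (?r l) M w\<close>. For \<open>M = mat 1\<close> the root equation says that
    \<open>w\<close> is isotropic.\<close>
  define w where "w = ?r k - z *s ?r l"
  have QE: "Q (x ** M ** transpose x) = bilin w M w" if "transpose M = M" for M
    unfolding Q_def congruence_entry w_def
    by (simp add: bilin_diff bilin_scale bilin_sym[OF that, of "?r l" "?r k"] algebra_simps power2_eq_square)
  have RE: "R (x ** M ** transpose x) = - bilin (?r l) M w" if "transpose M = M" for M
    unfolding R_def congruence_entry w_def
    by (simp add: bilin_diff bilin_scale bilin_sym[OF that, of "?r l" "?r k"])
  have "Q (P v) = 0" using root[OF v_in] by (simp add: Q_def z_def)
  then have ww: "cdot w w = 0" using QE[of "mat 1"] by (simp add: x bilin_mat_1)
  have Zi: "Z (e i) = - bilin w (E i) w / \<rho>" "Z (e' i) = Z (e i)" if "i \<in> I" for i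
  proof -
    show 1: "Z (e i) = - bilin w (E i) w / \<rho>"
    proof -
      have "2 * (\<rho> * Z (e i) + bilin w (E i) w) = 0"
        using first[of "e i"] by (simp add: dP that E Q_scale QE algebra_simps)
      then have "\<rho> * Z (e i) = - bilin w (E i) w"
        unfolding eq_neg_iff_add_eq_0 by (metis mult_eq_0_iff zero_neq_numeral)
      then show ?thesis using \<rho> by (simp add: field_simps)
    qed
    show "Z (e' i) = Z (e i)"
    proof -
      have "2 * \<rho> * Z (e' i) + Q (2 *\<^sub>R (x ** E i ** transpose x))
          = 2 * \<rho> * Z (e i) + Q (2 *\<^sub>R (x ** E i ** transpose x))"
        using first[of "e' i"] first[of "e i"] unfolding dP[OF that] by (rule trans[OF _ sym])
      then show ?thesis using \<rho> by simp
    qed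
  qed
  have conf: "(\<Sum>i\<in>I. (Z (e i))\<^sup>2) = 0"
  proof -
    have "(\<Sum>i\<in>I. (Z (e i))\<^sup>2) = (\<Sum>i\<in>I. bilin w (E i) w * bilin w (E i) w) / \<rho>\<^sup>2"
      by (simp add: sum_divide_distrib Zi power_divide power2_eq_square)
    then show ?thesis by (simp add: casimir_bilin_product[OF E(1)] ww)
  qed
  have tau: "second_derivative \<zeta> v (e' i) (e i) - Z (\<Gamma> (e i) (e' i))
      = - (2 * bilin w (E i ** E i) w) / \<rho> - 4 * (bilin (?r l) (E i) w * bilin w (E i) w) / \<rho>\<^sup>2
        - ?T l l (P v) * (Z (e i))\<^sup>2 / \<rho>" (is "?h = _") if i: "i \<in> I" for i
  proof -
    have EE: "transpose (E i ** E i) = E i ** E i" by (simp add: matrix_transpose_mul E i)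
    \<comment> \<open>Subtracting the first-order identity along \<open>\<Gamma>\<close> makes both
      \<zeta> and \<open>P\<close> enter through covariant second derivatives. The 8 collects two
      equal cross terms with factor 2, each with the further 2 of \<open>dP\<close>.\<close>
    have "2 * \<rho> * (second_derivative \<zeta> v (e' i) (e i) - Z (\<Gamma> (e i) (e' i)))
        + Q (second_derivative P v (e' i) (e i) - frechet_derivative P (at v) (\<Gamma> (e i) (e' i)))
        + 8 * R (x ** E i ** transpose x) * Z (e i) + 2 * ?T l l (P v) * (Z (e i))\<^sup>2 = 0"
      using second[of "e' i" "e i"] first[of "\<Gamma> (e i) (e' i)"]
      by (simp add: Q_diff dP i R_scale Zi(2) algebra_simps power2_eq_square)
    then have "2 * \<rho> * ?h + 4 * bilin w (E i ** E i) w - 8 * bilin (?r l) (E i) w * Z (e i)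
        + 2 * ?T l l (P v) * (Z (e i))\<^sup>2 = 0"
      by (simp add: ddP i Q_scale QE EE RE E)
    then have "2 * (\<rho> * ?h) = 2 * (- 2 * bilin w (E i ** E i) w + 4 * bilin (?r l) (E i) w * Z (e i)
        - ?T l l (P v) * (Z (e i))\<^sup>2)"
      unfolding eq_iff_diff_eq_0[of "2 * (\<rho> * _)"] by (simp add: algebra_simps)
    then have "\<rho> * ?h = - 2 * bilin w (E i ** E i) w + 4 * bilin (?r l) (E i) w * Z (e i)
        - ?T l l (P v) * (Z (e i))\<^sup>2"
      by (rule mult_left_cancel[THEN iffD1, rotated]) simp
    then have "?h = (- 2 * bilin w (E i ** E i) w + 4 * bilin (?r l) (E i) w * Z (e i)
        - ?T l l (P v) * (Z (e i))\<^sup>2) / \<rho>" using \<rho> by (simp add: nonzero_eq_divide_eq mult.commute)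
    also have "4 * bilin (?r l) (E i) w * Z (e i) = - 4 * (bilin (?r l) (E i) w * bilin w (E i) w) / \<rho>"
      by (simp add: Zi(1)[OF i])
    finally show ?thesis by (simp add: diff_divide_distrib add_divide_distrib power2_eq_square[of \<rho>])
  qed
  \<comment> \<open>All three sums are multiples of \<open>cdot w w\<close>: the first by
    \<open>casimir_bilin_square\<close>, the second by \<open>casimir_bilin_product\<close> with
    \<open>u\<close> the row \<open>l\<close>, the third as in \<open>conf\<close>, with
    \<open>u = w\<close>.\<close>
  have "(\<Sum>i\<in>I. second_derivative \<zeta> v (e' i) (e i) - Z (\<Gamma> (e i) (e' i)))
      = - (2 * (\<Sum>i\<in>I. bilin w (E i ** E i) w)) / \<rho>
        - 4 * (\<Sum>i\<in>I. bilin (?r l) (E i) w * bilin w (E i) w) / \<rho>\<^sup>2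
        - ?T l l (P v) * (\<Sum>i\<in>I. (Z (e i))\<^sup>2) / \<rho>"
    by (simp add: tau sum_subtractf sum_negf sum_divide_distrib sum_distrib_left)
  then have "(\<Sum>i\<in>I. second_derivative \<zeta> v (e' i) (e i) - Z (\<Gamma> (e i) (e' i))) = 0"
    by (simp add: casimir_bilin_square[OF E(1)] casimir_bilin_product[OF E(1)] ww conf)
  then show ?thesis
    using conf Zi(2) f by (intro laplacian_compose_eq_0[OF \<zeta>]) (simp_all add: Z_def)
qed

end

section \<open>Pullbacks of the trace metric\<close>

lemma trace_cyclic3:
  fixes A B C :: "real^'n^'n"
  shows "trace (A ** B ** C) = trace (C ** A ** B)" "trace (A ** B ** C) = trace (B ** C ** A)"
  using trace_mul_sym[of "A ** B" C] trace_mul_sym[of A "B ** C"] by (simp_all add: matrix_mul_assoc)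

lemma bounded_linear_trace: "bounded_linear (trace :: real^'n^'n \<Rightarrow> real)"
  by (simp add: linear_conv_bounded_linear[symmetric] linear_iff trace_add trace_scaleR)

lemma bounded_linear_transpose: "bounded_linear (transpose :: real^'n^'m \<Rightarrow> _)"
  by (simp add: linear_conv_bounded_linear[symmetric] linear_iff transpose_add transpose_scalar)

lemma matrix_mult_minus:
  fixes A :: "real^'n^'m" and B :: "real^'p^'n"
  shows "(- A) ** B = - (A ** B)" "A ** (- B) = - (A ** B)"
  by (simp_all add: matrix_matrix_mult_def vec_eq_iff sum_negf)

lemma matrix_mult_diff:
  fixes A A' :: "real^'n^'m" and B B' :: "real^'p^'n"
  shows "(A - A') ** B = A ** B - A' ** B" "A ** (B - B') = A ** B - A ** B'"
  by (simp_all add: matrix_matrix_mult_def vec_eq_iff sum_subtractf algebra_simps)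

lemma trace_minus: "trace (- (A::real^'n^'n)) = - trace A"
  by (simp add: trace_def sum_negf)

text \<open>The inverse solves the linear system \<open>S y ** w = mat 1\<close>, hence is
  differentiable; the product rule for inverse times \<open>S\<close> then forces the
  formula.\<close>

lemma has_derivative_matrix_inv:
  fixes S :: "'e::euclidean_space \<Rightarrow> real^'n^'n"
  assumes "open V" "v \<in> V" "\<And>y. y \<in> V \<Longrightarrow> invertible (S y)" "(S has_derivative S') (at v)"
  shows "((\<lambda>y. matrix_inv (S y)) has_derivative
    (\<lambda>a. - (matrix_inv (S v) ** S' a ** matrix_inv (S v)))) (at v)"
proof -
  let ?J = "\<lambda>y. matrix_inv (S y)"
  have "?J differentiable at v"
  proof (rule differentiable_linear_solution[OF assms(1,2), where L = "\<lambda>y w. S y ** w" and r = "\<lambda>_. mat 1"])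
    show "(\<lambda>y. S y ** w) differentiable at v" for w
      using bounded_bilinear.FDERIV[OF bounded_bilinear_matrix_mult assms(4) has_derivative_const]
      by (auto simp: differentiable_def)
    show "w = 0" if "S v ** w = 0" for w
    proof -
      have "?J v ** (S v ** w) = ?J v ** 0" using that by simp
      then show ?thesis
        using bounded_bilinear.zero_right[OF bounded_bilinear_matrix_mult, of "?J v"]
        by (simp add: matrix_mul_assoc matrix_inv_mult[OF assms(3)[OF assms(2)]])
    qed
  qed (auto simp: linear_iff matrix_add_ldistrib matrix_scaleR_mult matrix_inv_mult assms(3))
  then obtain J' where J': "(?J has_derivative J') (at v)" by (auto simp: differentiable_def)
  have "((\<lambda>y. ?J y ** S y) has_derivative (\<lambda>a. ?J v ** S' a + J' a ** S v)) (at v)"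
    by (rule bounded_bilinear.FDERIV[OF bounded_bilinear_matrix_mult J' assms(4)])
  then have "((\<lambda>y. mat 1 :: real^'n^'n) has_derivative (\<lambda>a. ?J v ** S' a + J' a ** S v)) (at v)"
    by (rule has_derivative_transform_within_open[OF _ assms(1,2)]) (simp add: matrix_inv_mult assms(3))
  from has_derivative_unique[OF this has_derivative_const]
  have 0: "?J v ** S' a + J' a ** S v = 0" for a by (simp add: fun_eq_iff)
  have "J' a = - (?J v ** S' a ** ?J v)" for a
  proof -
    have "J' a ** S v = - (?J v ** S' a)" using 0[of a] by (simp add: eq_neg_iff_add_eq_0 add.commute)
    then have "J' a ** S v ** ?J v = - (?J v ** S' a) ** ?J v" by simp
    then show ?thesis
      using matrix_inv_mult[OF assms(3)[OF assms(2)]]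
      by (simp add: matrix_mul_assoc[symmetric] matrix_mult_minus)
  qed
  with J' show ?thesis by (metis (no_types, lifting) has_derivative_eq_rhs ext)
qed

text \<open>The bi-invariant trace metric of the general linear group pulled back along
  \<open>S\<close>. The identity with \<open>c = 1\<close>, and the composite of \<open>Phi\<close>
  with a lift with \<open>c = 1/4\<close>, give the metrics on the two spaces.\<close>

definition pullback_metric ::
  "real \<Rightarrow> ('e::euclidean_space \<Rightarrow> real^'n^'n) \<Rightarrow> 'e metric" where
  "pullback_metric c S y a b = c * trace ((matrix_inv (S y) ** frechet_derivative S (at y) a) **
     (matrix_inv (S y) ** frechet_derivative S (at y) b))"

lemma pullback_metric_sym: "pullback_metric c S y a b = pullback_metric c S y b a"
  unfolding pullback_metric_def by (rule arg_cong[OF trace_mul_sym])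

lemma linear_pullback_metric:
  assumes "S differentiable at y"
  shows "linear (pullback_metric c S y a)"
proof -
  note lin = linear_frechet_derivative[OF assms]
  show ?thesis
    by (rule linearI) (simp_all add: pullback_metric_def linear_add[OF lin] linear_scale[OF lin]
        matrix_add_ldistrib matrix_scaleR_mult trace_add trace_scaleR ring_distribs)
qed

lemma has_derivative_pullback_metric:
  fixes S :: "'e::euclidean_space \<Rightarrow> real^'n^'n"
  assumes "open V" "v \<in> V" "\<And>y. y \<in> V \<Longrightarrow> invertible (S y)" "Ck_on 2 S V"
  defines "J \<equiv> matrix_inv (S v)" and "D \<equiv> frechet_derivative S (at v)"
  shows "((\<lambda>y. pullback_metric c S y b z) has_derivative (\<lambda>a.
    c * (trace (J ** second_derivative S v b a ** (J ** D z)) - trace (J ** D a ** (J ** D b) ** (J ** D z))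
      + trace (J ** D b ** (J ** second_derivative S v z a)) - trace (J ** D b ** (J ** D a) ** (J ** D z))))) (at v)"
proof -
  have dS: "(S has_derivative D) (at v)"
    using assms(2,4) unfolding D_def by (auto simp: Ck_on_2_iff has_derivative_frechet)
  note dJ = has_derivative_matrix_inv[OF assms(1-3) dS, folded J_def]
  have dd: "((\<lambda>y. frechet_derivative S (at y) u) has_derivative second_derivative S v u) (at v)" for u
    using assms(2,4) has_derivative_frechet[of "\<lambda>y. frechet_derivative S (at y) u" v]
    unfolding second_derivative_def[abs_def] Ck_on_2_iff by blast
  note bm = bounded_bilinear.FDERIV[OF bounded_bilinear_matrix_mult]
  have dM: "((\<lambda>y. matrix_inv (S y) ** frechet_derivative S (at y) u) has_derivative
      (\<lambda>a. J ** second_derivative S v u a + - (J ** D a ** J) ** D u)) (at v)" for u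
    using bm[OF dJ dd[of u]] by (simp add: J_def D_def)
  have "((\<lambda>y. pullback_metric c S y b z) has_derivative (\<lambda>a. c * trace ((J ** D b) **
      (J ** second_derivative S v z a + - (J ** D a ** J) ** D z)
      + (J ** second_derivative S v b a + - (J ** D a ** J) ** D b) ** (J ** D z)))) (at v)"
    unfolding pullback_metric_def
    using has_derivative_mult_right[OF bounded_linear.has_derivative[OF bounded_linear_trace bm[OF dM[of b] dM[of z]]], of c]
    by (simp add: J_def D_def)
  then show ?thesis
    by (rule has_derivative_eq_rhs) (simp add: fun_eq_iff matrix_add_ldistrib matrix_mult_add_left
      matrix_mult_minus matrix_mult_diff trace_add trace_sub trace_minus matrix_mul_assoc algebra_simps)
qed

text \<open>The right-hand side of \<open>u\<close> is the ambient Levi-Civita derivative along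
  \<open>S\<close>; its correction term vanishes the acceleration of the curves
  \<open>x exp (t X)\<close>, where the second derivative is \<open>a J a\<close>. The hypothesis
  says that this ambient vector is tangent to the image, so that it represents the intrinsic
  connection as well.\<close>

lemma koszul_pullback_metric:
  fixes S :: "'e::euclidean_space \<Rightarrow> real^'n^'n"
  assumes "open V" "v \<in> V" "\<And>y. y \<in> V \<Longrightarrow> invertible (S y)" "Ck_on 2 S V"
  defines "J \<equiv> matrix_inv (S v)" and "D \<equiv> frechet_derivative S (at v)"
  assumes u: "D u = second_derivative S v a b - (1/2) *\<^sub>R (D a ** J ** D b + D b ** J ** D a)"
  shows "2 * pullback_metric c S v u z =
       frechet_derivative (\<lambda>y. pullback_metric c S y b z) (at v) a
     + frechet_derivative (\<lambda>y. pullback_metric c S y a z) (at v) b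
     - frechet_derivative (\<lambda>y. pullback_metric c S y a b) (at v) z"
proof -
  have dg: "frechet_derivative (\<lambda>y. pullback_metric c S y b z) (at v) a =
    c * (trace (J ** second_derivative S v b a ** (J ** D z)) - trace (J ** D a ** (J ** D b) ** (J ** D z))
      + trace (J ** D b ** (J ** second_derivative S v z a)) - trace (J ** D b ** (J ** D a) ** (J ** D z)))"
    for a b z
    using fun_cong[OF frechet_derivative_at[OF has_derivative_pullback_metric[OF assms(1-4)]]]
    by (simp add: J_def D_def)
  note s = second_derivative_symmetric[OF assms(1,4,2)]
  have t: "trace (J ** D b ** (J ** second_derivative S v z a)) = trace (J ** second_derivative S v a z ** (J ** D b))"
    for a b z using trace_mul_sym[of "J ** D b" "J ** second_derivative S v z a"] s by simp
  have "2 * pullback_metric c S v u z = c * (2 * trace (J ** second_derivative S v a b ** (J ** D z))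
      - trace (J ** D a ** (J ** D b) ** (J ** D z)) - trace (J ** D b ** (J ** D a) ** (J ** D z)))"
    unfolding pullback_metric_def J_def[symmetric] D_def[symmetric] u
    by (simp add: matrix_mult_diff matrix_add_ldistrib matrix_mult_add_left matrix_scaleR_mult
        trace_sub trace_add trace_scaleR matrix_mul_assoc algebra_simps)
  \<comment> \<open>Up to cyclic rotation only two cubic traces occur, in the orders a b z and b a
    z. Each of the three derivatives contains both once, and the signs +, +, - leave one copy of
    each.\<close>
  then show ?thesis
    using trace_cyclic3(1)[of "J ** D a" "J ** D b" "J ** D z"] trace_cyclic3(1)[of "J ** D z" "J ** D b" "J ** D a"]
      trace_cyclic3(2)[of "J ** D z" "J ** D b" "J ** D a"] trace_cyclic3(2)[of "J ** D b" "J ** D a" "J ** D z"]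
    unfolding dg t by (simp add: s[of a b] s[of z] algebra_simps)
qed

section \<open>Matrix units and tight frames of symmetric matrices\<close>

definition matrix_unit :: "'n \<times> 'n \<Rightarrow> real^'n^'n" where
  "matrix_unit p = (\<chi> i j. of_bool (p = (i, j)))"

lemma matrix_unit_nth: "matrix_unit p $ i $ j = of_bool (p = (i, j))"
  by (simp add: matrix_unit_def)

lemma transpose_matrix_unit: "transpose (matrix_unit p) = matrix_unit (prod.swap p)"
  by (cases p) (auto simp: matrix_unit_def transpose_def vec_eq_iff)

text \<open>The trace form pairs a matrix unit with its transpose, so on \<open>GL_pos\<close> the
  transposed units form the dual frame.\<close>

lemma trace_mult_matrix_unit:
  fixes M :: "real^'n^'n"
  shows "trace (M ** matrix_unit (i, j)) = M $ j $ i"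
proof -
  have "trace (M ** matrix_unit (i, j)) = (\<Sum>a\<in>UNIV. \<Sum>b\<in>UNIV. if a = j then if b = i then M $ a $ b else 0 else 0)"
    unfolding trace_def matrix_matrix_mult_def vec_lambda_beta
    by (intro sum.cong refl) (auto simp: matrix_unit_nth)
  then show ?thesis by (simp add: sum_if)
qed

lemma matrix_eq_sum_units:
  fixes M :: "real^'n^'n"
  shows "M = (\<Sum>p\<in>UNIV. M $ fst p $ snd p *\<^sub>R matrix_unit p)"
proof -
  have "(\<Sum>p\<in>UNIV. M $ fst p $ snd p *\<^sub>R matrix_unit p) $ i $ j = M $ i $ j" for i j
  proof -
    have "(\<Sum>p\<in>UNIV. M $ fst p $ snd p *\<^sub>R matrix_unit p) $ i $ j
        = (\<Sum>p\<in>UNIV. if p = (i, j) then M $ i $ j else 0)"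
      by (auto simp: matrix_unit_nth intro!: sum.cong)
    then show ?thesis by simp
  qed
  then show ?thesis by (simp add: vec_eq_iff)
qed

text \<open>For \<open>c = 1/n\<close> this is the orthogonal projection of a matrix unit to the traceless symmetric
  matrices.\<close>

definition sym_frame :: "real \<Rightarrow> 'n \<times> 'n \<Rightarrow> real^'n^'n" where
  "sym_frame c p = sym_part (matrix_unit p) - (c * of_bool (fst p = snd p)) *\<^sub>R mat 1"

lemma sym_frame_nth:
  "sym_frame c (i, j) $ m $ n =
    (of_bool (i = m \<and> j = n) + of_bool (i = n \<and> j = m)) / 2 - c * of_bool (i = j \<and> m = n)"
  by (auto simp: sym_frame_def sym_part_def matrix_unit_nth transpose_def mat_def)

lemma transpose_sym_frame: "transpose (sym_frame c p) = sym_frame c p"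
  by (cases p) (auto simp: vec_eq_iff transpose_def sym_frame_nth)

text \<open>Each off-diagonal symmetric direction occurs for both orders of the pair, which makes up
  for the squared norm 1/2 of the symmetrised unit. Both cross terms with the identity give
  \<open>- c\<close> and its square gives \<open>+ n c^2\<close>; the constant is 0 at
  \<open>c = 0\<close> and 1/n at \<open>c = 1/n\<close>.\<close>

lemma casimir_sym_frame:
  "casimir (2 * c - real CARD('n) * c\<^sup>2) UNIV (sym_frame c :: 'n::finite \<times> 'n \<Rightarrow> real^'n^'n)"
  unfolding casimir_def
proof (intro allI)
  fix m n p q :: 'n
  have "(\<Sum>r\<in>UNIV. sym_frame c r $ m $ n * sym_frame c r $ p $ q)
     = (\<Sum>i\<in>UNIV. \<Sum>j\<in>UNIV. sym_frame c (i, j) $ m $ n * sym_frame c (i, j) $ p $ q)"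
    by (simp only: UNIV_Times_UNIV[symmetric] sum.cartesian_product')
  also have "\<dots> = (\<Sum>i\<in>UNIV. \<Sum>j\<in>UNIV.
      (if i = m then if j = n then sym_frame c (i, j) $ p $ q / 2 else 0 else 0)
    + (if i = n then if j = m then sym_frame c (i, j) $ p $ q / 2 else 0 else 0)
    - (if j = i then c * of_bool (m = n) * sym_frame c (i, j) $ p $ q else 0))"
    by (intro sum.cong refl) (auto simp: sym_frame_nth[of _ _ _ m n] algebra_simps)
  also have "\<dots> = sym_frame c (m, n) $ p $ q / 2 + sym_frame c (n, m) $ p $ q / 2
    - c * of_bool (m = n) * (\<Sum>i\<in>UNIV. sym_frame c (i, i) $ p $ q)"
    by (simp add: sum.distrib sum_subtractf sum_if sum_distrib_left)
  also have "(\<Sum>i\<in>UNIV. sym_frame c (i, i) $ p $ q) = of_bool (p = q) * (1 - real CARD('n) * c)"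
  proof -
    have "sym_frame c (i, i) $ p $ q = (if i = p then of_bool (p = q) else 0) - c * of_bool (p = q)" for i
      by (auto simp: sym_frame_nth)
    then show ?thesis by (simp only: sum_subtractf) (simp add: algebra_simps)
  qed
  also have "sym_frame c (n, m) $ p $ q = sym_frame c (m, n) $ p $ q"
    unfolding sym_frame_nth by (simp add: conj_commute eq_commute)
  also have "sym_frame c (m, n) $ p $ q / 2 + sym_frame c (m, n) $ p $ q / 2
      - c * of_bool (m = n) * (of_bool (p = q) * (1 - real CARD('n) * c))
    = (of_bool (m = p \<and> n = q) + of_bool (m = q \<and> n = p)) / 2
       - (2 * c - real CARD('n) * c\<^sup>2) * of_bool (m = n \<and> p = q)"
    unfolding sym_frame_nth of_bool_conj[of "m = n"]
    by (simp only: field_sum_of_halves) (simp add: algebra_simps power2_eq_square)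
  finally show "(\<Sum>r\<in>UNIV. sym_frame c r $ m $ n * sym_frame c r $ p $ q) =
     (of_bool (m = p \<and> n = q) + of_bool (m = q \<and> n = p)) / 2
       - (2 * c - real CARD('n) * c\<^sup>2) * of_bool (m = n \<and> p = q)" .
qed

section \<open>The ratio as a function of the Gram matrix\<close>

definition gram_ratio :: "'n \<Rightarrow> 'n \<Rightarrow> real^'n^'n \<Rightarrow> complex" where
  "gram_ratio k l S = (of_real (S $ k $ l) + \<i> * of_real (sqrt (S $ k $ k * S $ l $ l - (S $ k $ l)\<^sup>2)))
     / of_real (S $ l $ l)"

text \<open>The ratio depends on \<open>x\<close> only through \<open>Phi x\<close>: this yields the
  \<open>SO\<close>-invariance and lets both spaces share one computation.\<close>

lemma phi_psi_ratio_eq: "phi_psi_ratio k l x = gram_ratio k l (Phi x)"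
  by (simp add: phi_psi_ratio_def gram_ratio_def Psi_def)

lemma gram_ratio_root:
  assumes "S $ l $ l \<noteq> 0" "S $ k $ k * S $ l $ l - (S $ k $ l)\<^sup>2 \<ge> 0"
  shows "of_real (S $ l $ l) * (gram_ratio k l S)\<^sup>2 - 2 * of_real (S $ k $ l) * gram_ratio k l S
    + of_real (S $ k $ k) = 0"
proof -
  define a b c d where "a = complex_of_real (S $ l $ l)" and "b = complex_of_real (S $ k $ l)"
    and "c = complex_of_real (S $ k $ k)"
    and "d = complex_of_real (sqrt (S $ k $ k * S $ l $ l - (S $ k $ l)\<^sup>2))"
  have a: "a \<noteq> 0" using assms(1) by (simp add: a_def)
  have "d\<^sup>2 = c * a - b\<^sup>2"
    using assms(2) unfolding a_def b_def c_def d_def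
    by (simp add: of_real_power[symmetric] del: of_real_power)
  then have "(b + \<i> * d)\<^sup>2 - 2 * b * (b + \<i> * d) + c * a = 0"
    by (simp add: power2_eq_square algebra_simps)
  then have "a * ((b + \<i> * d) / a)\<^sup>2 - 2 * b * ((b + \<i> * d) / a) + c = 0"
    using a by (simp add: field_simps power2_eq_square)
  then show ?thesis by (simp add: gram_ratio_def a_def b_def c_def d_def)
qed

text \<open>The difference of the two sides is \<i> times the square root of the minor, so strict
  Cauchy-Schwarz is what makes the root simple.\<close>

lemma gram_ratio_simple:
  assumes "S $ l $ l \<noteq> 0" "S $ k $ k * S $ l $ l - (S $ k $ l)\<^sup>2 > 0"
  shows "of_real (S $ l $ l) * gram_ratio k l S \<noteq> of_real (S $ k $ l)"
  using assms by (simp add: gram_ratio_def)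

lemma Ck_on_gram_ratio:
  assumes "open V" "Ck_on m P V" "\<And>y. y \<in> V \<Longrightarrow> P y $ l $ l > 0"
    "\<And>y. y \<in> V \<Longrightarrow> P y $ k $ k * P y $ l $ l - (P y $ k $ l)\<^sup>2 > 0"
  shows "Ck_on m (\<lambda>y. gram_ratio k l (P y)) V"
proof (rule Ck_on_cong[OF assms(1)])
  \<comment> \<open>Square root and reciprocal as real powers of positive functions, the form to
    which \<open>Ck_on_powr\<close> applies.\<close>
  let ?d = "\<lambda>y. P y $ k $ k * P y $ l $ l + (- 1) * (P y $ k $ l * P y $ k $ l)"
  show "Ck_on m (\<lambda>y. (P y $ k $ l * P y $ l $ l powr (- 1)) *\<^sub>R 1
      + (?d y powr (1/2) * P y $ l $ l powr (- 1)) *\<^sub>R \<i>) V"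
    using assms
    by (intro Ck_on_add Ck_on_bilinear[OF _ bounded_bilinear_scaleR] Ck_on_bilinear[OF _ bounded_bilinear_mult]
        Ck_on_powr Ck_on_const Ck_on_entry) (auto simp: power2_eq_square)
  show "(P y $ k $ l * P y $ l $ l powr (- 1)) *\<^sub>R 1
      + (?d y powr (1/2) * P y $ l $ l powr (- 1)) *\<^sub>R \<i> = gram_ratio k l (P y)" if "y \<in> V" for y
    using assms(3,4)[OF that]
    by (simp add: gram_ratio_def powr_half_sqrt powr_minus_divide scaleR_conv_of_real power2_eq_square
        field_simps)
qed

lemma Phi_nth: "Phi x $ i $ j = row i x \<bullet> row j x"
  by (simp add: Phi_def matrix_matrix_mult_def transpose_def row_def inner_vec_def)

lemma Phi_minor_nonneg: "Phi x $ i $ i * Phi x $ j $ j - (Phi x $ i $ j)\<^sup>2 \<ge> 0"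
  using Cauchy_Schwarz_ineq[of "row i x" "row j x"] by (simp add: Phi_nth)

lemma Phi_diag_pos:
  assumes "det x \<noteq> 0" shows "Phi x $ l $ l > 0"
proof -
  have "row l x \<noteq> 0" using assms det_zero_row by blast
  then show ?thesis by (simp add: Phi_nth)
qed

lemma Phi_minor_pos:
  fixes x :: "real^'n^'n"
  assumes "det x \<noteq> 0" "k \<noteq> l"
  shows "Phi x $ k $ k * Phi x $ l $ l - (Phi x $ k $ l)\<^sup>2 > 0"
proof -
  let ?a = "row l x \<bullet> row l x" and ?b = "row k x \<bullet> row l x"
  \<comment> \<open>\<open>transpose x *v c\<close> is \<open>?a\<close> times the component of row
    \<open>k\<close> orthogonal to row \<open>l\<close>. Its squared norm is \<open>?a\<close> times
    the minor, and it is nonzero because the rows are independent.\<close>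
  define c where "c = ?a *\<^sub>R axis k 1 - ?b *\<^sub>R (axis l 1 :: real^'n)"
  have a: "?a > 0" using Phi_diag_pos[OF assms(1), of l] by (simp add: Phi_nth)
  have "c $ k = ?a" using assms(2) by (simp add: c_def axis_def)
  then have "c \<noteq> 0" using a by (metis order_less_irrefl zero_index)
  moreover have "invertible (transpose x)" using assms(1) by (simp add: invertible_det_nz)
  ultimately have "transpose x *v c \<noteq> 0"
    using invertible_left_inverse matrix_left_invertible_ker by blast
  moreover have "transpose x *v axis i 1 = row i x" for i
    by (simp add: matrix_vector_mul_component vec_eq_iff transpose_def inner_axis row_def)
  then have "transpose x *v c = ?a *\<^sub>R row k x - ?b *\<^sub>R row l x"
    by (simp add: c_def matrix_vector_mult_diff_distrib matrix_vector_mult_scaleR)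
  ultimately have "0 < (?a *\<^sub>R row k x - ?b *\<^sub>R row l x) \<bullet> (?a *\<^sub>R row k x - ?b *\<^sub>R row l x)" by simp
  also have "\<dots> = ?a * (row k x \<bullet> row k x * ?a - ?b\<^sup>2)"
    by (simp add: inner_diff_left inner_diff_right inner_commute algebra_simps power2_eq_square)
  finally show ?thesis using a by (simp add: Phi_nth zero_less_mult_iff)
qed

section \<open>Harmonic morphisms into the plane, chart by chart\<close>

lemma open_in_complex_plane: "open_in complex_plane U \<longleftrightarrow> open U"
  by (simp add: open_in_def complex_plane_def points_def)

lemma harmonic_morphism_chartsI:
  assumes "\<And>V p g. (V, p, g) \<in> M \<Longrightarrow> open V" "\<And>V p g. (V, p, g) \<in> M \<Longrightarrow> smooth_on V (F \<circ> p)"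
    and "\<And>V p g U f v. (V, p, g) \<in> M \<Longrightarrow> open U \<Longrightarrow> harmonic_on complex_plane U f \<Longrightarrow>
      v \<in> V \<Longrightarrow> F (p v) \<in> U \<Longrightarrow> laplacian g (\<lambda>y. f (F (p y))) v = 0"
  shows "harmonic_morphism M complex_plane F"
  unfolding harmonic_morphism_def
proof (intro conjI allI impI)
  have "the_inv_into UNIV (\<lambda>z. z) z = z" for z :: complex
    using the_inv_into_f_f[of "\<lambda>z. z" UNIV z] by simp
  then show "smooth_map M complex_plane F"
    using assms(1,2) by (auto simp: smooth_map_def complex_plane_def points_def comp_def)
next
  fix U f
  assume *: "open_in complex_plane U \<and> points M \<inter> F -` U \<noteq> {} \<and> harmonic_on complex_plane U f"
  then have U: "open U" by (simp add: open_in_complex_plane)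
  have f: "Ck_on 2 f U" using * by (auto simp: harmonic_on_def complex_plane_def comp_def)
  show "harmonic_on M (points M \<inter> F -` U) (f \<circ> F)"
    unfolding harmonic_on_def
  proof (intro ballI, clarify, intro conjI ballI)
    fix V p g assume c: "(V, p, g) \<in> M"
    then have eq: "V \<inter> p -` (points M \<inter> F -` U) = V \<inter> (F \<circ> p) -` U" by (auto simp: points_def)
    have sm: "Ck_on m (F \<circ> p) V" for m using assms(2)[OF c] by (simp add: smooth_on_def)
    have "open (V \<inter> (F \<circ> p) -` U)"
      using continuous_open_preimage[OF _ assms(1)[OF c] U] sm[of 0] by simp
    then have "Ck_on 2 (\<lambda>y. f ((F \<circ> p) y)) (V \<inter> (F \<circ> p) -` U)"
      by (rule Ck_on_compose[OF _ U _ f]) (auto intro: Ck_on_subset[OF sm[unfolded comp_def]])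
    then show "Ck_on 2 (f \<circ> F \<circ> p) (V \<inter> p -` (points M \<inter> F -` U))" unfolding eq by (simp add: comp_def)
    show "laplacian g (f \<circ> F \<circ> p) v = 0" if "v \<in> V \<inter> p -` (points M \<inter> F -` U)" for v
      using assms(3)[OF c U, of f v] * that by (auto simp: comp_def)
  qed
qed

text \<open>All conditions of the locale are local to \<open>V\<close>. This is used for
  \<open>quotient_metric\<close>, whose identification with a pullback is established only on the
  domain of the chart.\<close>

lemma framed_metric_cong:
  assumes "framed_metric V g v I e e' \<Gamma>" and eq: "\<And>y a b. y \<in> V \<Longrightarrow> g' y a b = g y a b"
  shows "framed_metric V g' v I e e' \<Gamma>"
proof -
  interpret framed_metric V g v I e e' \<Gamma> by fact
  have g': "g' y = g y" if "y \<in> V" for y using eq[OF that] by (simp add: fun_eq_iff)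
  have fd: "frechet_derivative (\<lambda>y. g' y a b) (at v) = frechet_derivative (\<lambda>y. g y a b) (at v)" for a b
    by (rule frechet_derivative_cong_open[OF open_V v_in eq])
  show ?thesis
  proof (rule framed_metric.intro)
    show "(\<lambda>y. g' y a b) differentiable at v" for a b
      by (rule differentiable_cong_open[OF open_V v_in eq[symmetric] metric_differentiable])
    show "w = (\<Sum>i\<in>I. g' v w (e' i) *\<^sub>R e i)" for w using frame[of w] by (simp add: g' v_in)
    show "2 * g' v (\<Gamma> a b) z = frechet_derivative (\<lambda>y. g' y b z) (at v) a
       + frechet_derivative (\<lambda>y. g' y a z) (at v) b - frechet_derivative (\<lambda>y. g' y a b) (at v) z" for a b z
      using koszul[of a b z] by (simp add: g' v_in fd)
    show "a = 0" if "y \<in> V" "\<And>b. g' y a b = 0" for y a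
      using metric_nondegenerate[OF that(1)] that(2) g'[OF that(1)] by simp
    show "g' y a b = g' y b a" if "y \<in> V" for y a b using metric_sym[OF that] g'[OF that] by simp
    show "linear (g' y a)" if "y \<in> V" for y a using metric_linear[OF that] g'[OF that] by simp
  qed (use open_V v_in finite_frame in auto)
qed

text \<open>The frame identity is asked for at every point of \<open>V\<close> because it also
  yields nondegeneracy there: a vector orthogonal to everything has only zero coefficients.\<close>

lemma framed_metric_pullback:
  fixes S :: "'e::euclidean_space \<Rightarrow> real^'n^'n" and e e' :: "'e \<Rightarrow> 'i \<Rightarrow> 'e"
  assumes "open V" "v \<in> V" "\<And>y. y \<in> V \<Longrightarrow> invertible (S y)" "Ck_on 2 S V" "finite I"
    and frame: "\<And>y w. y \<in> V \<Longrightarrow> w = (\<Sum>i\<in>I. pullback_metric c S y w (e' y i) *\<^sub>R e y i)"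
    and \<Gamma>: "\<And>a b. frechet_derivative S (at v) (\<Gamma> a b) = second_derivative S v a b
      - (1/2) *\<^sub>R (frechet_derivative S (at v) a ** matrix_inv (S v) ** frechet_derivative S (at v) b
        + frechet_derivative S (at v) b ** matrix_inv (S v) ** frechet_derivative S (at v) a)"
  shows "framed_metric V (pullback_metric c S) v I (e v) (e' v) \<Gamma>"
proof (rule framed_metric.intro)
  show "linear (pullback_metric c S y a)" if "y \<in> V" for y a
    using assms(4) that by (intro linear_pullback_metric) (simp add: Ck_on_2_iff)
  show "a = 0" if "y \<in> V" "\<And>b. pullback_metric c S y a b = 0" for y a
    using frame[OF that(1), of a] that(2) by simp
  show "(\<lambda>y. pullback_metric c S y a b) differentiable at v" for a b
    using has_derivative_pullback_metric[OF assms(1-4)] unfolding differentiable_def by blast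
  show "w = (\<Sum>i\<in>I. pullback_metric c S v w (e' v i) *\<^sub>R e v i)" for w
    by (rule frame[OF assms(2)])
qed (use assms pullback_metric_sym koszul_pullback_metric[OF assms(1-4) \<Gamma>] in auto)

lemma matrix_inv_eq:
  fixes A B :: "real^'n^'n"
  assumes "A ** B = mat 1" shows "matrix_inv A = B"
proof -
  have "B ** A = mat 1" using assms matrix_left_right_inverse by blast
  then have "invertible A" using assms by (auto simp: invertible_def)
  then have "matrix_inv A ** (A ** B) = B" by (simp add: matrix_mul_assoc matrix_inv_mult)
  then show ?thesis by (simp add: assms)
qed

section \<open>The general linear group\<close>

lemma has_derivative_Phi: "(Phi has_derivative (\<lambda>a. y ** transpose a + a ** transpose y)) (at y)"
  unfolding Phi_def[abs_def]
  by (rule bounded_bilinear.FDERIV[OF bounded_bilinear_matrix_mult has_derivative_ident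
        bounded_linear_imp_has_derivative[OF bounded_linear_transpose]])

lemma frechet_derivative_Phi:
  "frechet_derivative Phi (at y) a = y ** transpose a + a ** transpose y"
  by (rule fun_cong[OF frechet_derivative_at[OF has_derivative_Phi, symmetric]])

lemma second_derivative_Phi:
  "second_derivative Phi y a b = b ** transpose a + a ** transpose b"
proof -
  note bl = bounded_linear_compose[OF bounded_bilinear.bounded_linear_right[OF bounded_bilinear_matrix_mult] bounded_linear_transpose]
    bounded_bilinear.bounded_linear_left[OF bounded_bilinear_matrix_mult]
  have "((\<lambda>y. y ** transpose a + a ** transpose y) has_derivative
      (\<lambda>b. b ** transpose a + a ** transpose b)) (at y)"
    by (intro has_derivative_add bounded_linear_imp_has_derivative bl)
  then show ?thesis
    unfolding second_derivative_def frechet_derivative_Phi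
    by (rule fun_cong[OF frechet_derivative_at[symmetric]])
qed

lemma Ck_on_Phi:
  assumes "open V" "Ck_on m \<sigma> V" shows "Ck_on m (\<lambda>y. Phi (\<sigma> y)) V"
  unfolding Phi_def
  by (intro Ck_on_bilinear[OF _ bounded_bilinear_matrix_mult] Ck_on_bounded_linear[OF _ bounded_linear_transpose] assms)

lemma transpose_Phi: "transpose (Phi x) = Phi x"
  by (simp add: Phi_def matrix_transpose_mul)

lemma invertible_Phi: "invertible x \<Longrightarrow> invertible (Phi x)" for x :: "real^'n^'n"
  by (simp add: Phi_def invertible_det_nz det_mul)

lemma open_GL_pos: "open (GL_pos :: (real^'n^'n) set)"
proof -
  have "continuous_on UNIV (det :: real^'n^'n \<Rightarrow> real)"
    unfolding det_def[abs_def] by (intro continuous_intros)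
  from open_Collect_less[OF continuous_on_const this] show ?thesis unfolding GL_pos_def .
qed

lemma matrix_mult_sum_right:
  fixes A :: "real^'n^'m" and B :: "'i \<Rightarrow> real^'p^'n"
  shows "A ** (\<Sum>i\<in>I. B i) = (\<Sum>i\<in>I. A ** B i)"
  by (rule linear_sum[OF bounded_linear.linear[OF
        bounded_bilinear.bounded_linear_right[OF bounded_bilinear_matrix_mult]]])

lemma transpose_sum: "transpose (\<Sum>i\<in>I. B i) = (\<Sum>i\<in>I. transpose (B i :: real^'n^'m))"
  by (rule linear_sum[OF bounded_linear.linear[OF bounded_linear_transpose]])

lemma sym_part_square:
  fixes U :: "real^'n^'n"
  shows "4 *\<^sub>R (sym_part U ** sym_part U) =
    U ** U + U ** transpose U + transpose U ** U + transpose U ** transpose U"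
  by (simp add: sym_part_def matrix_scaleR_mult matrix_add_ldistrib matrix_mult_add_left scaleR_add_right[symmetric])

lemma laplacian_GL_compose_ratio:
  fixes x :: "real^'n^'n"
  assumes x: "x \<in> GL_pos" and kl: "k \<noteq> l"
    and f: "open U" "harmonic_on complex_plane U f" "phi_psi_ratio k l x \<in> U"
  shows "laplacian GL_metric (\<lambda>y. f (phi_psi_ratio k l y)) x = 0"
proof -
  let ?J = "matrix_inv x"
  \<comment> \<open>The Levi-Civita connection of the bi-invariant metric on constant matrix fields;
    the second derivative of the identity is 0.\<close>
  define \<Gamma> where "\<Gamma> a b = - ((1/2) *\<^sub>R (a ** ?J ** b + b ** ?J ** a))" for a b
  have inv: "invertible y" if "y \<in> GL_pos" for y :: "real^'n^'n"
    using that by (simp add: GL_pos_def invertible_det_nz)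
  have id1: "frechet_derivative (\<lambda>y. y) (at y) = (\<lambda>a. a)" for y :: "real^'n^'n"
    using frechet_derivative_at[OF has_derivative_ident] by metis
  have id2: "second_derivative (\<lambda>y. y) y a b = 0" for y a b :: "real^'n^'n"
    by (simp add: second_derivative_def id1 frechet_derivative_const)
  have GL: "GL_metric = pullback_metric 1 (\<lambda>y::real^'n^'n. y)"
    by (simp add: fun_eq_iff GL_metric_def pullback_metric_def id1)
  let ?u = "matrix_unit :: 'n \<times> 'n \<Rightarrow> real^'n^'n"
  interpret framed_metric GL_pos GL_metric x UNIV "\<lambda>p. x ** ?u p" "\<lambda>p. x ** transpose (?u p)" \<Gamma>
    unfolding GL
  proof (rule framed_metric_pullback[OF open_GL_pos x])
    show "Ck_on 2 (\<lambda>y. y) (GL_pos :: (real^'n^'n) set)"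
      by (rule Ck_on_linear[OF open_GL_pos bounded_linear_ident])
    show "frechet_derivative (\<lambda>y. y) (at x) (\<Gamma> a b) = second_derivative (\<lambda>y. y) x a b
      - (1/2) *\<^sub>R (frechet_derivative (\<lambda>y. y) (at x) a ** matrix_inv x ** frechet_derivative (\<lambda>y. y) (at x) b
        + frechet_derivative (\<lambda>y. y) (at x) b ** matrix_inv x ** frechet_derivative (\<lambda>y. y) (at x) a)" for a b
      by (simp add: id1 id2 \<Gamma>_def)
    fix y w :: "real^'n^'n" assume y: "y \<in> GL_pos"
    note yi = matrix_inv_mult[OF inv[OF y]]
    have "pullback_metric 1 (\<lambda>y. y) y w (y ** transpose (?u p)) = (matrix_inv y ** w) $ fst p $ snd p" for p
      by (cases p) (simp add: pullback_metric_def id1 matrix_mul_assoc yi transpose_matrix_unit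
          matrix_mul_assoc[symmetric, of _ y] trace_mult_matrix_unit)
    then have "(\<Sum>p\<in>UNIV. pullback_metric 1 (\<lambda>y. y) y w (y ** transpose (?u p)) *\<^sub>R (y ** ?u p))
        = y ** (\<Sum>p\<in>UNIV. (matrix_inv y ** w) $ fst p $ snd p *\<^sub>R ?u p)"
      by (simp add: matrix_mult_sum_right matrix_scaleR_mult)
    also have "\<dots> = w" by (simp add: matrix_eq_sum_units[symmetric] matrix_mul_assoc yi)
    finally show "w = (\<Sum>p\<in>UNIV. pullback_metric 1 (\<lambda>y. y) y w (y ** transpose (?u p)) *\<^sub>R (y ** ?u p))" ..
  qed (use inv in auto)
  have det: "det y \<noteq> 0" if "y \<in> GL_pos" for y :: "real^'n^'n" using that by (simp add: GL_pos_def)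
  note pos = Phi_diag_pos[OF det] Phi_minor_pos[OF det kl]
  have P: "Ck_on 2 Phi (GL_pos :: (real^'n^'n) set)"
    by (rule Ck_on_Phi[OF open_GL_pos Ck_on_linear[OF open_GL_pos bounded_linear_ident]])
  note xi = matrix_inv_mult[OF inv[OF x]]
  have cancel: "A ** ?J ** x = A" for A :: "real^'n^'n"
    by (metis matrix_mul_assoc matrix_mul_rid xi(2))
  \<comment> \<open>\<open>c = 0\<close>: the determinant is free on \<open>GL_pos\<close>, so no
    trace is removed. The skew part of a unit leaves \<open>Phi\<close> unchanged to first order,
    and therefore a unit and its transpose change it alike.\<close>
  have E: "sym_frame 0 p = sym_part (?u p)" for p by (simp add: sym_frame_def)
  show ?thesis
    using f unfolding phi_psi_ratio_eq
  proof (intro isotropic_root_harmonic[where P = Phi and x = x and E = "sym_frame 0" and k = k and l = l])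
    show "Ck_on 2 (\<lambda>y. gram_ratio k l (Phi y)) GL_pos"
      by (rule Ck_on_gram_ratio[OF open_GL_pos P]) (use pos in auto)
    show "casimir (2 * 0 - real CARD('n) * 0\<^sup>2) UNIV (sym_frame 0 :: 'n \<times> 'n \<Rightarrow> real^'n^'n)"
      by (rule casimir_sym_frame)
    fix p :: "'n \<times> 'n"
    show "frechet_derivative Phi (at x) (x ** ?u p) = 2 *\<^sub>R (x ** sym_frame 0 p ** transpose x)"
      "frechet_derivative Phi (at x) (x ** transpose (?u p)) = 2 *\<^sub>R (x ** sym_frame 0 p ** transpose x)"
      by (simp_all add: frechet_derivative_Phi E sym_part_def matrix_transpose_mul matrix_scaleR_mult
          matrix_add_ldistrib matrix_mult_add_left matrix_mul_assoc add.commute)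
    let ?U = "?u p"
    \<comment> \<open>The second derivative of \<open>Phi\<close> supplies only the squares of
      \<open>?U\<close> and of its transpose; the connection term supplies the mixed products
      \<open>N\<close>, completing \<open>4 *\<^sub>R (sym_part ?U ** sym_part ?U)\<close>.\<close>
    define N where "N = ?U ** transpose ?U + transpose ?U ** ?U"
    have N: "transpose N = N" by (simp add: N_def transpose_add matrix_transpose_mul)
    have G: "\<Gamma> (x ** ?U) (x ** transpose ?U) = (- 1/2) *\<^sub>R (x ** N)"
      by (simp add: \<Gamma>_def N_def cancel matrix_add_ldistrib matrix_mul_assoc)
    have "frechet_derivative Phi (at x) (r *\<^sub>R (x ** N)) = (2 * r) *\<^sub>R (x ** N ** transpose x)" for r
      by (simp add: frechet_derivative_Phi transpose_scalar matrix_transpose_mul N matrix_scaleR_mult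
          matrix_mul_assoc flip: scaleR_add_left)
    from this[of "- 1/2"] have "frechet_derivative Phi (at x) (\<Gamma> (x ** ?U) (x ** transpose ?U))
        = - (x ** N ** transpose x)"
      unfolding G by simp
    then have "second_derivative Phi x (x ** transpose ?U) (x ** ?U)
       - frechet_derivative Phi (at x) (\<Gamma> (x ** ?U) (x ** transpose ?U))
      = x ** (?U ** ?U + ?U ** transpose ?U + transpose ?U ** ?U + transpose ?U ** transpose ?U) ** transpose x"
      by (simp add: second_derivative_Phi N_def matrix_transpose_mul
          matrix_add_ldistrib matrix_mult_add_left matrix_mul_assoc algebra_simps)
    then show "second_derivative Phi x (x ** transpose ?U) (x ** ?U)
       - frechet_derivative Phi (at x) (\<Gamma> (x ** ?U) (x ** transpose ?U))
      = 4 *\<^sub>R (x ** (sym_frame 0 p ** sym_frame 0 p) ** transpose x)"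
      by (simp add: E sym_part_square[symmetric] matrix_scaleR_mult)
    show "of_real (Phi x $ l $ l) * gram_ratio k l (Phi x) \<noteq> of_real (Phi x $ k $ l)"
      using pos[OF x] by (intro gram_ratio_simple) auto
    show "of_real (Phi y $ l $ l) * (gram_ratio k l (Phi y))\<^sup>2 - 2 * of_real (Phi y $ k $ l) * gram_ratio k l (Phi y)
       + of_real (Phi y $ k $ k) = 0" if "y \<in> GL_pos" for y
      using pos[OF that] by (intro gram_ratio_root) auto
  qed (simp_all add: P Phi_def[of x] transpose_sym_frame)
qed

section \<open>The symmetric space\<close>

text \<open>The frame is the orthogonal projection of the orthonormal basis of matrix units. On a
  traceless symmetric \<open>M\<close> its coefficients are the entries of \<open>M\<close>, and
  projecting the expansion of \<open>M\<close> in units returns \<open>M\<close>.\<close>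

lemma matrix_eq_sum_sym_frame:
  fixes M :: "real^'n^'n"
  assumes "M \<in> sym_traceless"
  shows "M = (\<Sum>p\<in>UNIV. trace (M ** sym_frame (1 / real CARD('n)) p) *\<^sub>R sym_frame (1 / real CARD('n)) p)"
proof -
  have sym: "transpose M = M" and tr: "trace M = 0" using assms by (auto simp: sym_traceless_def)
  have nth: "M $ i $ j = M $ j $ i" for i j using sym by (metis transpose_def vec_lambda_beta)
  let ?F = "sym_frame (1 / real CARD('n)) :: _ \<Rightarrow> real^'n^'n"
  have "trace (M ** ?F (i, j)) = M $ i $ j" for i j
    using nth[of i j] tr
    by (simp add: sym_frame_def sym_part_def transpose_matrix_unit matrix_mult_diff matrix_scaleR_mult
        matrix_add_ldistrib trace_sub trace_scaleR trace_add trace_mult_matrix_unit)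
  then have "(\<Sum>p\<in>UNIV. trace (M ** ?F p) *\<^sub>R ?F p) = (\<Sum>p\<in>UNIV. M $ fst p $ snd p *\<^sub>R ?F p)"
    by (intro sum.cong refl) (metis prod.collapse)
  also have "\<dots> = sym_part (\<Sum>p\<in>UNIV. M $ fst p $ snd p *\<^sub>R matrix_unit p)
      - (\<Sum>p\<in>UNIV. (M $ fst p $ snd p * (1 / real CARD('n) * of_bool (fst p = snd p))) *\<^sub>R mat 1)"
    by (simp add: sym_frame_def sym_part_def transpose_sum scaleR_diff_right sum_subtractf transpose_scalar
        scaleR_add_right sum.distrib scaleR_sum_right)
  \<comment> \<open>The identity parts of the frame add up to a multiple of
    \<open>trace M\<close>.\<close>
  also have "(\<Sum>p\<in>UNIV. (M $ fst p $ snd p * (1 / real CARD('n) * of_bool (fst p = snd p))) *\<^sub>R (mat 1 :: real^'n^'n)) = 0"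
  proof -
    have "(\<Sum>p\<in>UNIV. M $ fst p $ snd p * (1 / real CARD('n) * of_bool (fst p = snd p)))
        = (\<Sum>i\<in>UNIV. \<Sum>j\<in>UNIV. if j = i then M $ i $ j / real CARD('n) else 0)"
      unfolding UNIV_Times_UNIV[symmetric] sum.cartesian_product' by (intro sum.cong refl) auto
    also have "\<dots> = 0" using tr by (simp add: trace_def sum_divide_distrib[symmetric])
    finally show ?thesis by (simp only: scaleR_sum_left[symmetric]) simp
  qed
  also have "sym_part (\<Sum>p\<in>UNIV. M $ fst p $ snd p *\<^sub>R matrix_unit p) = M"
    by (simp add: matrix_eq_sum_units[symmetric] sym_part_def sym flip: scaleR_add_left)
  finally show ?thesis by simp
qed

lemma sym_frame_traceless: "sym_frame (1 / real CARD('n)) p \<in> (sym_traceless :: (real^'n::finite^'n) set)"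
proof -
  obtain i j where p: "p = (i, j)" by (cases p)
  have "trace (sym_frame (1 / real CARD('n)) (i, j) :: real^'n^'n) = 0"
  proof -
    have "trace (sym_frame (1 / real CARD('n)) (i, j) :: real^'n^'n)
        = (\<Sum>m\<in>UNIV. (if m = i then of_bool (i = j) else 0) - of_bool (i = j) / real CARD('n))"
      unfolding trace_def by (intro sum.cong refl) (auto simp: sym_frame_nth)
    then show ?thesis by (simp only: sum_subtractf) simp
  qed
  then show ?thesis by (simp add: sym_traceless_def transpose_sym_frame p)
qed

lemma transpose_diff: "transpose (A - B) = transpose A - transpose (B :: real^'n^'m)"
  by (simp add: transpose_def vec_eq_iff)

section \<open>Geometry in an arbitrary chart of the quotient\<close>

context
  fixes V :: "'m::euclidean_space set" and \<sigma> :: "'m \<Rightarrow> real^'n^'n"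
  assumes open_dom: "open V" and smooth: "smooth_on V \<sigma>" and SL: "\<sigma> ` V \<subseteq> SL"
    and bij: "\<forall>v\<in>V. bij_betw (p_component \<sigma> v) UNIV sym_traceless"
begin

lemma lift_Ck: "Ck_on m \<sigma> V"
  using smooth by (simp add: smooth_on_def)

lemma lift_differentiable: "y \<in> V \<Longrightarrow> \<sigma> differentiable at y"
  using lift_Ck[of 2] by (simp add: Ck_on_2_iff)

lemma lift_det: "y \<in> V \<Longrightarrow> det (\<sigma> y) = 1"
  using SL by (auto simp: SL_def)

lemma lift_invertible: "y \<in> V \<Longrightarrow> invertible (\<sigma> y)"
  by (simp add: invertible_det_nz lift_det)

lemma lift_transpose_inv:
  assumes "y \<in> V"
  shows "transpose (\<sigma> y) ** transpose (matrix_inv (\<sigma> y)) = mat 1"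
    "transpose (matrix_inv (\<sigma> y)) ** transpose (\<sigma> y) = mat 1"
  using matrix_inv_mult[OF lift_invertible[OF assms]] by (metis matrix_transpose_mul transpose_mat)+

lemma matrix_inv_Phi_lift:
  assumes "y \<in> V"
  shows "matrix_inv (Phi (\<sigma> y)) = transpose (matrix_inv (\<sigma> y)) ** matrix_inv (\<sigma> y)"
proof (rule matrix_inv_eq)
  have "Phi (\<sigma> y) ** (transpose (matrix_inv (\<sigma> y)) ** matrix_inv (\<sigma> y))
      = \<sigma> y ** (transpose (\<sigma> y) ** transpose (matrix_inv (\<sigma> y))) ** matrix_inv (\<sigma> y)"
    by (simp only: Phi_def matrix_mul_assoc)
  then show "Phi (\<sigma> y) ** (transpose (matrix_inv (\<sigma> y)) ** matrix_inv (\<sigma> y)) = mat 1"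
    by (simp add: lift_transpose_inv assms matrix_inv_mult lift_invertible)
qed

lemma p_component_traceless:
  assumes "y \<in> V" shows "p_component \<sigma> y a \<in> sym_traceless"
  using bij assms by (auto simp: bij_betw_def)

lemma p_component_sym: "y \<in> V \<Longrightarrow> transpose (p_component \<sigma> y a) = p_component \<sigma> y a"
  and p_component_trace: "y \<in> V \<Longrightarrow> trace (p_component \<sigma> y a) = 0"
  using p_component_traceless by (auto simp: sym_traceless_def)

lemma linear_p_component:
  assumes "y \<in> V" shows "linear (p_component \<sigma> y)"
  using linear_frechet_derivative[OF lift_differentiable[OF assms]]
  by (simp add: p_component_def sym_part_def linear_iff matrix_add_ldistrib matrix_scaleR_mult
      transpose_add transpose_scalar scaleR_add_right)

lemma Phi_lift_Ck: "Ck_on m (\<lambda>y. Phi (\<sigma> y)) V"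
  by (rule Ck_on_Phi[OF open_dom lift_Ck])

text \<open>The skew part of \<sigma>^-1 d\<sigma> cancels in \<sigma> \<sigma>^t, so the
  differential of P sees exactly the \<open>p_component\<close>; the 2 comes from adding a matrix to
  its transpose.\<close>

lemma Phi_lift_derivative:
  assumes "y \<in> V"
  shows "frechet_derivative (\<lambda>y. Phi (\<sigma> y)) (at y) a = 2 *\<^sub>R (\<sigma> y ** p_component \<sigma> y a ** transpose (\<sigma> y))"
proof -
  let ?s = "\<sigma> y" and ?J = "matrix_inv (\<sigma> y)" and ?d = "frechet_derivative \<sigma> (at y) a"
  have "frechet_derivative (\<lambda>y. Phi (\<sigma> y)) (at y) a = frechet_derivative Phi (at (\<sigma> y)) ?d"
    using has_derivative_Phi lift_differentiable[OF assms]
    by (intro frechet_derivative_compose) (auto simp: differentiable_def)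
  also have "\<dots> = ?s ** transpose ?d + ?d ** transpose ?s" by (rule frechet_derivative_Phi)
  also have "\<dots> = ?s ** transpose ?d ** (transpose ?J ** transpose ?s) + (?s ** ?J) ** ?d ** transpose ?s"
    by (simp add: lift_transpose_inv assms matrix_inv_mult lift_invertible)
  also have "\<dots> = 2 *\<^sub>R (?s ** p_component \<sigma> y a ** transpose ?s)"
    by (simp add: p_component_def sym_part_def matrix_scaleR_mult matrix_add_ldistrib matrix_mult_add_left
        matrix_transpose_mul matrix_mul_assoc add.commute)
  finally show ?thesis .
qed

lemma inv_Phi_lift_derivative:
  assumes "y \<in> V"
  shows "matrix_inv (Phi (\<sigma> y)) ** frechet_derivative (\<lambda>y. Phi (\<sigma> y)) (at y) a
    = 2 *\<^sub>R (transpose (matrix_inv (\<sigma> y)) ** p_component \<sigma> y a ** transpose (\<sigma> y))"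
proof -
  have "A ** matrix_inv (\<sigma> y) ** \<sigma> y = A" for A :: "real^'n^'n"
    by (metis matrix_inv_mult(2)[OF lift_invertible[OF assms]] matrix_mul_assoc matrix_mul_rid)
  then show ?thesis
    by (simp add: matrix_inv_Phi_lift[OF assms] Phi_lift_derivative[OF assms] matrix_scaleR_mult matrix_mul_assoc)
qed

text \<open>The infinitesimal form of det P = 1. Differentiated once more, it shows the ambient
  connection to be tangent.\<close>

lemma trace_inv_Phi_lift_derivative:
  assumes "y \<in> V"
  shows "trace (matrix_inv (Phi (\<sigma> y)) ** frechet_derivative (\<lambda>y. Phi (\<sigma> y)) (at y) a) = 0"
proof -
  have "trace (transpose (matrix_inv (\<sigma> y)) ** p_component \<sigma> y a ** transpose (\<sigma> y))
      = trace (transpose (\<sigma> y) ** transpose (matrix_inv (\<sigma> y)) ** p_component \<sigma> y a)"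
    by (rule trace_cyclic3(1))
  then show ?thesis
    by (simp add: inv_Phi_lift_derivative[OF assms] trace_scaleR lift_transpose_inv[OF assms] p_component_trace[OF assms])
qed

text \<open>The logarithmic derivative of P is twice a conjugate of the \<open>p_component\<close>;
  the trace ignores the conjugation, and 1/4 compensates for the two factors 2.\<close>

lemma quotient_metric_eq_pullback:
  assumes "y \<in> V"
  shows "quotient_metric \<sigma> y a b = pullback_metric (1/4) (\<lambda>y. Phi (\<sigma> y)) y a b"
proof -
  let ?K = "transpose (matrix_inv (\<sigma> y))" and ?T = "transpose (\<sigma> y)"
  have c: "A ** ?T ** ?K = A" for A :: "real^'n^'n"
    by (metis lift_transpose_inv(1)[OF assms] matrix_mul_assoc matrix_mul_rid)
  have "trace (?K ** (p_component \<sigma> y a ** p_component \<sigma> y b) ** ?T)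
      = trace (?T ** ?K ** (p_component \<sigma> y a ** p_component \<sigma> y b))" by (rule trace_cyclic3(1))
  then show ?thesis
    by (simp add: pullback_metric_def quotient_metric_def inv_Phi_lift_derivative[OF assms] matrix_scaleR_mult
        trace_scaleR matrix_mul_assoc c lift_transpose_inv[OF assms])
qed

lemma laplacian_chart_compose_ratio:
  assumes v: "v \<in> V" and kl: "k \<noteq> l"
    and f: "open U" "harmonic_on complex_plane U f" "phi_psi_ratio k l (\<sigma> v) \<in> U"
  shows "laplacian (quotient_metric \<sigma>) (\<lambda>y. f (phi_psi_ratio k l (\<sigma> y))) v = 0"
proof -
  let ?P = "\<lambda>y. Phi (\<sigma> y)" and ?c = "1 / real CARD('n)"
  let ?F = "sym_frame ?c :: _ \<Rightarrow> real^'n^'n"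
  let ?D = "frechet_derivative ?P (at v)" and ?J = "matrix_inv (?P v)" and ?K = "matrix_inv (\<sigma> v)"
  \<comment> \<open>Carries traceless symmetric matrices to tangent vectors of the chart; both the
    frame and the connection are built with it.\<close>
  define q where "q y = inv_into UNIV (p_component \<sigma> y)" for y
  have q: "p_component \<sigma> y (q y M) = M" if "y \<in> V" "M \<in> sym_traceless" for y M
    using bij that by (auto simp: q_def bij_betw_def intro: f_inv_into_f)
  have inj: "a = b" if "y \<in> V" "p_component \<sigma> y a = p_component \<sigma> y b" for y a b
    using bij that by (auto simp: bij_betw_def dest: injD)
  have P_inv: "invertible (?P y)" if "y \<in> V" for y by (intro invertible_Phi lift_invertible that)
  note P = Phi_lift_Ck[of 2]
  \<comment> \<open>The ambient covariant derivative of dP. It lies in the range of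
    \<open>?D\<close> once \<open>?K ** H a b ** transpose ?K\<close> is symmetric and traceless;
    the 1/2 in \<open>\<Gamma>\<close> undoes the 2 in \<open>Phi_lift_derivative\<close>.\<close>
  define H where "H a b = second_derivative ?P v a b - (1/2) *\<^sub>R (?D a ** ?J ** ?D b + ?D b ** ?J ** ?D a)" for a b
  define \<Gamma> where "\<Gamma> a b = q v ((1/2) *\<^sub>R (?K ** H a b ** transpose ?K))" for a b
  have D_sym: "transpose (?D a) = ?D a" for a
    by (simp add: Phi_lift_derivative[OF v] transpose_scalar matrix_transpose_mul p_component_sym[OF v] matrix_mul_assoc)
  have J_sym: "transpose ?J = ?J" by (simp add: matrix_inv_Phi_lift[OF v] matrix_transpose_mul)
  have H_sym: "transpose (H a b) = H a b" for a b
  proof -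
    have "transpose (second_derivative ?P v a b) = second_derivative ?P v a b"
      using second_derivative_bounded_linear[OF open_dom bounded_linear_transpose P v, of a b]
      by (simp add: transpose_Phi)
    then show ?thesis
      by (simp add: H_def transpose_diff transpose_scalar transpose_add matrix_transpose_mul D_sym J_sym
          matrix_mul_assoc add.commute)
  qed
  \<comment> \<open>Differentiating the vanishing trace of P^-1 dP(a) in direction b expresses the
    trace of P^-1 times the second derivative by exactly the term that \<open>H\<close>
    subtracts.\<close>
  have H_trace: "trace (?J ** H a b) = 0" for a b
  proof -
    have "((\<lambda>y. frechet_derivative ?P (at y) a) has_derivative second_derivative ?P v a) (at v)"
      using P v has_derivative_frechet[of "\<lambda>y. frechet_derivative ?P (at y) a" v]
      unfolding second_derivative_def[abs_def] Ck_on_2_iff by blast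
    moreover have "(?P has_derivative ?D) (at v)"
      using P v by (auto simp: Ck_on_2_iff has_derivative_frechet)
    ultimately have "((\<lambda>y. trace (matrix_inv (?P y) ** frechet_derivative ?P (at y) a)) has_derivative
        (\<lambda>b. trace (?J ** second_derivative ?P v a b + - (?J ** ?D b ** ?J) ** ?D a))) (at v)"
      by (intro bounded_linear.has_derivative[OF bounded_linear_trace]
          bounded_bilinear.FDERIV[OF bounded_bilinear_matrix_mult] has_derivative_matrix_inv[OF open_dom v P_inv])
    then have "((\<lambda>y. 0) has_derivative
        (\<lambda>b. trace (?J ** second_derivative ?P v a b + - (?J ** ?D b ** ?J) ** ?D a))) (at v)"
      by (rule has_derivative_transform_within_open[OF _ open_dom v]) (rule trace_inv_Phi_lift_derivative)
    from fun_cong[OF has_derivative_unique[OF this has_derivative_const], of b]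
    have "trace (?J ** second_derivative ?P v a b) = trace (?J ** ?D b ** (?J ** ?D a))"
      by (simp add: matrix_mult_minus trace_add trace_minus trace_sub matrix_mul_assoc)
    moreover have "trace (?J ** ?D a ** (?J ** ?D b)) = trace (?J ** ?D b ** (?J ** ?D a))"
      by (rule trace_mul_sym)
    ultimately show ?thesis
      by (simp add: H_def matrix_mult_diff matrix_scaleR_mult matrix_add_ldistrib trace_sub trace_scaleR trace_add
          matrix_mul_assoc)
  qed
  have \<Gamma>: "?D (\<Gamma> a b) = H a b" for a b
  proof -
    have "trace (?K ** H a b ** transpose ?K) = trace (transpose ?K ** ?K ** H a b)"
      by (rule trace_cyclic3(1))
    also have "\<dots> = 0" using H_trace[of a b] by (simp add: matrix_inv_Phi_lift[OF v])
    finally have "(1/2) *\<^sub>R (?K ** H a b ** transpose ?K) \<in> sym_traceless"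
      by (simp add: sym_traceless_def transpose_scalar matrix_transpose_mul H_sym matrix_mul_assoc trace_scaleR)
    from q[OF v this] have "?D (\<Gamma> a b) = (\<sigma> v ** ?K) ** H a b ** (transpose ?K ** transpose (\<sigma> v))"
      unfolding Phi_lift_derivative[OF v] \<Gamma>_def by (simp add: matrix_scaleR_mult matrix_mul_assoc)
    then show ?thesis by (simp add: lift_transpose_inv[OF v] matrix_inv_mult lift_invertible[OF v])
  qed
  \<comment> \<open>Here the frame is its own dual. The reconstruction identity is checked after
    applying the injective \<open>p_component\<close>, where it is the tight frame
    expansion.\<close>
  have "framed_metric V (pullback_metric (1/4) ?P) v UNIV (\<lambda>p. q v (?F p)) (\<lambda>p. q v (?F p)) \<Gamma>"
  proof (rule framed_metric_pullback[OF open_dom v P_inv P, where e = "\<lambda>y p. q y (?F p)" and e' = "\<lambda>y p. q y (?F p)"])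
    show "?D (\<Gamma> a b) = second_derivative ?P v a b - (1/2) *\<^sub>R (?D a ** ?J ** ?D b + ?D b ** ?J ** ?D a)" for a b
      by (simp add: \<Gamma> H_def)
    fix y w assume y: "y \<in> V"
    have "p_component \<sigma> y (\<Sum>p\<in>UNIV. quotient_metric \<sigma> y w (q y (?F p)) *\<^sub>R q y (?F p))
        = (\<Sum>p\<in>UNIV. trace (p_component \<sigma> y w ** ?F p) *\<^sub>R ?F p)"
      by (simp add: linear_sum[OF linear_p_component[OF y]] linear_scale[OF linear_p_component[OF y]]
          quotient_metric_def q[OF y sym_frame_traceless])
    also have "\<dots> = p_component \<sigma> y w"
      by (rule matrix_eq_sum_sym_frame[OF p_component_traceless[OF y], symmetric])
    finally show "w = (\<Sum>p\<in>UNIV. pullback_metric (1/4) ?P y w (q y (?F p)) *\<^sub>R q y (?F p))"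
      using inj[OF y] by (simp add: quotient_metric_eq_pullback[OF y])
  qed auto
  then interpret framed_metric V "quotient_metric \<sigma>" v UNIV "\<lambda>p. q v (?F p)" "\<lambda>p. q v (?F p)" \<Gamma>
    by (rule framed_metric_cong) (rule quotient_metric_eq_pullback)
  have det: "det (\<sigma> y) \<noteq> 0" if "y \<in> V" for y using lift_det[OF that] by simp
  note pos = Phi_diag_pos[OF det] Phi_minor_pos[OF det kl]
  have De: "?D (q v (?F p)) = 2 *\<^sub>R (\<sigma> v ** ?F p ** transpose (\<sigma> v))" for p
    by (simp add: Phi_lift_derivative[OF v] q[OF v sym_frame_traceless])
  show ?thesis
    using f unfolding phi_psi_ratio_eq
  proof (intro isotropic_root_harmonic[where P = ?P and x = "\<sigma> v" and E = ?F and k = k and l = l])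
    show "Ck_on 2 (\<lambda>y. gram_ratio k l (?P y)) V"
      by (rule Ck_on_gram_ratio[OF open_dom P]) (use pos in auto)
    show "of_real (?P v $ l $ l) * gram_ratio k l (?P v) \<noteq> of_real (?P v $ k $ l)"
      using pos[OF v] by (intro gram_ratio_simple) auto
    show "of_real (?P y $ l $ l) * (gram_ratio k l (?P y))\<^sup>2 - 2 * of_real (?P y $ k $ l) * gram_ratio k l (?P y)
       + of_real (?P y $ k $ k) = 0" if "y \<in> V" for y
      using pos[OF that] by (intro gram_ratio_root) auto
    show "casimir (2 * ?c - real CARD('n) * ?c\<^sup>2) UNIV ?F" by (rule casimir_sym_frame)
    fix p
    have J_cancel: "A ** transpose (\<sigma> v) ** ?J ** \<sigma> v = A" for A :: "real^'n^'n"
    proof -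
      have "A ** transpose (\<sigma> v) ** ?J ** \<sigma> v = A ** (transpose (\<sigma> v) ** transpose ?K) ** (?K ** \<sigma> v)"
        by (simp only: matrix_inv_Phi_lift[OF v] matrix_mul_assoc)
      then show ?thesis by (simp add: lift_transpose_inv[OF v] matrix_inv_mult lift_invertible[OF v])
    qed
    \<comment> \<open>By the choice of \<open>\<Gamma>\<close> the difference is dP(e) P^-1 dP(e);
      the inner factors \<sigma>^t P^-1 \<sigma> cancel and 4 = 2 * 2 remains.\<close>
    show "second_derivative ?P v (q v (?F p)) (q v (?F p)) - ?D (\<Gamma> (q v (?F p)) (q v (?F p)))
        = 4 *\<^sub>R (\<sigma> v ** (?F p ** ?F p) ** transpose (\<sigma> v))"
      by (simp add: \<Gamma> H_def De matrix_scaleR_mult matrix_mul_assoc J_cancel flip: scaleR_add_left)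
  qed (simp_all add: P De Phi_def[of "\<sigma> v"] transpose_sym_frame)
qed

end

section \<open>Invariance, the induced map and the conclusion\<close>

lemma Phi_mult_SO: "K \<in> SO \<Longrightarrow> Phi (x ** K) = Phi x"
  unfolding Phi_def SO_def rotation_matrix_def orthogonal_matrix_def
  by (simp add: matrix_transpose_mul) (metis (no_types, lifting) matrix_left_right_inverse matrix_mul_assoc matrix_mul_rid)

lemma phi_psi_ratio_mult_SO: "K \<in> SO \<Longrightarrow> phi_psi_ratio k l (x ** K) = phi_psi_ratio k l x"
  by (simp add: phi_psi_ratio_eq Phi_mult_SO)

text \<open>Entries of \<open>Phi\<close> scale by \<open>r^2\<close> and minors by
  \<open>r^4\<close>, so the numerator and the denominator have the same degree.\<close>

lemma phi_psi_ratio_scale: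
  assumes "r > 0" shows "phi_psi_ratio k l (r *\<^sub>R x) = phi_psi_ratio k l x"
proof -
  have P: "Phi (r *\<^sub>R x) $ i $ j = r\<^sup>2 * Phi x $ i $ j" for i j
    by (simp add: Phi_def transpose_scalar matrix_scaleR_mult power2_eq_square)
  have "(r\<^sup>2 * a) * (r\<^sup>2 * b) - (r\<^sup>2 * c)\<^sup>2 = (r\<^sup>2)\<^sup>2 * (a * b - c\<^sup>2)" for a b c
    by (simp add: algebra_simps power2_eq_square)
  then have s: "sqrt ((r\<^sup>2 * a) * (r\<^sup>2 * b) - (r\<^sup>2 * c)\<^sup>2) = r\<^sup>2 * sqrt (a * b - c\<^sup>2)" for a b c
    by (simp only: real_sqrt_mult real_sqrt_abs) simp
  have q: "(complex_of_real (r\<^sup>2 * a) + \<i> * of_real (r\<^sup>2 * b)) / of_real (r\<^sup>2 * c)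
      = (of_real a + \<i> * of_real b) / of_real c" for a b c
  proof -
    have "complex_of_real (r\<^sup>2 * a) + \<i> * of_real (r\<^sup>2 * b) = of_real (r\<^sup>2) * (of_real a + \<i> * of_real b)"
      by (simp add: algebra_simps)
    then show ?thesis using assms by simp
  qed
  show ?thesis unfolding phi_psi_ratio_eq gram_ratio_def P s q ..
qed

lemma induced_phi_psi_ratio: "induced (phi_psi_ratio k l) (coset x) = phi_psi_ratio k l x"
proof -
  have "mat 1 \<in> (SO :: (real^'n^'n) set)" by (simp add: SO_def rotation_matrix_def orthogonal_matrix_id)
  then have "phi_psi_ratio k l ` coset x = {phi_psi_ratio k l x}"
    by (auto simp: coset_def image_image phi_psi_ratio_mult_SO)
  then show ?thesis by (simp add: induced_def)
qed

lemma Ck_on_phi_psi_ratio: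
  assumes "open V" "Ck_on m \<sigma> V" "\<And>y. y \<in> V \<Longrightarrow> det (\<sigma> y) \<noteq> 0" "k \<noteq> l"
  shows "Ck_on m (\<lambda>y. phi_psi_ratio k l (\<sigma> y)) V"
  unfolding phi_psi_ratio_eq
  by (intro Ck_on_gram_ratio Ck_on_Phi assms(1,2) Phi_diag_pos Phi_minor_pos assms(3,4))

theorem theorem4p1:
  fixes k l :: "'n::finite"
  assumes "k \<noteq> l"
    and "DIM('m::euclidean_space) = dim (sym_traceless :: (real^'n^'n) set)"
  shows
    "(\<forall>x \<in> (GL_pos :: (real^'n^'n) set).
        (\<forall>K\<in>SO. Phi (x ** K) = Phi x \<and> Psi (x ** K) = Psi x) \<and>
        (\<forall>i j. Phi x $ i $ i * Phi x $ j $ j - (Phi x $ i $ j)\<^sup>2 \<ge> 0) \<and>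
        Phi x $ l $ l \<noteq> 0) \<and>
     (\<forall>x \<in> GL_pos. (\<forall>K\<in>SO. phi_psi_ratio k l (x ** K) = phi_psi_ratio k l x) \<and>
        (\<forall>r>0. phi_psi_ratio k l (r *\<^sub>R x) = phi_psi_ratio k l x)) \<and>
     harmonic_morphism GL_manifold complex_plane (phi_psi_ratio k l) \<and>
     points (SL_mod_SO :: ('m, (real^'n^'n) set) atlas) = coset ` SL \<and>
     (\<forall>x \<in> SL. induced (phi_psi_ratio k l) (coset x) = phi_psi_ratio k l x) \<and>
     harmonic_morphism (SL_mod_SO :: ('m, (real^'n^'n) set) atlas) complex_plane
       (induced (phi_psi_ratio k l))"
proof (intro conjI ballI allI impI)
  fix x :: "real^'n^'n" assume "x \<in> GL_pos"
  then have det: "det x \<noteq> 0" by (simp add: GL_pos_def)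
  show "Phi x $ l $ l \<noteq> 0" using Phi_diag_pos[OF det, of l] by simp
  show "Phi x $ i $ i * Phi x $ j $ j - (Phi x $ i $ j)\<^sup>2 \<ge> 0" for i j by (rule Phi_minor_nonneg)
  show "Phi (x ** K) = Phi x" "Psi (x ** K) = Psi x"
    "phi_psi_ratio k l (x ** K) = phi_psi_ratio k l x" if "K \<in> SO" for K
    using that by (simp_all add: Psi_def Phi_mult_SO phi_psi_ratio_mult_SO)
  show "phi_psi_ratio k l (r *\<^sub>R x) = phi_psi_ratio k l x" if "r > 0" for r
    using that by (rule phi_psi_ratio_scale)
next
  show "harmonic_morphism GL_manifold complex_plane (phi_psi_ratio k l :: real^'n^'n \<Rightarrow> complex)"
  proof (rule harmonic_morphism_chartsI)
    fix V p and g :: "(real^'n^'n) metric" assume "(V, p, g) \<in> GL_manifold"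
    then have c: "V = GL_pos" "p = (\<lambda>x::real^'n^'n. x)" "g = GL_metric" by (auto simp: GL_manifold_def)
    show "open V" by (simp add: c open_GL_pos)
    have "Ck_on m (\<lambda>y::real^'n^'n. phi_psi_ratio k l y) GL_pos" for m
      by (rule Ck_on_phi_psi_ratio[OF open_GL_pos Ck_on_linear[OF open_GL_pos bounded_linear_ident] _ assms(1)])
         (simp add: GL_pos_def)
    then show "smooth_on V (phi_psi_ratio k l \<circ> p)" by (simp add: c smooth_on_def comp_def)
    show "laplacian g (\<lambda>y. f (phi_psi_ratio k l (p y))) v = 0"
      if "open U" "harmonic_on complex_plane U f" "v \<in> V" "phi_psi_ratio k l (p v) \<in> U" for U f v
      using laplacian_GL_compose_ratio[OF _ assms(1) that(1,2)] that by (simp add: c)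
  qed
next
  show "points (SL_mod_SO :: ('m, (real^'n^'n) set) atlas) = coset ` SL"
    using assms(2) by (rule points_SL_mod_SO)
  show "induced (phi_psi_ratio k l) (coset x) = phi_psi_ratio k l x" for x :: "real^'n^'n"
    by (rule induced_phi_psi_ratio)
  show "harmonic_morphism (SL_mod_SO :: ('m, (real^'n^'n) set) atlas) complex_plane
       (induced (phi_psi_ratio k l))"
  proof (rule harmonic_morphism_chartsI)
    fix V and p :: "'m \<Rightarrow> (real^'n^'n) set" and g assume "(V, p, g) \<in> SL_mod_SO"
    then obtain \<sigma> where c: "p = (\<lambda>v. coset (\<sigma> v))" "g = quotient_metric \<sigma>"
      and \<sigma>: "open V" "smooth_on V \<sigma>" "\<sigma> ` V \<subseteq> SL"
        "\<forall>v\<in>V. bij_betw (p_component \<sigma> v) UNIV sym_traceless"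
      by (auto simp: SL_mod_SO_def)
    show "open V" by fact
    have "Ck_on m (\<lambda>y. phi_psi_ratio k l (\<sigma> y)) V" for m
      using \<sigma>(2,3) by (intro Ck_on_phi_psi_ratio \<sigma>(1) assms(1)) (auto simp: smooth_on_def SL_def)
    then show "smooth_on V (induced (phi_psi_ratio k l) \<circ> p)"
      by (simp add: c smooth_on_def comp_def induced_phi_psi_ratio)
    show "laplacian g (\<lambda>y. f (induced (phi_psi_ratio k l) (p y))) v = 0"
      if "open U" "harmonic_on complex_plane U f" "v \<in> V" "induced (phi_psi_ratio k l) (p v) \<in> U" for U f v
      using laplacian_chart_compose_ratio[OF \<sigma> that(3) assms(1) that(1,2)] that(4)
      by (simp add: c induced_phi_psi_ratio)
  qed
qed

end
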